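(* Let $f(\zeta,t)$, $0\le t<\infty$, be a global in time locally univalent solution of the Polubarinova-Galin equation with $q(t)>0$ and $Q(t)=\int_0^tq(s)\,ds\to\infty$ as $t\to\infty$, of the form $$f(\zeta,t)=\sum_{j=1}^\ell e_j\log\left(1-\frac{\zeta}{\zeta_j(t)}\right)+\frac{\sum_{j=1}^{m-\ell+1}b_j(t)\zeta^j}{\sum_{j=0}^{n-\ell}c_j(t)\zeta^j}$$ (so that $g=f'$ is rational). Assume that, for an integer $r\ge1$, the harmonic moments satisfy $M_1=\dots=M_{r-1}=0$ and $M_r\ne0$. Then $$\lim_{t\to\infty}\sup_{\zeta\in\partial\mathbb{D}}\left|\left[f(\zeta,t)-\sqrt{2Q(t)+M_0(0)}\,\zeta\right]\left(\sqrt{2Q(t)}\right)^{r+1}-\overline{M_r}\,\zeta^{r+1}\right|=0.$$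
   Context: $\mathbb{D}$ is the open unit disk; dot denotes $\partial/\partial t$ and prime denotes $\partial/\partial\zeta$. Locally univalent solution: for each $t$, $f(\cdot,t)$ is analytic in a neighborhood of $\overline{\mathbb{D}}$, $f(0,t)=0$, $f'(0,t)>0$, $f'(\zeta,t)\ne0$ for $\zeta\in\overline{\mathbb{D}}$, $f$ depends smoothly on $t$, and the Polubarinova-Galin equation $\operatorname{Re}[\dot f(\zeta,t)\overline{\zeta f'(\zeta,t)}]=q(t)$ holds for $\zeta\in\partial\mathbb{D}$, where $q$ is a given continuous function. Form of $g=f'$: $g(\zeta,t)=b(t)\prod_{k=1}^m(\zeta-\omega_k(t))\big/\prod_{j=1}^\ell(\zeta-\zeta_j(t))^{n_j}$ with $b(t)\neq 0$, $|\omega_k|>1$, $\zeta_1,\dots,\zeta_\ell$ distinct with $|\zeta_j|>1$, no zero coinciding with a pole, $n_j\ge1$, $n=\sum_{j=1}^\ell n_j\le m$. This form is preserved in time, with the sole exception that when $m=n$ the degree of the numerator may drop below $n$ at one moment of time. The constants $e_j$ are the residues of $g(\zeta)d\zeta$ at $\zeta_j$; they do not depend on $t$ and may be zero. The denominator is $\sum_{j=0}^{n-\ell}c_j\zeta^j=\prod_{j=1}^\ell(1-\zeta/\zeta_j)^{n_j-1}$, and the logarithms are the branches in $\overline{\mathbb{D}}$ vanishing at $\zeta=0$. Harmonic moments: $M_k(t)=\frac{1}{2\pi i}\int_{\partial\mathbb{D}}f(\zeta,t)^kf^*(\zeta,t)f'(\zeta,t)\,d\zeta$ with $f^*(\zeta,t)=\overline{f(1/\bar\zeta,t)}$;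 for $k\ge1$ these are independent of $t$, and $M_0(t)=M_0(0)+2Q(t)$. *)

theory Defs
  imports "HOL-Complex_Analysis.Complex_Analysis"
begin

text \<open>
  Families are functions \<open>f z t\<close> of a space variable \<open>z\<close> and a time \<open>t\<close>; only times \<open>t \<ge> 0\<close> matter.
\<close>

definition space_deriv :: "(complex \<Rightarrow> real \<Rightarrow> complex) \<Rightarrow> complex \<Rightarrow> real \<Rightarrow> complex" where
  "space_deriv f z t = deriv (\<lambda>w. f w t) z"

text \<open>The time derivative is one-sided at \<open>t = 0\<close>.\<close>

definition time_deriv :: "(complex \<Rightarrow> real \<Rightarrow> complex) \<Rightarrow> complex \<Rightarrow> real \<Rightarrow> complex" where
  "time_deriv f z t = vector_derivative (\<lambda>s. f z s) (at t within {0..})"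

text \<open>
  Smooth dependence on \<open>t\<close> is taken to be \<open>C\<^sup>1\<close> regularity on the closed disk times \<open>[0,\<infinity>)\<close>.
  More cannot be expected in time when \<open>q\<close> is merely continuous.
\<close>

definition smooth_in_time :: "(complex \<Rightarrow> real \<Rightarrow> complex) \<Rightarrow> bool" where
  "smooth_in_time f \<longleftrightarrow>
     (\<forall>z\<in>cball 0 1. \<forall>t\<ge>0. (\<lambda>s. f z s) differentiable (at t within {0..})) \<and>
     continuous_on (cball 0 1 \<times> {0..}) (\<lambda>(z, t). time_deriv f z t) \<and>
     continuous_on (cball 0 1 \<times> {0..}) (\<lambda>(z, t). space_deriv f z t)"

definition locally_univalent_solution ::
    "(real \<Rightarrow> real) \<Rightarrow> (complex \<Rightarrow> real \<Rightarrow> complex) \<Rightarrow> bool" where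
  "locally_univalent_solution q f \<longleftrightarrow>
     (\<forall>t\<ge>0. (\<lambda>z. f z t) analytic_on cball 0 1) \<and>
     (\<forall>t\<ge>0. f 0 t = 0) \<and>
     (\<forall>t\<ge>0. Im (space_deriv f 0 t) = 0 \<and> Re (space_deriv f 0 t) > 0) \<and>
     (\<forall>t\<ge>0. \<forall>z\<in>cball 0 1. space_deriv f z t \<noteq> 0) \<and>
     smooth_in_time f \<and>
     (\<forall>t\<ge>0. \<forall>z\<in>sphere 0 1. Re (time_deriv f z t * cnj (z * space_deriv f z t)) = q t)"

definition accumulated :: "(real \<Rightarrow> real) \<Rightarrow> real \<Rightarrow> real" where
  "accumulated q t = integral {0..t} q"

definition reflected :: "(complex \<Rightarrow> real \<Rightarrow> complex) \<Rightarrow> complex \<Rightarrow> real \<Rightarrow> complex" where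
  "reflected f z t = cnj (f (1 / cnj z) t)"

text \<open>
  The moment of order 0 is a positive real number (the normalized area of the image, counted with
  multiplicity), so that square roots of it plus a nonnegative real agree with \<open>csqrt\<close>.
  On the unit circle \<open>reflected f z t\<close> is the conjugate of \<open>f z t\<close>.
\<close>

definition harmonic_moment :: "(complex \<Rightarrow> real \<Rightarrow> complex) \<Rightarrow> nat \<Rightarrow> real \<Rightarrow> complex" where
  "harmonic_moment f k t =
     1 / (2 * of_real pi * \<i>) *
     contour_integral (circlepath 0 1) (\<lambda>z. f z t ^ k * reflected f z t * space_deriv f z t)"

definition rational_fun ::
    "nat \<Rightarrow> nat \<Rightarrow> (nat \<Rightarrow> nat) \<Rightarrow> complex \<Rightarrow> (nat \<Rightarrow> complex) \<Rightarrow> (nat \<Rightarrow> complex) \<Rightarrow>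
     complex \<Rightarrow> complex" where
  "rational_fun d l \<nu> b \<omega> \<zeta> z =
     b * (\<Prod>k=1..d. z - \<omega> k) / (\<Prod>j=1..l. (z - \<zeta> j) ^ \<nu> j)"

definition admissible ::
    "nat \<Rightarrow> nat \<Rightarrow> complex \<Rightarrow> (nat \<Rightarrow> complex) \<Rightarrow> (nat \<Rightarrow> complex) \<Rightarrow> bool" where
  "admissible d l b \<omega> \<zeta> \<longleftrightarrow>
     b \<noteq> 0 \<and>
     (\<forall>k\<in>{1..d}. cmod (\<omega> k) > 1) \<and>
     (\<forall>j\<in>{1..l}. cmod (\<zeta> j) > 1) \<and>
     inj_on \<zeta> {1..l} \<and>
     (\<forall>k\<in>{1..d}. \<forall>j\<in>{1..l}. \<omega> k \<noteq> \<zeta> j)"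

text \<open>
  The derivative of \<open>f\<close> is rational with \<open>m\<close> zeros and with poles \<open>\<zeta> j t\<close> of fixed orders \<open>\<nu> j\<close>,
  \<open>n\<close> being the total order. The degree \<open>d t\<close> of the numerator equals \<open>m\<close>, except that for
  \<open>m = n\<close> it may be smaller at one moment \<open>T\<close>. Repetitions among the zeros are allowed.
\<close>

definition rational_derivative ::
    "(complex \<Rightarrow> real \<Rightarrow> complex) \<Rightarrow> nat \<Rightarrow> nat \<Rightarrow> (nat \<Rightarrow> nat) \<Rightarrow> (real \<Rightarrow> nat) \<Rightarrow>
     (real \<Rightarrow> complex) \<Rightarrow> (nat \<Rightarrow> real \<Rightarrow> complex) \<Rightarrow> (nat \<Rightarrow> real \<Rightarrow> complex) \<Rightarrow> bool" where
  "rational_derivative f m l \<nu> d b \<omega> \<zeta> \<longleftrightarrow>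
     (let n = (\<Sum>j=1..l. \<nu> j) in
       (\<forall>j\<in>{1..l}. \<nu> j \<ge> 1) \<and> n \<le> m \<and>
       (\<exists>T. \<forall>t\<ge>0. d t = m \<or> (m = n \<and> t = T \<and> d t < n))) \<and>
     (\<forall>t\<ge>0. admissible (d t) l (b t) (\<lambda>k. \<omega> k t) (\<lambda>j. \<zeta> j t)) \<and>
     (\<forall>t\<ge>0. \<forall>z\<in>cball 0 1.
        space_deriv f z t = rational_fun (d t) l \<nu> (b t) (\<lambda>k. \<omega> k t) (\<lambda>j. \<zeta> j t) z)"

end

theory Submission imports Defs begin

text \<open>
  Write \<open>a\<^sub>k\<close> for the Taylor coefficients of \<open>f\<close>, \<open>a = a\<^sub>1\<close>, and \<open>L\<^sub>t(u)\<close> for the mean of \<open>u \<cdot> cnj f \<cdot> z f'\<close> over the unit circle, so that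
  \<open>M\<^sub>k = L\<^sub>t(f\<^sup>k)\<close>. The equation says that \<open>df/dt = z f' P\<close> with \<open>Re P > 0\<close>, so \<open>f\<close> is a subordination chain:
  \<open>f(\<cdot>,0) = f(\<phi>,t)\<close> for a self-map \<open>\<phi>\<close> of the disk. Moment conservation takes the stronger form
  \<open>L\<^sub>t(\<Psi>) = 2 Q \<Psi>(0) + L\<^sub>0(\<Psi> \<circ> \<phi>)\<close> for all holomorphic \<open>\<Psi>\<close>, not only for the powers of \<open>f\<close>.

  For \<open>\<Psi> = 1\<close> this is the growth law of the area \<open>\<Sum> k \<bar>a\<^sub>k\<bar>\<^sup>2\<close>. Since \<open>Re P(0)\<close> is \<open>q\<close> times the mean of
  \<open>1/\<bar>f'\<bar>\<^sup>2\<close>, which is at least \<open>1/a\<^sup>2\<close>, also \<open>a\<^sup>2\<close> grows at least as fast as \<open>2 Q\<close>; hence \<open>a\<^sub>k\<close> stays bounded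
  for \<open>k \<ge> 2\<close> while \<open>a \<rightarrow> \<infinity>\<close>. So \<open>f/a\<close> is close to the identity near \<open>0\<close>, and as the image of \<open>\<phi>\<close> is
  connected, \<open>\<phi> = O(1/a)\<close> on the whole disk. For \<open>\<Psi> = z\<^sup>p/f'\<close> the left-hand side is the conjugate of \<open>a\<^bsub>p+1\<^esub>\<close>.
  Expanding \<open>\<Psi> \<circ> \<phi>\<close> in powers of \<open>f(\<cdot>,0)\<close> by Lagrange inversion expresses it through the moments
  \<open>M\<^sub>0, \<dots>, M\<^sub>r\<close> up to \<open>O(a\<^bsup>-r-2\<^esup>)\<close>.
\<close>

section \<open>Means over circles\<close>

text \<open>As \<open>f(\<cdot>,t)\<close> is only locally univalent, it has no inverse on its
  image, so \<open>z\<^sup>p/f'\<close> cannot be expanded in powers of \<open>f\<close> on the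
  whole disk. Composition with \<phi> removes the obstacle: \<phi> maps the whole disk close to 0,
  where \<open>f(\<cdot>,t)\<close> is injective once \<open>a\<close> is large. For this reason
  \<phi> is built on the whole disk, by integrating \<open>dz/dt = -z P\<close>;
  \<open>Re P \<ge> 0\<close> keeps trajectories inside.

  \<open>P\<close> has Lipschitz bounds only on smaller disks and \<phi> is known only in the open
  disk. Identities are therefore proved on circles of radius \<rho> < 1, where the boundary equation
  holds up to an error that vanishes as \<rho> tends to 1.

  Degrees above r + 1 are infinite in number and need a separate bound that is geometric in the
  degree.\<close>

definition circle_mean :: "real \<Rightarrow> (complex \<Rightarrow> complex) \<Rightarrow> complex" where
  "circle_mean \<rho> F = integral {0..1} (\<lambda>x. F (of_real \<rho> * exp (2 * of_real pi * \<i> * of_real x)))"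

lemma norm_circle_point [simp]: "norm (exp (2 * of_real pi * \<i> * of_real x)) = 1"
  by (simp add: norm_exp_eq_Re)

text \<open>On the circle dz is \<open>2 * pi * \<i> * z\<close> times the differential of the
  parameter. Written as means, integrals containing \<open>cnj\<close> can be added, bounded and
  differentiated like those of holomorphic integrands.\<close>

lemma contour_integral_circlepath_mean:
  "contour_integral (circlepath 0 \<rho>) g = 2 * of_real pi * \<i> * circle_mean \<rho> (\<lambda>z. z * g z)"
proof -
  have "contour_integral (circlepath 0 \<rho>) g =
      integral {0..1} (\<lambda>x. (2 * of_real pi * \<i>) * (let z = of_real \<rho> * exp (2 * of_real pi * \<i> * of_real x) in z * g z))"
    unfolding contour_integral_integral vector_derivative_circlepath
    by (simp add: circlepath Let_def mult_ac)
  also have "\<dots> = 2 * of_real pi * \<i> * circle_mean \<rho> (\<lambda>z. z * g z)"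
    unfolding circle_mean_def Let_def by (rule integral_mult_right)
  finally show ?thesis .
qed

lemma circle_mean_cong:
  assumes "\<And>z. norm z = \<rho> \<Longrightarrow> F z = G z" "\<rho> \<ge> 0"
  shows "circle_mean \<rho> F = circle_mean \<rho> G"
  unfolding circle_mean_def using assms by (intro integral_cong) (simp add: norm_mult)

lemma continuous_on_circle_param:
  assumes "continuous_on (sphere 0 \<rho>) F" "\<rho> \<ge> 0"
  shows "continuous_on A (\<lambda>x. F (of_real \<rho> * exp (2 * of_real pi * \<i> * of_real x)))"
  by (rule continuous_on_compose2[OF assms(1)])
     (use assms in \<open>auto intro!: continuous_intros simp: norm_mult\<close>)

lemma integrable_circle_param:
  fixes F :: "complex \<Rightarrow> 'a::banach"
  assumes "continuous_on (sphere 0 \<rho>) F" "\<rho> \<ge> 0"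
  shows "(\<lambda>x. F (of_real \<rho> * exp (2 * of_real pi * \<i> * of_real x))) integrable_on {0..1}"
  by (rule integrable_continuous_real) (rule continuous_on_circle_param[OF assms])

lemma circle_mean_add:
  assumes "continuous_on (sphere 0 \<rho>) F" "continuous_on (sphere 0 \<rho>) G" "\<rho> \<ge> 0"
  shows "circle_mean \<rho> (\<lambda>z. F z + G z) = circle_mean \<rho> F + circle_mean \<rho> G"
  unfolding circle_mean_def using assms
  by (intro Henstock_Kurzweil_Integration.integral_add integrable_circle_param)

lemma circle_mean_diff:
  assumes "continuous_on (sphere 0 \<rho>) F" "continuous_on (sphere 0 \<rho>) G" "\<rho> \<ge> 0"
  shows "circle_mean \<rho> (\<lambda>z. F z - G z) = circle_mean \<rho> F - circle_mean \<rho> G"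
  unfolding circle_mean_def using assms
  by (intro Henstock_Kurzweil_Integration.integral_diff integrable_circle_param)

lemma circle_mean_mult: "circle_mean \<rho> (\<lambda>z. c * F z) = c * circle_mean \<rho> F"
  unfolding circle_mean_def by (rule integral_mult_right)

lemma circle_mean_cnj: "circle_mean \<rho> (\<lambda>z. cnj (F z)) = cnj (circle_mean \<rho> F)"
  unfolding circle_mean_def by (simp add: integral_cnj)

lemma circle_mean_sum:
  assumes "finite I" "\<And>i. i \<in> I \<Longrightarrow> continuous_on (sphere 0 \<rho>) (F i)" "\<rho> \<ge> 0"
  shows "circle_mean \<rho> (\<lambda>z. \<Sum>i\<in>I. F i z) = (\<Sum>i\<in>I. circle_mean \<rho> (F i))"
  unfolding circle_mean_def using assms
  by (intro Henstock_Kurzweil_Integration.integral_sum integrable_circle_param) auto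

lemma norm_circle_mean_le:
  assumes "continuous_on (sphere 0 \<rho>) F" "\<rho> \<ge> 0" "\<And>z. norm z = \<rho> \<Longrightarrow> norm (F z) \<le> B"
  shows "norm (circle_mean \<rho> F) \<le> B"
proof -
  have "norm (circle_mean \<rho> F) \<le> B * (1 - 0)"
    unfolding circle_mean_def
    using assms by (intro integral_bound continuous_on_circle_param) (auto simp: norm_mult)
  then show ?thesis by simp
qed

lemma Re_circle_mean_mono:
  assumes "continuous_on (sphere 0 \<rho>) F" "continuous_on (sphere 0 \<rho>) G" "\<rho> \<ge> 0"
    and "\<And>z. norm z = \<rho> \<Longrightarrow> Re (F z) \<le> Re (G z)"
  shows "Re (circle_mean \<rho> F) \<le> Re (circle_mean \<rho> G)"
proof -
  have *: "Re (circle_mean \<rho> H) =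
      integral {0..1} (\<lambda>x. Re (H (of_real \<rho> * exp (2 * of_real pi * \<i> * of_real x))))"
    if "continuous_on (sphere 0 \<rho>) H" for H
    unfolding circle_mean_def
    using integral_linear[OF integrable_circle_param[OF that assms(3)] bounded_linear_Re]
    by (simp add: o_def)
  show ?thesis
    unfolding *[OF assms(1)] *[OF assms(2)]
    by (intro integral_le integrable_continuous_real continuous_on_Re continuous_on_circle_param assms)
      (auto simp: norm_mult assms)
qed

lemma Cauchy_circle_mean:
  assumes "continuous_on (cball 0 \<rho>) F" "F holomorphic_on ball 0 \<rho>" "norm w < \<rho>"
  shows "circle_mean \<rho> (\<lambda>z. z * (F z / (z - w))) = F w"
  using Cauchy_integral_circlepath[OF assms(1,2), of w, THEN contour_integral_unique] assms(3)
  by (simp add: contour_integral_circlepath_mean)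

lemma circle_mean_holomorphic:
  assumes "continuous_on (cball 0 \<rho>) F" "F holomorphic_on ball 0 \<rho>" "\<rho> > 0"
  shows "circle_mean \<rho> F = F 0"
proof -
  have "circle_mean \<rho> F = circle_mean \<rho> (\<lambda>z. z * (F z / (z - 0)))"
    by (rule circle_mean_cong) (use assms in auto)
  then show ?thesis using Cauchy_circle_mean[OF assms(1,2), of 0] assms(3) by simp
qed

text \<open>On the unit circle \<open>cnj z\<close> equals \<open>1 / z\<close>, which turns the
  mean into Cauchy's integral for a derivative at 0.\<close>

lemma circle_mean_coeff:
  assumes "continuous_on (cball 0 1) F" "F holomorphic_on ball 0 1"
  shows "circle_mean 1 (\<lambda>z. F z * cnj z ^ k) = (deriv ^^ k) F 0 / fact k"
proof -
  have "circle_mean 1 (\<lambda>z. F z * cnj z ^ k) = circle_mean 1 (\<lambda>z. z * (F z / (z - 0) ^ Suc k))"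
  proof (rule circle_mean_cong)
    fix z :: complex assume z: "norm z = 1"
    then have "z * cnj z = 1" by (simp add: complex_norm_square[symmetric])
    then have "cnj z = 1 / z" using z by (metis mult_eq_0_iff nonzero_eq_divide_eq mult.commute zero_neq_one)
    then show "F z * cnj z ^ k = z * (F z / (z - 0) ^ Suc k)"
      using z by (auto simp: field_simps)
  qed auto
  also have "2 * of_real pi * \<i> * \<dots> = 2 * of_real pi * \<i> / fact k * (deriv ^^ k) F 0"
    using Cauchy_has_contour_integral_higher_derivative_circlepath[OF assms, of 0 k, THEN contour_integral_unique]
    by (simp add: contour_integral_circlepath_mean)
  finally show ?thesis by (simp add: field_simps)
qed

lemma circle_mean_continuous_param:
  fixes F :: "'a::topological_space \<Rightarrow> complex \<Rightarrow> complex"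
  assumes "continuous_on (U \<times> sphere 0 \<rho>) (\<lambda>(x, z). F x z)" "\<rho> \<ge> 0"
  shows "continuous_on U (\<lambda>x. circle_mean \<rho> (F x))"
proof -
  have "continuous_on (U \<times> cbox 0 (1::real))
      (\<lambda>p. (\<lambda>(x, z). F x z) (fst p, of_real \<rho> * exp (2 * of_real pi * \<i> * of_real (snd p))))"
    by (rule continuous_on_compose2[OF assms(1)])
       (use assms in \<open>auto intro!: continuous_intros simp: norm_mult\<close>)
  then have "continuous_on (U \<times> cbox 0 (1::real))
      (\<lambda>(x, t). F x (of_real \<rho> * exp (2 * of_real pi * \<i> * of_real t)))"
    by (simp add: case_prod_beta)
  from integral_continuous_on_param[OF this] show ?thesis
    by (simp add: circle_mean_def)
qed

lemma circle_mean_has_vector_derivative: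
  fixes F :: "real \<Rightarrow> complex \<Rightarrow> complex"
  assumes "\<And>s z. s \<in> U \<Longrightarrow> norm z = \<rho> \<Longrightarrow> ((\<lambda>s. F s z) has_vector_derivative F' s z) (at s within U)"
    and "\<And>s. s \<in> U \<Longrightarrow> continuous_on (sphere 0 \<rho>) (F s)"
    and "continuous_on (U \<times> sphere 0 \<rho>) (\<lambda>(s, z). F' s z)"
    and "s0 \<in> U" "convex U" "\<rho> \<ge> 0"
  shows "((\<lambda>s. circle_mean \<rho> (F s)) has_vector_derivative circle_mean \<rho> (F' s0)) (at s0 within U)"
proof -
  have "continuous_on (U \<times> cbox 0 (1::real))
      (\<lambda>p. (\<lambda>(x, z). F' x z) (fst p, of_real \<rho> * exp (2 * of_real pi * \<i> * of_real (snd p))))"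
    by (rule continuous_on_compose2[OF assms(3)])
       (use assms in \<open>auto intro!: continuous_intros simp: norm_mult\<close>)
  then have c: "continuous_on (U \<times> cbox 0 (1::real))
      (\<lambda>(x, t). F' x (of_real \<rho> * exp (2 * of_real pi * \<i> * of_real t)))"
    by (simp add: case_prod_beta)
  show ?thesis
    using leibniz_rule_vector_derivative[OF _ _ c assms(4,5),
        of "\<lambda>s x. F s (of_real \<rho> * exp (2 * of_real pi * \<i> * of_real x))"]
      assms integrable_circle_param[of \<rho>]
    by (auto simp: circle_mean_def norm_mult)
qed

text \<open>Passage from circles inside the disk, where the transition maps live, to the unit
  circle, where moments and coefficients are defined.\<close>

lemma circle_mean_tendsto_1:
  assumes "continuous_on (cball 0 1) F"
  shows "((\<lambda>\<rho>. circle_mean \<rho> F) \<longlongrightarrow> circle_mean 1 F) (at_left 1)"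
proof -
  have "continuous_on ({0..1} \<times> cbox 0 (1::real))
      (\<lambda>p. F (of_real (fst p) * exp (2 * of_real pi * \<i> * of_real (snd p))))"
    by (rule continuous_on_compose2[OF assms]) (auto intro!: continuous_intros simp: norm_mult)
  then have "continuous_on ({0..1} \<times> cbox 0 (1::real))
      (\<lambda>(\<rho>, x). F (of_real \<rho> * exp (2 * of_real pi * \<i> * of_real x)))"
    by (simp add: case_prod_beta)
  from integral_continuous_on_param[OF this]
  have "continuous_on {0..1} (\<lambda>\<rho>. circle_mean \<rho> F)" by (simp add: circle_mean_def)
  then have "((\<lambda>\<rho>. circle_mean \<rho> F) \<longlongrightarrow> circle_mean 1 F) (at 1 within {0..1})"
    by (simp add: continuous_on)
  then show ?thesis by (simp add: at_within_Icc_at_left)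
qed

lemma circle_mean_uniform_limit:
  fixes F :: "nat \<Rightarrow> complex \<Rightarrow> complex"
  assumes "uniform_limit (sphere 0 \<rho>) F G sequentially"
    and "\<And>n. continuous_on (sphere 0 \<rho>) (F n)" "\<rho> \<ge> 0"
  shows "(\<lambda>n. circle_mean \<rho> (F n)) \<longlonglongrightarrow> circle_mean \<rho> G"
proof -
  have "uniform_limit {0..1} (\<lambda>n x. F n (of_real \<rho> * exp (2 * of_real pi * \<i> * of_real x)))
      (\<lambda>x. G (of_real \<rho> * exp (2 * of_real pi * \<i> * of_real (x::real)))) sequentially"
    by (rule uniform_limit_compose'[OF assms(1)]) (use assms(3) in \<open>auto simp: norm_mult\<close>)
  then obtain I J where *: "\<And>n. ((\<lambda>x. F n (of_real \<rho> * exp (2 * of_real pi * \<i> * of_real x))) has_integral I n) {0..1::real}"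
    "((\<lambda>x. G (of_real \<rho> * exp (2 * of_real pi * \<i> * of_real x))) has_integral J) {0..1::real}" "I \<longlonglongrightarrow> J"
    by (rule uniform_limit_integral) (use assms in \<open>auto intro!: continuous_on_circle_param\<close>)
  then show ?thesis
    by (simp add: circle_mean_def *(1,2)[THEN integral_unique])
qed

section \<open>Picard iteration in the disk\<close>

text \<open>The integral form makes no demand on the derivative of \<open>g\<close>; later
  \<open>g\<close> is the distance of two trajectories, which may fail to be differentiable where
  they meet.\<close>

lemma gronwall:
  fixes g :: "real \<Rightarrow> real"
  assumes cont: "continuous_on {s..T} g" and L: "\<Lambda> \<ge> 0"
    and le: "\<And>\<tau>. \<tau> \<in> {s..T} \<Longrightarrow> g \<tau> \<le> \<epsilon> + \<Lambda> * integral {s..\<tau>} g"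
    and \<tau>: "\<tau> \<in> {s..T}"
  shows "g \<tau> \<le> \<epsilon> * exp (\<Lambda> * (\<tau> - s))"
proof -
  define G where "G \<tau> = integral {s..\<tau>} g" for \<tau>
  \<comment> \<open>Integrating factor times the right-hand side of the hypothesis; the sign of its
    derivative is that of the hypothesis.\<close>
  define H where "H \<tau> = exp (- \<Lambda> * (\<tau> - s)) * (\<epsilon> + \<Lambda> * G \<tau>)" for \<tau>
  have G: "(G has_real_derivative g x) (at x within {s..T})" if "x \<in> {s..T}" for x
    unfolding G_def using cont that by (rule integral_has_real_derivative)
  have "H \<tau> \<le> H s"
  proof (rule DERIV_nonpos_imp_decreasing_open[where f = H and a = s and b = \<tau>])
    fix x assume x: "s < x" "x < \<tau>"
    then have "(G has_real_derivative g x) (at x)"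
      using G[of x] \<tau> at_within_interior[of x "{s..T}"] by auto
    then have "(H has_real_derivative exp (- \<Lambda> * (x - s)) * (\<Lambda> * (g x - (\<epsilon> + \<Lambda> * G x)))) (at x)"
      unfolding H_def by (auto intro!: derivative_eq_intros simp: algebra_simps)
    moreover have "\<Lambda> * (g x - (\<epsilon> + \<Lambda> * G x)) \<le> 0"
      using le[of x] L x \<tau> by (intro mult_nonneg_nonpos) (auto simp: G_def)
    ultimately show "\<exists>y. (H has_real_derivative y) (at x) \<and> y \<le> 0"
      by (intro exI[of _ "exp (- \<Lambda> * (x - s)) * (\<Lambda> * (g x - (\<epsilon> + \<Lambda> * G x)))"] conjI)
        (simp_all add: mult_nonneg_nonpos)
  next
    have "continuous_on {s..T} G"
      using G by (meson DERIV_continuous_on)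
    then show "continuous_on {s..\<tau>} H"
      unfolding H_def using \<tau> by (auto intro!: continuous_intros elim: continuous_on_subset)
  qed (use \<tau> in auto)
  then have "exp (- \<Lambda> * (\<tau> - s)) * (\<epsilon> + \<Lambda> * G \<tau>) \<le> \<epsilon>"
    by (simp add: H_def G_def)
  from mult_left_mono[OF this exp_ge_zero[of "\<Lambda> * (\<tau> - s)"]]
  have "\<epsilon> + \<Lambda> * G \<tau> \<le> \<epsilon> * exp (\<Lambda> * (\<tau> - s))"
    by (simp add: mult.assoc[symmetric] exp_add[symmetric] mult.commute[of _ \<epsilon>])
  then show ?thesis using le[OF \<tau>] by (simp add: G_def)
qed

text \<open>The derivative of \<open>exp\<close> has modulus at most 1 on the left half-plane, which
  is convex. The exponents to which this is applied are integrals of \<open>- P\<close> with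
  \<open>Re P\<close> nonnegative.\<close>

lemma norm_exp_diff_le:
  assumes "Re a \<le> 0" "Re b \<le> 0"
  shows "norm (exp a - exp b) \<le> norm (a - b)"
proof -
  have "norm (exp a - exp b) \<le> 1 * norm (a - b)"
    by (rule field_differentiable_bound[of "{z. Re z \<le> 0}" exp exp])
       (use assms in \<open>auto intro!: derivative_eq_intros convex_halfspace_Re_le\<close>)
  then show ?thesis by simp
qed

lemma integral_exp_power_bound:
  fixes \<Lambda> s \<tau> :: real
  assumes "s \<le> \<tau>"
  shows "((\<lambda>\<sigma>. \<Lambda> * ((\<Lambda> * (\<sigma> - s)) ^ n / fact n)) has_integral (\<Lambda> * (\<tau> - s)) ^ Suc n / fact (Suc n)) {s..\<tau>}"
proof -
  have "((\<lambda>\<sigma>. (\<Lambda> * (\<sigma> - s)) ^ Suc n / fact (Suc n)) has_real_derivative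
      \<Lambda> * ((\<Lambda> * (x - s)) ^ n / fact n)) (at x within {s..\<tau>})" for x
  proof -
    have "((\<lambda>\<sigma>. \<Lambda> * (\<sigma> - s)) has_real_derivative \<Lambda>) (at x within {s..\<tau>})"
      by (auto intro!: derivative_eq_intros)
    from DERIV_cdivide[OF DERIV_power[OF this, of "Suc n"], of "fact (Suc n)"]
    show ?thesis by (simp add: field_simps del: of_nat_Suc power_Suc)
  qed
  then have "((\<lambda>\<sigma>. \<Lambda> * ((\<Lambda> * (\<sigma> - s)) ^ n / fact n)) has_integral
      (\<Lambda> * (\<tau> - s)) ^ Suc n / fact (Suc n) - (\<Lambda> * (s - s)) ^ Suc n / fact (Suc n)) {s..\<tau>}"
    by (intro fundamental_theorem_of_calculus assms)
      (auto simp: has_real_derivative_iff_has_vector_derivative[symmetric])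
  then show ?thesis by simp
qed

lemma Re_integral_nonneg:
  assumes "continuous_on {s..\<tau>::real} h" "\<And>x. x \<in> {s..\<tau>} \<Longrightarrow> 0 \<le> Re (h x)"
  shows "0 \<le> Re (integral {s..\<tau>} h)"
proof -
  have int: "h integrable_on {s..\<tau>}" by (rule integrable_continuous_real[OF assms(1)])
  have "(\<lambda>x. Re (h x)) integrable_on {s..\<tau>}"
    by (intro integrable_continuous_real continuous_on_Re assms)
  from Henstock_Kurzweil_Integration.integral_nonneg[OF this assms(2)]
  show ?thesis using integral_linear[OF int bounded_linear_Re] by (simp add: o_def)
qed

text \<open>The multiplicative form of the iteration keeps the iterates in the disk of radius \<open>norm z\<close>.\<close>

lemma picard_disk:
  fixes P :: "complex \<Rightarrow> real \<Rightarrow> complex"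
  assumes z: "norm z < 1" and L: "\<Lambda> \<ge> 0"
    and contP: "continuous_on (ball 0 1 \<times> {s..T}) (\<lambda>(w, t). P w t)"
    and Re_nonneg: "\<And>w t. norm w < 1 \<Longrightarrow> t \<in> {s..T} \<Longrightarrow> 0 \<le> Re (P w t)"
    and lip: "\<And>w v t. norm w \<le> norm z \<Longrightarrow> norm v \<le> norm z \<Longrightarrow> t \<in> {s..T} \<Longrightarrow>
        norm (P w t - P v t) \<le> \<Lambda> * norm (w - v)"
  obtains W where "continuous_on {s..T} W"
    and "\<And>\<tau>. \<tau> \<in> {s..T} \<Longrightarrow> norm (W \<tau>) \<le> norm z"
    and "\<And>\<tau>. \<tau> \<in> {s..T} \<Longrightarrow> W \<tau> = z * exp (- integral {s..\<tau>} (\<lambda>\<sigma>. P (W \<sigma>) \<sigma>))"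
proof -
  have contI: "continuous_on {s..T} (\<lambda>\<sigma>. P (v \<sigma>) \<sigma>)"
    if "continuous_on {s..T} v" "\<And>\<tau>. \<tau> \<in> {s..T} \<Longrightarrow> norm (v \<tau>) \<le> norm z" for v
    using continuous_on_compose2[OF contP, of "{s..T}" "\<lambda>\<sigma>. (v \<sigma>, \<sigma>)"] that z
    by (fastforce intro!: continuous_intros)
  define \<Phi> where "\<Phi> v \<tau> = z * exp (- integral {s..\<tau>} (\<lambda>\<sigma>. P (v \<sigma>) \<sigma>))" for v \<tau>
  have Re_int: "0 \<le> Re (integral {s..\<tau>} (\<lambda>\<sigma>. P (v \<sigma>) \<sigma>))"
    if v: "continuous_on {s..T} v" "\<And>\<tau>. \<tau> \<in> {s..T} \<Longrightarrow> norm (v \<tau>) \<le> norm z" and \<tau>: "\<tau> \<in> {s..T}" for v \<tau>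
  proof (rule Re_integral_nonneg)
    show "continuous_on {s..\<tau>} (\<lambda>\<sigma>. P (v \<sigma>) \<sigma>)"
      using contI[OF v] \<tau> by (auto elim: continuous_on_subset)
    show "0 \<le> Re (P (v x) x)" if "x \<in> {s..\<tau>}" for x
      using v(2)[of x] z \<tau> that by (intro Re_nonneg) auto
  qed
  have \<Phi>: "continuous_on {s..T} (\<Phi> v)" "\<And>\<tau>. \<tau> \<in> {s..T} \<Longrightarrow> norm (\<Phi> v \<tau>) \<le> norm z"
    if v: "continuous_on {s..T} v" "\<And>\<tau>. \<tau> \<in> {s..T} \<Longrightarrow> norm (v \<tau>) \<le> norm z" for v
  proof -
    have "continuous_on {s..T} (\<lambda>\<tau>. integral {s..\<tau>} (\<lambda>\<sigma>. P (v \<sigma>) \<sigma>))"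
      by (intro indefinite_integral_continuous_1 integrable_continuous_real contI v)
    then show "continuous_on {s..T} (\<Phi> v)" unfolding \<Phi>_def by (intro continuous_intros)
    show "norm (\<Phi> v \<tau>) \<le> norm z" if "\<tau> \<in> {s..T}" for \<tau>
      using Re_int[OF v that] by (simp add: \<Phi>_def norm_mult norm_exp_eq_Re mult_left_le)
  qed
  have diff: "norm (\<Phi> v \<tau> - \<Phi> u \<tau>) \<le> integral {s..\<tau>} (\<lambda>\<sigma>. B \<sigma>)"
    if v: "continuous_on {s..T} v" "\<And>\<tau>. \<tau> \<in> {s..T} \<Longrightarrow> norm (v \<tau>) \<le> norm z"
      and u: "continuous_on {s..T} u" "\<And>\<tau>. \<tau> \<in> {s..T} \<Longrightarrow> norm (u \<tau>) \<le> norm z"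
      and \<tau>: "\<tau> \<in> {s..T}" and B: "B integrable_on {s..\<tau>}"
      and le: "\<And>\<sigma>. \<sigma> \<in> {s..\<tau>} \<Longrightarrow> \<Lambda> * norm (v \<sigma> - u \<sigma>) \<le> B \<sigma>" for v u \<tau> B
  proof -
    let ?I = "\<lambda>v. integral {s..\<tau>} (\<lambda>\<sigma>. P (v \<sigma>) \<sigma>)"
    have int: "(\<lambda>\<sigma>. P (v \<sigma>) \<sigma>) integrable_on {s..\<tau>}" "(\<lambda>\<sigma>. P (u \<sigma>) \<sigma>) integrable_on {s..\<tau>}"
      using contI[OF v] contI[OF u] \<tau>
      by (auto intro!: integrable_continuous_real elim: continuous_on_subset)
    have "norm (\<Phi> v \<tau> - \<Phi> u \<tau>) = norm z * norm (exp (- ?I v) - exp (- ?I u))"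
      by (simp add: \<Phi>_def flip: norm_mult right_diff_distrib)
    also have "\<dots> \<le> 1 * norm (- ?I v - - ?I u)"
      using z Re_int[OF v \<tau>] Re_int[OF u \<tau>] by (intro mult_mono norm_exp_diff_le) auto
    also have "\<dots> = norm (integral {s..\<tau>} (\<lambda>\<sigma>. P (v \<sigma>) \<sigma> - P (u \<sigma>) \<sigma>))"
      using Henstock_Kurzweil_Integration.integral_diff[OF int]
      by (simp add: norm_minus_commute)
    also have "\<dots> \<le> integral {s..\<tau>} B"
    proof (rule integral_norm_bound_integral)
      fix x assume x: "x \<in> {s..\<tau>}"
      then have "norm (P (v x) x - P (u x) x) \<le> \<Lambda> * norm (v x - u x)"
        using v(2)[of x] u(2)[of x] \<tau> by (intro lip) auto
      then show "norm (P (v x) x - P (u x) x) \<le> B x" using le[OF x] by linarith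
    qed (use int B in \<open>auto intro: integrable_diff\<close>)
    finally show ?thesis .
  qed
  define w where "w n = (\<Phi> ^^ n) (\<lambda>_. z)" for n
  have w0: "w 0 = (\<lambda>_. z)" and wS: "w (Suc n) = \<Phi> (w n)" for n by (auto simp: w_def)
  have w: "continuous_on {s..T} (w n)" "\<tau> \<in> {s..T} \<Longrightarrow> norm (w n \<tau>) \<le> norm z" for n \<tau>
  proof (induction n arbitrary: \<tau>)
    case 0
    { case 1 show ?case by (simp add: w0)
    next
      case 2 show ?case by (simp add: w0) }
  next
    case (Suc n)
    { case 1 show ?case unfolding wS by (rule \<Phi>(1)[OF Suc])
    next
      case 2 then show ?case unfolding wS by (intro \<Phi>(2)[OF Suc]) }
  qed
  \<comment> \<open>The factor 2 is the trivial bound for two points of the unit disk; every further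
    iteration integrates once more and so produces the next term of the exponential series.\<close>
  have step: "norm (w (Suc n) \<tau> - w n \<tau>) \<le> 2 * ((\<Lambda> * (\<tau> - s)) ^ n / fact n)" if "\<tau> \<in> {s..T}" for n \<tau>
    using that
  proof (induction n arbitrary: \<tau>)
    case 0
    have "norm (w (Suc 0) \<tau> - w 0 \<tau>) \<le> norm (w (Suc 0) \<tau>) + norm (w 0 \<tau>)" by (rule norm_triangle_ineq4)
    then show ?case using w(2)[OF 0, of 0] w(2)[OF 0, of "Suc 0"] z by simp
  next
    case (Suc n)
    have I: "((\<lambda>\<sigma>. 2 * (\<Lambda> * ((\<Lambda> * (\<sigma> - s)) ^ n / fact n))) has_integral
        2 * ((\<Lambda> * (\<tau> - s)) ^ Suc n / fact (Suc n))) {s..\<tau>}"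
      using Suc.prems by (intro has_integral_mult_right integral_exp_power_bound) auto
    have "norm (\<Phi> (w (Suc n)) \<tau> - \<Phi> (w n) \<tau>) \<le>
        integral {s..\<tau>} (\<lambda>\<sigma>. 2 * (\<Lambda> * ((\<Lambda> * (\<sigma> - s)) ^ n / fact n)))"
    proof (rule diff[OF w w Suc.prems])
      fix \<sigma> assume "\<sigma> \<in> {s..\<tau>}"
      then have "norm (w (Suc n) \<sigma> - w n \<sigma>) \<le> 2 * ((\<Lambda> * (\<sigma> - s)) ^ n / fact n)"
        using Suc.prems by (intro Suc.IH) auto
      from mult_left_mono[OF this L]
      show "\<Lambda> * norm (w (Suc n) \<sigma> - w n \<sigma>) \<le> 2 * (\<Lambda> * ((\<Lambda> * (\<sigma> - s)) ^ n / fact n))"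
        by (simp add: mult_ac)
    qed (use I in \<open>auto simp: integrable_on_def\<close>)
    then show ?case unfolding wS integral_unique[OF I] .
  qed
  \<comment> \<open>The limit is written as a telescoping series so that the Weierstrass test gives
    uniform convergence.\<close>
  define W where "W \<tau> = z + (\<Sum>i. w (Suc i) \<tau> - w i \<tau>)" for \<tau>
  have "uniform_limit {s..T} (\<lambda>n \<tau>. \<Sum>i<n. w (Suc i) \<tau> - w i \<tau>) (\<lambda>\<tau>. \<Sum>i. w (Suc i) \<tau> - w i \<tau>) sequentially"
  proof (rule Weierstrass_m_test)
    fix n \<tau> assume \<tau>: "\<tau> \<in> {s..T}"
    have "2 * ((\<Lambda> * (\<tau> - s)) ^ n / fact n) \<le> 2 * ((\<Lambda> * (T - s)) ^ n / fact n)"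
      using \<tau> L by (intro mult_left_mono divide_right_mono power_mono) auto
    then show "norm (w (Suc n) \<tau> - w n \<tau>) \<le> 2 * ((\<Lambda> * (T - s)) ^ n / fact n)"
      using step[OF \<tau>, of n] by linarith
  next
    show "summable (\<lambda>n. 2 * ((\<Lambda> * (T - s)) ^ n / fact n))"
      using summable_exp[of "\<Lambda> * (T - s)"] by (intro summable_mult) (simp add: field_simps)
  qed
  then have "uniform_limit {s..T} (\<lambda>n \<tau>. z + (\<Sum>i<n. w (Suc i) \<tau> - w i \<tau>)) W sequentially"
    unfolding W_def by (intro uniform_limit_add uniform_limit_const)
  moreover have "z + (\<Sum>i<n. w (Suc i) \<tau> - w i \<tau>) = w n \<tau>" for n \<tau>
    using sum_lessThan_telescope[of "\<lambda>i. w i \<tau>" n] by (simp add: w0)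
  ultimately have lim: "uniform_limit {s..T} w W sequentially" by simp
  have W1: "continuous_on {s..T} W"
    by (rule uniform_limit_theorem[OF _ lim]) (simp_all add: w)
  have pt: "(\<lambda>n. w n \<tau>) \<longlonglongrightarrow> W \<tau>" if "\<tau> \<in> {s..T}" for \<tau>
    by (rule tendsto_uniform_limitI[OF lim that])
  have W2: "norm (W \<tau>) \<le> norm z" if "\<tau> \<in> {s..T}" for \<tau>
    by (rule Lim_norm_ubound[OF _ pt[OF that]]) (use w(2)[OF that] in auto)
  have "W \<tau> = \<Phi> W \<tau>" if \<tau>: "\<tau> \<in> {s..T}" for \<tau>
  proof -
    have "(\<lambda>n. \<Phi> (w n) \<tau>) \<longlonglongrightarrow> \<Phi> W \<tau>"
    proof (rule LIMSEQ_I)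
      fix r :: real assume r: "r > 0"
      \<comment> \<open>Chosen so that \<Lambda> * (T - s) * e is at most r / 2; the summand 1 keeps
        the denominator positive when \<Lambda> * (T - s) is 0.\<close>
      define e where "e = r / 2 / (\<Lambda> * (T - s) + 1)"
      have pos: "\<Lambda> * (T - s) + 1 > 0" using L \<tau> by (intro add_nonneg_pos) auto
      have e: "e > 0" using r pos by (simp add: e_def)
      from uniform_limitD[OF lim this] obtain N where
        N: "\<And>n x. n \<ge> N \<Longrightarrow> x \<in> {s..T} \<Longrightarrow> dist (w n x) (W x) < e"
        unfolding eventually_sequentially by blast
      have "norm (\<Phi> (w n) \<tau> - \<Phi> W \<tau>) < r" if "n \<ge> N" for n
      proof -
        have "norm (\<Phi> (w n) \<tau> - \<Phi> W \<tau>) \<le> integral {s..\<tau>} (\<lambda>\<sigma>. \<Lambda> * e)"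
        proof (rule diff[OF w W1 W2 \<tau>])
          fix \<sigma> assume "\<sigma> \<in> {s..\<tau>}"
          then have "norm (w n \<sigma> - W \<sigma>) \<le> e" using N[OF \<open>n \<ge> N\<close>, of \<sigma>] \<tau> by (auto simp: dist_norm)
          then show "\<Lambda> * norm (w n \<sigma> - W \<sigma>) \<le> \<Lambda> * e" using L by (intro mult_left_mono)
        qed auto
        also have "\<dots> = \<Lambda> * (\<tau> - s) * e" using \<tau> by simp
        also have "\<dots> \<le> (\<Lambda> * (T - s) + 1) * e"
          using \<tau> L e by (intro mult_right_mono add_increasing2 mult_left_mono) auto
        also have "\<dots> = r / 2"
          unfolding e_def using less_imp_neq[OF pos] by (metis nonzero_mult_div_cancel_left times_divide_eq_right)
        also have "\<dots> < r" using r by simp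
        finally show ?thesis .
      qed
      then show "\<exists>no. \<forall>n\<ge>no. norm (\<Phi> (w n) \<tau> - \<Phi> W \<tau>) < r" by blast
    qed
    moreover have "(\<lambda>n. \<Phi> (w n) \<tau>) \<longlonglongrightarrow> W \<tau>"
      using LIMSEQ_Suc[OF pt[OF \<tau>]] by (simp add: wS)
    ultimately show ?thesis by (rule LIMSEQ_unique[symmetric])
  qed
  with W1 W2 show thesis unfolding \<Phi>_def by (rule that)
qed

section \<open>Cauchy integrals as a source of holomorphy\<close>

lemma Cauchy_circle_mean_deriv:
  assumes "continuous_on (cball 0 \<rho>) F" "F holomorphic_on ball 0 \<rho>" "norm w < \<rho>"
  shows "circle_mean \<rho> (\<lambda>z. z * (F z / (z - w)\<^sup>2)) = deriv F w"
  using Cauchy_has_contour_integral_higher_derivative_circlepath[OF assms(1,2), of w 1, THEN contour_integral_unique]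
    assms(3)
  by (simp add: contour_integral_circlepath_mean power2_eq_square)

text \<open>A function reproduced by its Cauchy integral is holomorphic because the kernel can be
  differentiated. It is applied to the time derivative of f, whose holomorphy in z has to be
  derived.\<close>

lemma Cauchy_type_holomorphic:
  assumes "continuous_on (sphere 0 \<rho>) F" "\<And>w. norm w < \<rho> \<Longrightarrow> F w = circle_mean \<rho> (\<lambda>z. z * (F z / (z - w)))"
  shows "F holomorphic_on ball 0 \<rho>"
proof -
  have "((\<lambda>w. 2 * of_real pi * \<i> * F w) has_field_derivative
      of_nat 1 * contour_integral (circlepath 0 \<rho>) (\<lambda>u. F u / (u - w) ^ Suc 1)) (at w)"
    if w: "w \<in> ball 0 \<rho>" for w
  proof (rule Cauchy_next_derivative_circlepath(2)[OF _ _ _ w])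
    have "\<rho> > 0" using w by (auto intro: le_less_trans[OF norm_ge_zero])
    then show "continuous_on (path_image (circlepath 0 \<rho>)) F" using assms(1) by simp
    fix v :: complex assume v: "v \<in> ball 0 \<rho>"
    have "continuous_on (path_image (circlepath 0 \<rho>)) (\<lambda>u. F u / (u - v) ^ 1)"
      using \<open>\<rho> > 0\<close> v by (auto intro!: continuous_intros assms(1))
    then have "(\<lambda>u. F u / (u - v) ^ 1) contour_integrable_on circlepath 0 \<rho>"
      by (rule contour_integrable_continuous_circlepath)
    moreover have "contour_integral (circlepath 0 \<rho>) (\<lambda>u. F u / (u - v) ^ 1) = 2 * of_real pi * \<i> * F v"
      using assms(2)[of v] v by (simp add: contour_integral_circlepath_mean)
    ultimately show "((\<lambda>u. F u / (u - v) ^ 1) has_contour_integral 2 * of_real pi * \<i> * F v) (circlepath 0 \<rho>)"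
      by (metis has_contour_integral_integral)
  qed simp
  then have "(\<lambda>w. 2 * of_real pi * \<i> * F w) holomorphic_on ball 0 \<rho>"
    by (meson holomorphic_onI field_differentiable_def field_differentiable_at_within)
  then have "(\<lambda>w. 1 / (2 * of_real pi * \<i>) * (2 * of_real pi * \<i> * F w)) holomorphic_on ball 0 \<rho>"
    by (rule holomorphic_on_mult[OF holomorphic_on_const])
  moreover have "(\<lambda>w. 1 / (2 * of_real pi * \<i>) * (2 * of_real pi * \<i> * F w)) = F"
    by (rule ext) simp
  ultimately show ?thesis by (simp only:)
qed

section \<open>The velocity field of the Polubarinova-Galin equation\<close>

locale pg_solution =
  fixes f :: "complex \<Rightarrow> real \<Rightarrow> complex" and q :: "real \<Rightarrow> real"
  assumes q_cont: "continuous_on {0..} q"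
    and q_pos: "\<And>t. t \<ge> 0 \<Longrightarrow> q t > 0"
    and sol: "locally_univalent_solution q f"
begin

abbreviation "D \<equiv> space_deriv f"
abbreviation "E \<equiv> time_deriv f"

lemma f_analytic: "t \<ge> 0 \<Longrightarrow> (\<lambda>z. f z t) analytic_on cball 0 1"
  and f_0 [simp]: "t \<ge> 0 \<Longrightarrow> f 0 t = 0"
  and D_0: "t \<ge> 0 \<Longrightarrow> Im (D 0 t) = 0" "t \<ge> 0 \<Longrightarrow> Re (D 0 t) > 0"
  and D_nonzero: "t \<ge> 0 \<Longrightarrow> norm z \<le> 1 \<Longrightarrow> D z t \<noteq> 0"
  and PG: "t \<ge> 0 \<Longrightarrow> norm z = 1 \<Longrightarrow> Re (E z t * cnj (z * D z t)) = q t"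
  and E_continuous: "continuous_on (cball 0 1 \<times> {0..}) (\<lambda>(z, t). E z t)"
  and D_continuous: "continuous_on (cball 0 1 \<times> {0..}) (\<lambda>(z, t). D z t)"
  using sol by (auto simp: locally_univalent_solution_def smooth_in_time_def)

lemma f_time: "t \<ge> 0 \<Longrightarrow> norm z \<le> 1 \<Longrightarrow> ((\<lambda>s. f z s) has_vector_derivative E z t) (at t within {0..})"
  using sol
  by (auto simp: locally_univalent_solution_def smooth_in_time_def time_deriv_def vector_derivative_works[symmetric])

lemma f_space: "t \<ge> 0 \<Longrightarrow> norm z \<le> 1 \<Longrightarrow> ((\<lambda>w. f w t) has_field_derivative D z t) (at z)"
  unfolding space_deriv_def
  by (intro field_differentiable_derivI analytic_on_imp_differentiable_at[OF f_analytic]) auto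

lemma f_holomorphic: "t \<ge> 0 \<Longrightarrow> (\<lambda>z. f z t) holomorphic_on ball 0 1"
  by (rule holomorphic_on_subset[OF analytic_imp_holomorphic[OF f_analytic]]) auto

lemma D_analytic: "t \<ge> 0 \<Longrightarrow> (\<lambda>z. D z t) analytic_on cball 0 1"
  unfolding space_deriv_def using analytic_deriv[OF f_analytic[of t]] by simp

lemma D_holomorphic: "t \<ge> 0 \<Longrightarrow> (\<lambda>z. D z t) holomorphic_on ball 0 1"
  by (rule holomorphic_on_subset[OF analytic_imp_holomorphic[OF D_analytic]]) auto

text \<open>Continuity of the space derivative in both variables upgrades the two partial
  derivatives to a joint one. The chain rule along moving points \<open>W \<tau>\<close> rests on
  this.\<close>

lemma f_has_derivative:
  assumes "t \<ge> 0" "norm z \<le> 1"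
  shows "((\<lambda>(t, z). f z t) has_derivative (\<lambda>(h, k). h *\<^sub>R E z t + D z t * k)) (at (t, z) within {0..} \<times> cball 0 1)"
proof -
  have "((\<lambda>(t, z). f z t) has_derivative (\<lambda>(h, k). h *\<^sub>R E z t + blinfun_mult_right (D z t) k))
      (at (t, z) within {0..} \<times> cball 0 1)"
  proof (rule has_derivative_partialsI)
    show "((\<lambda>x. f z x) has_derivative (\<lambda>h. h *\<^sub>R E z t)) (at t within {0..})"
      using f_time[OF assms] by (simp add: has_vector_derivative_def)
    show "((\<lambda>y. f y x) has_derivative blinfun_apply (blinfun_mult_right (D y x))) (at y within cball 0 1)"
      if "x \<in> {0..}" "y \<in> cball 0 1" for x y
      using f_space[of x y] that
      by (auto simp: has_field_derivative_def intro: has_derivative_at_withinI)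
    have "continuous_on ({0..} \<times> cball 0 1) (\<lambda>p. (\<lambda>(z, t). D z t) (snd p, fst p))"
      by (rule continuous_on_compose2[OF D_continuous]) (auto intro!: continuous_intros)
    then have "continuous_on ({0..} \<times> cball 0 1) (\<lambda>(x, y). D y x)"
      by (simp add: case_prod_beta)
    then have "continuous_on ({0..} \<times> cball 0 1) (\<lambda>(x, y). blinfun_mult_right (D y x))"
      by (auto simp: case_prod_beta intro!: bounded_linear.continuous_on[OF bounded_linear_blinfun_mult_right])
    then show "continuous (at (t, z) within {0..} \<times> cball 0 1) (\<lambda>(x, y). blinfun_mult_right (D y x))"
      using assms by (auto simp: continuous_on_eq_continuous_within)
  qed (use assms in auto)
  then show ?thesis by simp
qed

lemma f_continuous: "continuous_on (cball 0 1 \<times> {0..}) (\<lambda>(z, t). f z t)"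
proof -
  have "continuous_on ({0..} \<times> cball 0 1) (\<lambda>(t, z). f z t)"
    unfolding continuous_on_eq_continuous_within
    using f_has_derivative by (auto intro!: has_derivative_continuous)
  then have "continuous_on (cball 0 1 \<times> {0..}) (\<lambda>p. (\<lambda>(t, z). f z t) (snd p, fst p))"
    by (rule continuous_on_compose2) (auto intro!: continuous_intros)
  then show ?thesis by (simp add: case_prod_beta)
qed

lemma continuous_at_time:
  assumes "continuous_on (cball 0 1 \<times> {0..}) (\<lambda>(z, t). G z t)" "t \<ge> (0::real)" "A \<subseteq> cball 0 1"
  shows "continuous_on A (\<lambda>z. G z t)"
proof -
  have "continuous_on A (\<lambda>z. (\<lambda>(z, t). G z t) (z, t))"
    by (rule continuous_on_compose2[OF assms(1)]) (use assms in \<open>auto intro!: continuous_intros\<close>)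
  then show ?thesis by simp
qed

lemmas f_cont_space = continuous_at_time[OF f_continuous]
  and D_cont_space = continuous_at_time[OF D_continuous]
  and E_cont_space = continuous_at_time[OF E_continuous]

lemma at_time_not_bot: "t \<ge> 0 \<Longrightarrow> at t within {0::real..} \<noteq> bot"
proof -
  assume "t \<ge> 0"
  then have "at_right t \<le> at t within {0..}" by (intro at_le) auto
  then show ?thesis using trivial_limit_at_right_real[of t] by (metis bot.extremum_uniqueI)
qed

lemma E_0 [simp]: assumes "t \<ge> 0" shows "E 0 t = 0"
proof -
  have "((\<lambda>s. f 0 s) has_vector_derivative 0) (at t within {0..})"
    by (rule has_vector_derivative_transform[where f = "\<lambda>_. 0"]) (use assms in auto)
  with f_time[of t 0] assms show ?thesis
    using vector_derivative_unique_within[OF at_time_not_bot[OF assms]] by auto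
qed

lemma kernel_continuous:
  assumes "continuous_on (cball 0 1 \<times> {0..}) (\<lambda>(z, t). G z t)"
  shows "continuous_on (ball 0 1 \<times> {0..}) (\<lambda>(w, t). circle_mean 1 (\<lambda>z. z * (G z t / (z - w) ^ k)))"
proof -
  have "continuous_on ((ball 0 1 \<times> {0..}) \<times> sphere 0 1)
      (\<lambda>p. snd p * ((\<lambda>(z, t). G z t) (snd p, snd (fst p)) / (snd p - fst (fst p)) ^ k))"
    by (intro continuous_intros continuous_on_compose2[OF assms]) (auto dest!: sym[of "norm _" 1])
  then have "continuous_on ((ball 0 1 \<times> {0..}) \<times> sphere 0 1)
      (\<lambda>(p, z). z * (G z (snd p) / (z - fst p) ^ k))"
    by (simp add: case_prod_beta)
  from circle_mean_continuous_param[OF this] show ?thesis by (simp add: case_prod_beta)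
qed

text \<open>The case \<open>k = 1\<close> yields Cauchy's formula for the time derivative of f, the
  case \<open>k = 2\<close> the time derivative of f'.\<close>

lemma kernel_time_derivative:
  assumes "t \<ge> 0" "norm w < 1"
  shows "((\<lambda>s. circle_mean 1 (\<lambda>z. z * (f z s / (z - w) ^ k))) has_vector_derivative
      circle_mean 1 (\<lambda>z. z * (E z t / (z - w) ^ k))) (at t within {0..})"
proof (rule circle_mean_has_vector_derivative)
  show "((\<lambda>s. z * (f z s / (z - w) ^ k)) has_vector_derivative z * (E z s / (z - w) ^ k)) (at s within {0..})"
    if "s \<in> {0..}" "norm z = 1" for s z
    using has_vector_derivative_mult_right[OF f_time[of s z], of "z / (z - w) ^ k"] that by simp
  show "continuous_on (sphere 0 1) (\<lambda>z. z * (f z s / (z - w) ^ k))" if "s \<in> {0..}" for s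
    using that assms by (auto intro!: continuous_intros f_cont_space)
  have "continuous_on ({0..} \<times> sphere 0 1) (\<lambda>p. snd p * ((\<lambda>(z, t). E z t) (snd p, fst p) / (snd p - w) ^ k))"
    using assms by (intro continuous_intros continuous_on_compose2[OF E_continuous]) auto
  then show "continuous_on ({0..} \<times> sphere 0 1) (\<lambda>(s, z). z * (E z s / (z - w) ^ k))"
    by (simp add: case_prod_beta)
qed (use assms in auto)

text \<open>Both sides are the derivative of \<open>f w\<close> at time t: one by definition, the
  other by differentiating Cauchy's formula for f under the integral. One-sided derivatives at t = 0
  are still unique.\<close>

lemma E_Cauchy:
  assumes t: "t \<ge> 0" and w: "norm w < 1"
  shows "E w t = circle_mean 1 (\<lambda>z. z * (E z t / (z - w)))"
proof (rule vector_derivative_unique_within[OF at_time_not_bot[OF t]])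
  show "((\<lambda>s. f w s) has_vector_derivative E w t) (at t within {0..})"
    using f_time t w by auto
  show "((\<lambda>s. f w s) has_vector_derivative circle_mean 1 (\<lambda>z. z * (E z t / (z - w)))) (at t within {0..})"
  proof (rule has_vector_derivative_transform[where f = "\<lambda>s. circle_mean 1 (\<lambda>z. z * (f z s / (z - w)))"])
    show "((\<lambda>s. circle_mean 1 (\<lambda>z. z * (f z s / (z - w)))) has_vector_derivative
        circle_mean 1 (\<lambda>z. z * (E z t / (z - w)))) (at t within {0..})"
      using kernel_time_derivative[OF t w, of 1] by simp
    show "f w s = circle_mean 1 (\<lambda>z. z * (f z s / (z - w)))" if "s \<in> {0..}" for s
      by (rule Cauchy_circle_mean[symmetric]) (use that w in \<open>auto intro!: f_cont_space f_holomorphic\<close>)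
  qed (use t in auto)
qed

lemma E_holomorphic: "t \<ge> 0 \<Longrightarrow> (\<lambda>z. E z t) holomorphic_on ball 0 1"
  by (rule Cauchy_type_holomorphic) (auto intro!: E_cont_space simp del: times_divide_eq_right simp: E_Cauchy[symmetric])

text \<open>The mixed second derivative; \<open>D_time\<close> identifies it with the time
  derivative of f'.\<close>

definition E' :: "complex \<Rightarrow> real \<Rightarrow> complex" where "E' w t = deriv (\<lambda>z. E z t) w"

lemma E_space: "t \<ge> 0 \<Longrightarrow> norm w < 1 \<Longrightarrow> ((\<lambda>z. E z t) has_field_derivative E' w t) (at w)"
  unfolding E'_def by (rule holomorphic_derivI[OF E_holomorphic]) auto

lemma E'_kernel: "t \<ge> 0 \<Longrightarrow> norm w < 1 \<Longrightarrow> E' w t = circle_mean 1 (\<lambda>z. z * (E z t / (z - w)\<^sup>2))"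
  unfolding E'_def
  by (rule Cauchy_circle_mean_deriv[symmetric]) (auto intro!: E_cont_space E_holomorphic)

lemma E'_continuous: "continuous_on (ball 0 1 \<times> {0..}) (\<lambda>(w, t). E' w t)"
  using kernel_continuous[OF E_continuous, of 2]
  by (rule continuous_on_eq) (auto simp: E'_kernel)

lemma D_time:
  assumes t: "t \<ge> 0" and w: "norm w < 1"
  shows "((\<lambda>s. D w s) has_vector_derivative E' w t) (at t within {0..})"
  unfolding E'_kernel[OF t w]
proof (rule has_vector_derivative_transform[OF _ _ kernel_time_derivative[OF t w, of 2]])
  show "D w s = circle_mean 1 (\<lambda>z. z * (f z s / (z - w)\<^sup>2))" if "s \<in> {0..}" for s
    unfolding space_deriv_def
    by (rule Cauchy_circle_mean_deriv[symmetric]) (use that w in \<open>auto intro!: f_cont_space f_holomorphic\<close>)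
qed (use t in auto)

text \<open>The Herglotz function of the Loewner-Kufarev equation \<open>E = z * P * D\<close>. At
  0, where E vanishes, the value is the limit of the quotient.\<close>

definition P :: "complex \<Rightarrow> real \<Rightarrow> complex" where
  "P z t = (if z = 0 then E' 0 t / D 0 t else E z t / (z * D z t))"

lemma E_eq_P: "t \<ge> 0 \<Longrightarrow> norm z \<le> 1 \<Longrightarrow> E z t = z * P z t * D z t"
  using D_nonzero[of t z] by (auto simp: P_def)

lemma P_holomorphic:
  assumes t: "t \<ge> 0" shows "(\<lambda>z. P z t) holomorphic_on ball 0 1"
proof (rule pole_theorem_open_0)
  show "(\<lambda>z. E z t / D z t) holomorphic_on ball 0 1"
    using D_nonzero[OF t] by (auto intro!: holomorphic_intros E_holomorphic D_holomorphic t)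
  show "E z t / D z t = (z - 0) * P z t" if "z \<in> ball 0 1 - {0}" for z
    using that D_nonzero[OF t] by (auto simp: P_def)
  have "((\<lambda>z. D z t) has_field_derivative deriv (\<lambda>z. D z t) 0) (at 0)"
    by (rule holomorphic_derivI[OF D_holomorphic[OF t]]) auto
  then have "((\<lambda>z. E z t / D z t) has_field_derivative E' 0 t / D 0 t) (at 0)"
    using D_nonzero[OF t, of 0] t
    by (auto intro!: derivative_eq_intros E_space simp: field_simps)
  then show "P 0 t = deriv (\<lambda>z. E z t / D z t) 0" by (simp add: P_def DERIV_imp_deriv)
qed (use t in auto)

lemma P_cont_space:
  assumes t: "t \<ge> 0" shows "continuous_on (cball 0 1) (\<lambda>z. P z t)"
proof -
  have "continuous_on (cball 0 1 - {0}) (\<lambda>z. E z t / (z * D z t))"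
    using D_nonzero[OF t] t by (auto intro!: continuous_intros E_cont_space D_cont_space)
  then have 1: "continuous_on (cball 0 1 - {0}) (\<lambda>z. P z t)"
    by (rule continuous_on_eq) (auto simp: P_def)
  have 2: "continuous_on (ball 0 1) (\<lambda>z. P z t)"
    by (rule holomorphic_on_imp_continuous_on[OF P_holomorphic[OF t]])
  have "continuous (at z within cball 0 1) (\<lambda>z. P z t)" if z: "z \<in> cball 0 1" for z
  proof (cases "z = 0")
    case True
    then have "continuous (at z) (\<lambda>z. P z t)"
      using 2 by (auto simp: continuous_on_eq_continuous_at)
    then show ?thesis by (rule continuous_at_imp_continuous_at_within)
  next
    case False
    then have "continuous (at z within cball 0 1 - {0}) (\<lambda>z. P z t)"
      using 1 z by (auto simp: continuous_on_eq_continuous_within)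
    moreover have "at z within cball 0 1 - {0} = at z within cball 0 1"
      by (rule at_within_nhd[of _ "- {0}"]) (use False in auto)
    ultimately show ?thesis by (simp add: continuous_within)
  qed
  then show ?thesis by (auto simp: continuous_on_eq_continuous_within)
qed

lemma Re_P_circle:
  assumes "t \<ge> 0" "norm z = 1"
  shows "Re (P z t) = q t / (norm (D z t))\<^sup>2"
proof -
  have zz: "z * cnj z = 1" using assms(2) by (simp add: complex_norm_square[symmetric])
  have "E z t * cnj (z * D z t) = (z * cnj z) * P z t * (D z t * cnj (D z t))"
    using E_eq_P[of t z] assms(1) by (simp add: mult_ac assms(2))
  also have "\<dots> = of_real ((norm (D z t))\<^sup>2) * P z t"
    by (simp only: zz complex_norm_square[of "D z t"] mult_ac mult_1)
  finally have "q t = (norm (D z t))\<^sup>2 * Re (P z t)"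
    using PG[OF assms] by (metis Re_complex_of_real mult.commute times_complex.simps(1) Im_complex_of_real mult_zero_right diff_zero)
  then show ?thesis using D_nonzero[of t z] assms by (simp add: field_simps)
qed

text \<open>Minimum principle for the harmonic function \<open>Re P\<close>: on the circle it is q
  divided by the square of the modulus of f'.\<close>

lemma Re_P_nonneg:
  assumes "t \<ge> 0" "norm z \<le> 1" shows "0 \<le> Re (P z t)"
proof -
  have "Re (- P z t) \<le> 0"
  proof (rule maximum_real_frontier[of "\<lambda>z. - P z t" "cball 0 1"])
    fix z :: complex assume "z \<in> frontier (cball 0 1)"
    then show "Re (- P z t) \<le> 0" using Re_P_circle[of t z] q_pos[of t] assms by simp
  qed (use assms in \<open>auto intro!: holomorphic_intros P_holomorphic continuous_intros P_cont_space\<close>)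
  then show ?thesis by simp
qed

lemma P_kernel: "t \<ge> 0 \<Longrightarrow> norm w < 1 \<Longrightarrow> P w t = circle_mean 1 (\<lambda>z. z * (P z t / (z - w)))"
  by (rule Cauchy_circle_mean[symmetric]) (auto intro!: P_cont_space P_holomorphic)

text \<open>The case distinction at 0 hides continuity in both variables there. Cauchy's formula
  expresses P through its values on the unit circle, where only the quotient
  \<open>E / (z * D)\<close> occurs.\<close>

lemma P_continuous: "continuous_on (ball 0 1 \<times> {0..}) (\<lambda>(w, t). P w t)"
proof -
  have "continuous_on ((ball 0 1 \<times> {0..}) \<times> sphere 0 1)
      (\<lambda>p. (\<lambda>(z, t). E z t) (snd p, snd (fst p)) / (\<lambda>(z, t). D z t) (snd p, snd (fst p)) / (snd p - fst (fst p)))"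
    by (intro continuous_intros continuous_on_compose2[OF E_continuous] continuous_on_compose2[OF D_continuous])
       (auto simp: D_nonzero dest!: sym[of "norm _" 1])
  then have "continuous_on ((ball 0 1 \<times> {0..}) \<times> sphere 0 1)
      (\<lambda>(p, z). E z (snd p) / D z (snd p) / (z - fst p))"
    by (simp add: case_prod_beta)
  from circle_mean_continuous_param[OF this]
  have "continuous_on (ball 0 1 \<times> {0..}) (\<lambda>p. circle_mean 1 (\<lambda>z. E z (snd p) / D z (snd p) / (z - fst p)))"
    by simp
  then show ?thesis
  proof (rule continuous_on_eq)
    fix p :: "complex \<times> real" assume p: "p \<in> ball 0 1 \<times> {0..}"
    have "circle_mean 1 (\<lambda>z. E z (snd p) / D z (snd p) / (z - fst p)) =
        circle_mean 1 (\<lambda>z. z * (P z (snd p) / (z - fst p)))"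
      by (rule circle_mean_cong) (auto simp: P_def)
    with P_kernel[of "snd p" "fst p"] p
    show "circle_mean 1 (\<lambda>z. E z (snd p) / D z (snd p) / (z - fst p)) = (\<lambda>(w, t). P w t) p"
      by (auto simp: case_prod_beta)
  qed
qed

section \<open>Growth of the leading coefficient\<close>

definition a :: "real \<Rightarrow> real" where "a t = Re (D 0 t)"

lemma D_0_eq: "t \<ge> 0 \<Longrightarrow> D 0 t = of_real (a t)"
  using D_0[of t] by (simp add: a_def complex_eq_iff)

lemma a_pos: "t \<ge> 0 \<Longrightarrow> a t > 0"
  using D_0[of t] by (simp add: a_def)

lemma a_derivative: "t \<ge> 0 \<Longrightarrow> (a has_real_derivative a t * Re (P 0 t)) (at t within {0..})"
proof -
  assume t: "t \<ge> 0"
  have "((\<lambda>s. Re (D 0 s)) has_vector_derivative Re (E' 0 t)) (at t within {0..})"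
    by (rule bounded_linear.has_vector_derivative[OF bounded_linear_Re D_time]) (use t in auto)
  moreover have "Re (E' 0 t) = a t * Re (P 0 t)"
    using D_nonzero[OF t, of 0] a_pos[OF t] by (simp add: P_def D_0_eq[OF t] Re_divide_of_real)
  ultimately show ?thesis
    by (simp add: has_real_derivative_iff_has_vector_derivative a_def[abs_def])
qed

text \<open>The mean value property of \<open>1 / f'\<^sup>2\<close> bounds the mean of \<open>1 / \<bar>f'\<bar>\<^sup>2\<close> from below.\<close>

lemma Re_P_0_ge:
  assumes t: "t \<ge> 0" shows "q t / (a t)\<^sup>2 \<le> Re (P 0 t)"
proof -
  have c: "continuous_on (cball 0 1) (\<lambda>z. 1 / (D z t)\<^sup>2)"
    using t D_nonzero[OF t] by (auto intro!: continuous_intros D_cont_space)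
  have "circle_mean 1 (\<lambda>z. 1 / (D z t)\<^sup>2) = 1 / (D 0 t)\<^sup>2"
    using t D_nonzero[OF t] by (intro circle_mean_holomorphic c) (auto intro!: holomorphic_intros D_holomorphic)
  then have "Re (circle_mean 1 (\<lambda>z. of_real (q t) * (1 / (D z t)\<^sup>2))) = q t / (a t)\<^sup>2"
    unfolding circle_mean_mult by (simp add: D_0_eq[OF t] flip: of_real_power)
  moreover have "Re (circle_mean 1 (\<lambda>z. of_real (q t) * (1 / (D z t)\<^sup>2))) \<le> Re (circle_mean 1 (\<lambda>z. P z t))"
  proof (rule Re_circle_mean_mono)
    fix z :: complex assume z: "norm z = 1"
    have "Re (of_real (q t) * (1 / (D z t)\<^sup>2)) \<le> norm (of_real (q t) * (1 / (D z t)\<^sup>2))"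
      by (rule complex_Re_le_cmod)
    also have "\<dots> = Re (P z t)"
      using q_pos[OF t] by (simp add: norm_mult norm_divide norm_power Re_P_circle[OF t z])
    finally show "Re (of_real (q t) * (1 / (D z t)\<^sup>2)) \<le> Re (P z t)" .
  qed (use t in \<open>auto intro!: continuous_intros D_cont_space continuous_on_subset[OF P_cont_space] simp: D_nonzero\<close>)
  moreover have "circle_mean 1 (\<lambda>z. P z t) = P 0 t"
    using t by (intro circle_mean_holomorphic) (auto intro!: P_cont_space P_holomorphic)
  ultimately show ?thesis by simp
qed

abbreviation "Q \<equiv> accumulated q"

lemma Q_derivative: "0 \<le> t \<Longrightarrow> t \<le> T \<Longrightarrow> (Q has_real_derivative q t) (at t within {0..T})"
  unfolding accumulated_def[abs_def]
  by (rule integral_has_real_derivative) (auto intro: continuous_on_subset[OF q_cont])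

text \<open>The derivative of the square of a is twice that square times \<open>Re (P 0 t)\<close>,
  hence at least 2 q by \<open>Re_P_0_ge\<close>.\<close>

lemma a_growth:
  assumes T: "T \<ge> 0" shows "(a 0)\<^sup>2 + 2 * Q T \<le> (a T)\<^sup>2"
proof -
  define h where "h t = (a t)\<^sup>2 - 2 * Q t" for t
  have der: "(h has_real_derivative 2 * a t * (a t * Re (P 0 t)) - 2 * q t) (at t within {0..T})"
    if "0 \<le> t" "t \<le> T" for t
  proof -
    have "(a has_real_derivative a t * Re (P 0 t)) (at t within {0..T})"
      by (rule has_field_derivative_subset[OF a_derivative]) (use that in auto)
    then show ?thesis
      unfolding h_def using Q_derivative[OF that]
      by (auto intro!: derivative_eq_intros simp: power2_eq_square)
  qed
  have "h 0 \<le> h T"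
  proof (rule DERIV_nonneg_imp_increasing_open[where f = h])
    fix t assume t: "0 < t" "t < T"
    have "2 * a t * (a t * Re (P 0 t)) - 2 * q t \<ge> 0"
      using Re_P_0_ge[of t] a_pos[of t] t by (simp add: field_simps power2_eq_square)
    with der[of t] t at_within_interior[of t "{0..T}"]
    show "\<exists>y. (h has_real_derivative y) (at t) \<and> y \<ge> 0" by auto
  next
    show "continuous_on {0..T} h" by (rule DERIV_continuous_on) (use der in auto)
  qed (rule T)
  then show ?thesis by (simp add: h_def accumulated_def)
qed

end

text \<open>Near \<open>x0\<close> the map \<phi> is \<open>g \<circ> F \<circ> \<phi>\<close> with
  \<open>g\<close> a local inverse of \<open>F\<close>; continuity of \<phi> keeps its values in the
  domain where \<open>g\<close> inverts \<open>F\<close>. The parameter space is general because the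
  lemma serves both for a complex point and for real time.\<close>

lemma implicit_derivative:
  fixes \<phi> :: "'a::real_normed_vector \<Rightarrow> complex"
  assumes holF: "F holomorphic_on U" and U: "open U" "\<phi> x0 \<in> U"
    and nz: "deriv F (\<phi> x0) \<noteq> 0" and x0: "x0 \<in> S"
    and cont: "(\<phi> \<longlongrightarrow> \<phi> x0) (at x0 within S)"
    and der: "((\<lambda>x. F (\<phi> x)) has_derivative G') (at x0 within S)"
  shows "(\<phi> has_derivative (\<lambda>h. G' h / deriv F (\<phi> x0))) (at x0 within S)"
proof -
  obtain r where r: "r > 0" "ball (\<phi> x0) r \<subseteq> U" "inj_on F (ball (\<phi> x0) r)"
    using has_complex_derivative_locally_injective[OF holF U(2,1) nz] by blast
  have hol: "F holomorphic_on ball (\<phi> x0) r" using holF r(2) by (rule holomorphic_on_subset)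
  obtain g where g: "g holomorphic_on F ` ball (\<phi> x0) r"
    "\<And>z. z \<in> ball (\<phi> x0) r \<Longrightarrow> deriv F z * deriv g (F z) = 1"
    "\<And>z. z \<in> ball (\<phi> x0) r \<Longrightarrow> g (F z) = z"
    using holomorphic_has_inverse[OF hol open_ball r(3)] by blast
  have g': "deriv g (F (\<phi> x0)) = 1 / deriv F (\<phi> x0)"
    using g(2)[of "\<phi> x0"] r(1) nz by (simp add: field_simps)
  have "(g has_field_derivative deriv g (F (\<phi> x0))) (at (F (\<phi> x0)))"
    by (rule holomorphic_derivI[OF g(1)]) (use r in \<open>auto intro!: open_mapping_thm3[OF hol]\<close>)
  then have "((\<lambda>x. g (F (\<phi> x))) has_derivative (\<lambda>h. deriv g (F (\<phi> x0)) * G' h)) (at x0 within S)"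
    using has_derivative_compose[OF der, of g "(*) (deriv g (F (\<phi> x0)))"]
    by (simp add: has_field_derivative_def)
  then have "((\<lambda>x. g (F (\<phi> x))) has_derivative (\<lambda>h. G' h / deriv F (\<phi> x0))) (at x0 within S)"
    by (simp add: g')
  then show ?thesis
  proof (rule has_derivative_transform_eventually)
    have "\<forall>\<^sub>F x in at x0 within S. \<phi> x \<in> ball (\<phi> x0) r"
      using topological_tendstoD[OF cont open_ball] r(1) by simp
    then show "\<forall>\<^sub>F x in at x0 within S. g (F (\<phi> x)) = \<phi> x"
      by eventually_elim (rule g(3))
  qed (use g(3)[of "\<phi> x0"] r(1) x0 in auto)
qed

text \<open>The tangential derivative of \<open>G * cnj F\<close> has mean 0 over the closed circle.
  Conjugation turns the factor \<i> of the second term into -\<i>, which is why no minus sign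
  appears.\<close>

lemma circle_mean_by_parts:
  assumes G: "\<And>z. norm z = \<rho> \<Longrightarrow> (G has_field_derivative G' z) (at z)"
    and F: "\<And>z. norm z = \<rho> \<Longrightarrow> (F has_field_derivative F' z) (at z)"
    and c: "continuous_on (sphere 0 \<rho>) G'" "continuous_on (sphere 0 \<rho>) F'" and \<rho>: "\<rho> \<ge> 0"
  shows "circle_mean \<rho> (\<lambda>z. z * G' z * cnj (F z)) = circle_mean \<rho> (\<lambda>z. G z * cnj (z * F' z))"
proof -
  define e where "e x = of_real \<rho> * exp (2 * of_real pi * \<i> * of_real x)" for x :: real
  have e: "norm (e x) = \<rho>" for x using \<rho> by (simp add: e_def norm_mult)
  have cG: "continuous_on (sphere 0 \<rho>) G" "continuous_on (sphere 0 \<rho>) F"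
    by (rule continuous_at_imp_continuous_on; use DERIV_isCont[OF G] DERIV_isCont[OF F] in force)+
  have de: "(e has_vector_derivative e x * (2 * of_real pi * \<i>)) (at x within A)" for x A
    unfolding e_def by (auto intro!: derivative_eq_intros has_vector_derivative_real_field)
  define h where "h z = z * G' z * cnj (F z) - G z * cnj (z * F' z)" for z
  have "((\<lambda>x. G (e x) * cnj (F (e x))) has_vector_derivative (2 * of_real pi * \<i>) * h (e x)) (at x within {0..1})" for x
  proof -
    have 1: "((\<lambda>x. G (e x)) has_vector_derivative e x * (2 * of_real pi * \<i>) * G' (e x)) (at x within {0..1})"
      using field_vector_diff_chain_within[OF de[of x] has_field_derivative_at_within[OF G[OF e]]]
      by (simp add: o_def)
    have 2: "((\<lambda>x. F (e x)) has_vector_derivative e x * (2 * of_real pi * \<i>) * F' (e x)) (at x within {0..1})"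
      using field_vector_diff_chain_within[OF de[of x] has_field_derivative_at_within[OF F[OF e]]]
      by (simp add: o_def)
    show ?thesis
      by (rule has_vector_derivative_eq_rhs[OF has_vector_derivative_mult[OF 1 has_vector_derivative_cnj[OF 2]]])
        (simp add: h_def algebra_simps)
  qed
  then have "((\<lambda>x. (2 * of_real pi * \<i>) * h (e x)) has_integral
      G (e 1) * cnj (F (e 1)) - G (e 0) * cnj (F (e 0))) {0..1}"
    by (intro fundamental_theorem_of_calculus) auto
  moreover have "e 1 = e 0" by (simp add: e_def exp_two_pi_i')
  ultimately have "((\<lambda>x. (2 * of_real pi * \<i>) * h (e x)) has_integral 0) {0..1}" by simp
  from integral_unique[OF this]
  have "circle_mean \<rho> h = 0" unfolding circle_mean_def e_def by simp
  moreover have "h = (\<lambda>z. z * G' z * cnj (F z) - G z * cnj (z * F' z))"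
    by (rule ext) (rule h_def)
  ultimately have "circle_mean \<rho> (\<lambda>z. z * G' z * cnj (F z) - G z * cnj (z * F' z)) = 0" by simp
  moreover have "circle_mean \<rho> (\<lambda>z. z * G' z * cnj (F z) - G z * cnj (z * F' z)) =
      circle_mean \<rho> (\<lambda>z. z * G' z * cnj (F z)) - circle_mean \<rho> (\<lambda>z. G z * cnj (z * F' z))"
    by (intro circle_mean_diff continuous_intros c cG \<rho>)
  ultimately show ?thesis by (simp only: right_minus_eq)
qed

context pg_solution begin

subsection \<open>The subordination chain\<close>

lemma P_bounds:
  assumes T: "T \<ge> 0" and r: "0 \<le> r" "r < 1"
  shows "\<exists>M \<Lambda>. M \<ge> 0 \<and> \<Lambda> \<ge> 0 \<and> (\<forall>t\<in>{0..T}. \<forall>w. norm w \<le> r \<longrightarrow> norm (P w t) \<le> M) \<and>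
    (\<forall>t\<in>{0..T}. \<forall>w v. norm w \<le> r \<and> norm v \<le> r \<longrightarrow> norm (P w t - P v t) \<le> \<Lambda> * norm (w - v))"
proof -
  \<comment> \<open>Midway between r and 1: disks of radius \<open>r' - r\<close> about points of
    \<open>cball 0 r\<close> stay in the compact disk \<open>cball 0 r'\<close>, so Cauchy's
    estimate there bounds the derivative of P.\<close>
  define r' where "r' = (1 + r) / 2"
  have r': "r < r'" "r' < 1" "0 < r'" using r by (auto simp: r'_def)
  have "compact ((\<lambda>(w, t). P w t) ` (cball 0 r' \<times> {0..T}))"
    by (intro compact_continuous_image compact_Times continuous_on_subset[OF P_continuous])
      (use r' in auto)
  then have "bounded ((\<lambda>(w, t). P w t) ` (cball 0 r' \<times> {0..T}))" by (rule compact_imp_bounded)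
  from this[unfolded bounded_pos]
  obtain M where "M > 0" and M: "\<forall>p\<in>(\<lambda>(w, t). P w t) ` (cball 0 r' \<times> {0..T}). norm p \<le> M"
    by (elim exE conjE)
  have M': "norm (P w t) \<le> M" if "norm w \<le> r'" "t \<in> {0..T}" for w t
    by (rule M[rule_format, OF image_eqI[of _ _ "(w, t)"]]) (use that in simp_all)
  have "norm (P w t - P v t) \<le> M / (r' - r) * norm (w - v)"
    if wv: "norm w \<le> r" "norm v \<le> r" and t: "t \<in> {0..T}" for w v t
  proof (rule field_differentiable_bound[of "cball 0 r" _ "deriv (\<lambda>z. P z t)"])
    fix x :: complex assume x: "x \<in> cball 0 r"
    show "((\<lambda>z. P z t) has_field_derivative deriv (\<lambda>z. P z t) x) (at x within cball 0 r)"
      by (rule has_field_derivative_at_within[OF holomorphic_derivI[OF P_holomorphic open_ball]]) (use x r t in auto)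
    have sub: "norm y \<le> r'" if "norm (x - y) \<le> r' - r" for y
      using that x norm_triangle_ineq4[of x "x - y"] by simp
    have sub1: "cball x (r' - r) \<subseteq> ball 0 1"
    proof
      fix y assume "y \<in> cball x (r' - r)"
      then show "y \<in> ball 0 1" using sub[of y] r' by (simp add: dist_norm)
    qed
    have t0: "0 \<le> t" using t by simp
    have "norm ((deriv ^^ 1) (\<lambda>z. P z t) x) \<le> fact 1 * M / (r' - r) ^ 1"
    proof (rule Cauchy_inequality)
      show "(\<lambda>z. P z t) holomorphic_on ball x (r' - r)"
        by (rule holomorphic_on_subset[OF P_holomorphic[OF t0] order.trans[OF ball_subset_cball sub1]])
      show "continuous_on (cball x (r' - r)) (\<lambda>z. P z t)"
        by (rule continuous_on_subset[OF P_cont_space[OF t0] order.trans[OF sub1 ball_subset_cball]])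
      show "norm (P y t) \<le> M" if "norm (x - y) = r' - r" for y
        using sub[of y] that t by (intro M') simp_all
    qed (use r' in auto)
    then show "norm (deriv (\<lambda>z. P z t) x) \<le> M / (r' - r)" by simp
  qed (use wv in auto)
  then show ?thesis using \<open>M > 0\<close> M' r'
    by (intro exI[of _ M] exI[of _ "M / (r' - r)"] conjI) simp_all
qed

text \<open>Solutions of \<open>W' = - W * P W \<tau>\<close> with \<open>W s = z\<close>, in
  integrated form; the modulus bound reflects \<open>Re P \<ge> 0\<close>.\<close>

definition trajectory :: "real \<Rightarrow> real \<Rightarrow> complex \<Rightarrow> (real \<Rightarrow> complex) \<Rightarrow> bool" where
  "trajectory T s z W \<longleftrightarrow> continuous_on {s..T} W \<and> (\<forall>\<tau>\<in>{s..T}. norm (W \<tau>) \<le> norm z) \<and>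
     (\<forall>\<tau>\<in>{s..T}. W \<tau> = z * exp (- integral {s..\<tau>} (\<lambda>\<sigma>. P (W \<sigma>) \<sigma>)))"

lemma trajectoryD:
  assumes "trajectory T s z W"
  shows "continuous_on {s..T} W" "\<tau> \<in> {s..T} \<Longrightarrow> norm (W \<tau>) \<le> norm z"
    "\<tau> \<in> {s..T} \<Longrightarrow> W \<tau> = z * exp (- integral {s..\<tau>} (\<lambda>\<sigma>. P (W \<sigma>) \<sigma>))"
  using assms[unfolded trajectory_def, THEN conjunct1]
    assms[unfolded trajectory_def, THEN conjunct2, THEN conjunct1]
    assms[unfolded trajectory_def, THEN conjunct2, THEN conjunct2]
  by - (assumption, (erule bspec, assumption)+)

lemma trajectory_exists:
  assumes "0 \<le> s" "s \<le> T" "norm z < 1"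
  shows "\<exists>W. trajectory T s z W"
proof -
  have "T \<ge> 0" using assms by simp
  from P_bounds[OF this norm_ge_zero assms(3)]
  obtain M \<Lambda> where L: "\<Lambda> \<ge> 0"
    "\<forall>t\<in>{0..T}. \<forall>w v. norm w \<le> norm z \<and> norm v \<le> norm z \<longrightarrow> norm (P w t - P v t) \<le> \<Lambda> * norm (w - v)"
    by (elim exE conjE)
  show ?thesis
  proof (rule picard_disk[OF assms(3) L(1), of s T P])
    show "continuous_on (ball 0 1 \<times> {s..T}) (\<lambda>(w, t). P w t)"
      by (rule continuous_on_subset[OF P_continuous]) (use assms in auto)
    show "0 \<le> Re (P w t)" if "norm w < 1" "t \<in> {s..T}" for w t
      using that assms by (intro Re_P_nonneg) simp_all
    show "norm (P w t - P v t) \<le> \<Lambda> * norm (w - v)"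
      if "norm w \<le> norm z" "norm v \<le> norm z" "t \<in> {s..T}" for w v t
      using that assms by (intro L(2)[rule_format]) simp_all
    fix W assume "continuous_on {s..T} W" "\<And>\<tau>. \<tau> \<in> {s..T} \<Longrightarrow> norm (W \<tau>) \<le> norm z"
      "\<And>\<tau>. \<tau> \<in> {s..T} \<Longrightarrow> W \<tau> = z * exp (- integral {s..\<tau>} (\<lambda>\<sigma>. P (W \<sigma>) \<sigma>))"
    then show ?thesis unfolding trajectory_def by (intro exI[of _ W] conjI ballI)
  qed
qed

lemma trajectory_integrand:
  assumes "trajectory T s z W" "norm z < 1" "0 \<le> s" "s \<le> u" "v \<le> T"
  shows "continuous_on {u..v} (\<lambda>\<sigma>. P (W \<sigma>) \<sigma>)"
    and "0 \<le> Re (integral {u..v} (\<lambda>\<sigma>. P (W \<sigma>) \<sigma>))"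
proof -
  have W: "continuous_on {u..v} W"
    by (rule continuous_on_subset[OF trajectoryD(1)[OF assms(1)]]) (use assms in auto)
  have W1: "norm (W \<tau>) < 1" if "\<tau> \<in> {u..v}" for \<tau>
    using trajectoryD(2)[OF assms(1), of \<tau>] assms that by auto
  have "continuous_on {u..v} (\<lambda>\<sigma>. (\<lambda>(w, t). P w t) (W \<sigma>, \<sigma>))"
    by (rule continuous_on_compose2[OF P_continuous]) (use W W1 assms in \<open>auto intro!: continuous_intros\<close>)
  then show "continuous_on {u..v} (\<lambda>\<sigma>. P (W \<sigma>) \<sigma>)" by simp
  then show "0 \<le> Re (integral {u..v} (\<lambda>\<sigma>. P (W \<sigma>) \<sigma>))"
    by (rule Re_integral_nonneg) (use W1[THEN less_imp_le] assms in \<open>auto intro!: Re_P_nonneg\<close>)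
qed

text \<open>Along a trajectory the derivative of \<open>f (W \<tau>) \<tau>\<close> is
  \<open>E - W * P * D\<close>, which vanishes by \<open>E_eq_P\<close>.\<close>

lemma trajectory_conserved:
  assumes W: "trajectory T s z W" and z: "norm z < 1" and s: "0 \<le> s" "s \<le> T"
  shows "f (W T) T = f z s"
proof -
  have W1: "norm (W \<tau>) < 1" "W \<tau> = z * exp (- integral {s..\<tau>} (\<lambda>\<sigma>. P (W \<sigma>) \<sigma>))" if "\<tau> \<in> {s..T}" for \<tau>
    using trajectoryD(2,3)[OF W that] z by simp_all
  have "((\<lambda>\<tau>. f (W \<tau>) \<tau>) has_derivative (\<lambda>h. 0)) (at \<tau> within {s..T})" if \<tau>: "\<tau> \<in> {s..T}" for \<tau>
  proof -
    have I: "((\<lambda>\<tau>. integral {s..\<tau>} (\<lambda>\<sigma>. P (W \<sigma>) \<sigma>)) has_vector_derivative P (W \<tau>) \<tau>) (at \<tau> within {s..T})"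
      by (rule integral_has_vector_derivative[OF trajectory_integrand(1)[OF W z s(1)]]) (use \<tau> in auto)
    have "((\<lambda>\<tau>. exp (- integral {s..\<tau>} (\<lambda>\<sigma>. P (W \<sigma>) \<sigma>))) has_vector_derivative
        (- P (W \<tau>) \<tau>) * exp (- integral {s..\<tau>} (\<lambda>\<sigma>. P (W \<sigma>) \<sigma>))) (at \<tau> within {s..T})"
      using field_vector_diff_chain_within[OF has_vector_derivative_minus[OF I] has_field_derivative_at_within[OF DERIV_exp]]
      by (simp add: o_def)
    from has_vector_derivative_mult_right[OF this, of z]
    have "((\<lambda>\<tau>. z * exp (- integral {s..\<tau>} (\<lambda>\<sigma>. P (W \<sigma>) \<sigma>))) has_vector_derivative - (W \<tau> * P (W \<tau>) \<tau>)) (at \<tau> within {s..T})"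
      using W1(2)[OF \<tau>] by (simp add: mult_ac)
    then have "(W has_vector_derivative - (W \<tau> * P (W \<tau>) \<tau>)) (at \<tau> within {s..T})"
      by (rule has_vector_derivative_transform[rotated 2]) (use \<tau> W1(2) in auto)
    then have "((\<lambda>\<tau>. (\<tau>, W \<tau>)) has_derivative (\<lambda>h. (h, h *\<^sub>R - (W \<tau> * P (W \<tau>) \<tau>)))) (at \<tau> within {s..T})"
      unfolding has_vector_derivative_def by (intro has_derivative_Pair has_derivative_ident)
    moreover have "((\<lambda>(t, z). f z t) has_derivative (\<lambda>(h, k). h *\<^sub>R E (W \<tau>) \<tau> + D (W \<tau>) \<tau> * k))
        (at (\<tau>, W \<tau>) within (\<lambda>\<tau>. (\<tau>, W \<tau>)) ` {s..T})"
      by (rule has_derivative_subset[OF f_has_derivative]) (use \<tau> W1(1)[THEN less_imp_le] s in auto)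
    ultimately have "((\<lambda>\<tau>. (\<lambda>(t, z). f z t) (\<tau>, W \<tau>)) has_derivative
        (\<lambda>h. (\<lambda>(h, k). h *\<^sub>R E (W \<tau>) \<tau> + D (W \<tau>) \<tau> * k) (h, h *\<^sub>R - (W \<tau> * P (W \<tau>) \<tau>)))) (at \<tau> within {s..T})"
      by (rule has_derivative_in_compose)
    moreover have "E (W \<tau>) \<tau> = W \<tau> * P (W \<tau>) \<tau> * D (W \<tau>) \<tau>"
      using E_eq_P[of \<tau> "W \<tau>"] W1(1)[OF \<tau>] \<tau> s by auto
    ultimately show ?thesis by (simp add: mult_ac)
  qed
  then obtain c where "\<forall>\<tau>\<in>{s..T}. f (W \<tau>) \<tau> = c"
    using has_derivative_zero_constant[of "{s..T}" "\<lambda>\<tau>. f (W \<tau>) \<tau>"] by auto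
  then have "f (W T) T = f (W s) s" using s by auto
  then show ?thesis using W1(2)[of s] s by simp
qed

text \<open>Until the later starting time s' the first trajectory moves by at most
  \<open>M * (s' - s)\<close>; from then on Gronwall compares the two. The estimate holds for any
  two trajectories, however they were chosen, and gives joint continuity in starting time and
  starting point.\<close>

lemma trajectory_stable:
  assumes W: "trajectory T s z W" and W': "trajectory T s' z' W'"
    and s: "0 \<le> s" "s \<le> s'" "s' \<le> T" and r: "norm z \<le> r" "norm z' \<le> r" "r < 1"
    and M: "\<And>w t. norm w \<le> r \<Longrightarrow> t \<in> {0..T} \<Longrightarrow> norm (P w t) \<le> M"
    and L: "\<Lambda> \<ge> 0" "\<And>w v t. norm w \<le> r \<Longrightarrow> norm v \<le> r \<Longrightarrow> t \<in> {0..T} \<Longrightarrow> norm (P w t - P v t) \<le> \<Lambda> * norm (w - v)"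
  shows "norm (W T - W' T) \<le> (norm (z - z') + M * (s' - s)) * exp (\<Lambda> * T)"
proof -
  have z1: "norm z < 1" "norm z' < 1" using r by auto
  have Wr: "norm (W \<tau>) \<le> r" if "\<tau> \<in> {s'..T}" for \<tau>
    using trajectoryD(2)[OF W, of \<tau>] that s r by auto
  have Wr': "norm (W' \<tau>) \<le> r" if "\<tau> \<in> {s'..T}" for \<tau>
    using trajectoryD(2)[OF W' that] r by auto
  let ?I = "\<lambda>u v. integral {u..v} (\<lambda>\<sigma>. P (W \<sigma>) \<sigma>)" and ?I' = "\<lambda>u v. integral {u..v} (\<lambda>\<sigma>. P (W' \<sigma>) \<sigma>)"
  have M0: "M \<ge> 0" using order.trans[OF norm_ge_zero M[of 0 0]] order.trans[OF norm_ge_zero r(1)] s by simp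
  have start: "norm (W s' - z') \<le> norm (z - z') + M * (s' - s)"
  proof -
    have "norm (?I s s') \<le> M * (s' - s)"
    proof (rule integral_bound)
      fix t assume "t \<in> {s..s'}"
      then show "norm (P (W t) t) \<le> M" using trajectoryD(2)[OF W, of t] s r by (intro M) auto
    qed (use s trajectory_integrand(1)[OF W z1(1)] in auto)
    moreover have "norm (exp (- ?I s s') - exp 0) \<le> norm (- ?I s s' - 0)"
      by (rule norm_exp_diff_le) (use trajectory_integrand(2)[OF W z1(1) s(1)] s in auto)
    ultimately have "norm (exp (- ?I s s') - 1) \<le> M * (s' - s)" by simp
    then have "norm z * norm (exp (- ?I s s') - 1) \<le> 1 * (M * (s' - s))"
      using z1 by (intro mult_mono) auto
    moreover have eq: "W s' - z' = (z - z') + z * (exp (- ?I s s') - 1)"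
    proof -
      have "W s' = z * exp (- ?I s s')" using trajectoryD(3)[OF W, of s'] s by auto
      then show ?thesis by (simp add: algebra_simps)
    qed
    ultimately show ?thesis
      using norm_triangle_ineq[of "z - z'" "z * (exp (- ?I s s') - 1)"] unfolding eq norm_mult by linarith
  qed
  have cont: "continuous_on {s'..T} (\<lambda>\<tau>. norm (W \<tau> - W' \<tau>))"
    by (intro continuous_intros continuous_on_subset[OF trajectoryD(1)[OF W]] trajectoryD(1)[OF W']) (use s in auto)
  have "norm (W T - W' T) \<le> norm (W s' - z') * exp (\<Lambda> * (T - s'))"
  proof (rule gronwall[OF cont L(1)])
    fix \<tau> assume \<tau>: "\<tau> \<in> {s'..T}"
    have split: "?I s s' + ?I s' \<tau> = ?I s \<tau>"
      by (intro Henstock_Kurzweil_Integration.integral_combine integrable_continuous_real trajectory_integrand(1)[OF W z1(1)])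
        (use s \<tau> in auto)
    have "W \<tau> = z * exp (- (?I s s' + ?I s' \<tau>))"
      using trajectoryD(3)[OF W, of \<tau>] s \<tau> split by simp
    also have "\<dots> = z * exp (- ?I s s') * exp (- ?I s' \<tau>)"
      by (simp only: minus_add_distrib exp_add mult.assoc)
    also have "z * exp (- ?I s s') = W s'"
      using trajectoryD(3)[OF W, of s'] s by simp
    finally have W\<tau>: "W \<tau> = W s' * exp (- ?I s' \<tau>)" .
    have W'\<tau>: "W' \<tau> = z' * exp (- ?I' s' \<tau>)"
      by (rule trajectoryD(3)[OF W' \<tau>])
    have Re: "Re (- ?I s' \<tau>) \<le> 0" "Re (- ?I' s' \<tau>) \<le> 0"
      using trajectory_integrand(2)[OF W z1(1), of s' \<tau>] trajectory_integrand(2)[OF W' z1(2), of s' \<tau>] s \<tau> by auto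
    have "norm (- ?I s' \<tau> - - ?I' s' \<tau>) = norm (integral {s'..\<tau>} (\<lambda>\<sigma>. P (W \<sigma>) \<sigma> - P (W' \<sigma>) \<sigma>))"
      using Henstock_Kurzweil_Integration.integral_diff[of "\<lambda>\<sigma>. P (W \<sigma>) \<sigma>" "{s'..\<tau>}" "\<lambda>\<sigma>. P (W' \<sigma>) \<sigma>"]
        trajectory_integrand(1)[OF W z1(1)] trajectory_integrand(1)[OF W' z1(2)] s \<tau>
      by (simp add: integrable_continuous_real norm_minus_commute)
    also have "\<dots> \<le> integral {s'..\<tau>} (\<lambda>\<sigma>. \<Lambda> * norm (W \<sigma> - W' \<sigma>))"
    proof (rule integral_norm_bound_integral)
      show "(\<lambda>\<sigma>. P (W \<sigma>) \<sigma> - P (W' \<sigma>) \<sigma>) integrable_on {s'..\<tau>}"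
        using trajectory_integrand(1)[OF W z1(1)] trajectory_integrand(1)[OF W' z1(2)] s \<tau>
        by (intro integrable_continuous_real continuous_intros) auto
      show "(\<lambda>\<sigma>. \<Lambda> * norm (W \<sigma> - W' \<sigma>)) integrable_on {s'..\<tau>}"
        by (intro integrable_continuous_real continuous_on_mult_left continuous_on_subset[OF cont]) (use \<tau> in auto)
      show "norm (P (W \<sigma>) \<sigma> - P (W' \<sigma>) \<sigma>) \<le> \<Lambda> * norm (W \<sigma> - W' \<sigma>)" if "\<sigma> \<in> {s'..\<tau>}" for \<sigma>
        using that \<tau> s by (intro L Wr Wr') auto
    qed
    also have "\<dots> = \<Lambda> * integral {s'..\<tau>} (\<lambda>\<sigma>. norm (W \<sigma> - W' \<sigma>))" by simp
    finally have le: "norm (- ?I s' \<tau> - - ?I' s' \<tau>) \<le> \<Lambda> * integral {s'..\<tau>} (\<lambda>\<sigma>. norm (W \<sigma> - W' \<sigma>))" .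
    have "W \<tau> - W' \<tau> = (W s' - z') * exp (- ?I s' \<tau>) + z' * (exp (- ?I s' \<tau>) - exp (- ?I' s' \<tau>))"
      unfolding W\<tau> W'\<tau> by (simp add: algebra_simps)
    also have "norm \<dots> \<le> norm (W s' - z') * norm (exp (- ?I s' \<tau>)) + norm z' * norm (exp (- ?I s' \<tau>) - exp (- ?I' s' \<tau>))"
      by (rule order.trans[OF norm_triangle_ineq]) (simp add: norm_mult)
    also have "\<dots> \<le> norm (W s' - z') * 1 + 1 * norm (- ?I s' \<tau> - - ?I' s' \<tau>)"
    proof (intro add_mono mult_mono)
      show "norm (exp (- ?I s' \<tau>)) \<le> 1" using Re(1) by (simp only: norm_exp_eq_Re exp_le_one_iff)
      show "norm (exp (- ?I s' \<tau>) - exp (- ?I' s' \<tau>)) \<le> norm (- ?I s' \<tau> - - ?I' s' \<tau>)"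
        by (rule norm_exp_diff_le[OF Re])
      show "norm z' \<le> 1" using z1(2) by (rule less_imp_le)
    qed simp_all
    finally show "norm (W \<tau> - W' \<tau>) \<le> norm (W s' - z') + \<Lambda> * integral {s'..\<tau>} (\<lambda>\<sigma>. norm (W \<sigma> - W' \<sigma>))"
      using le by simp
  qed (use s in auto)
  also have "\<dots> \<le> (norm (z - z') + M * (s' - s)) * exp (\<Lambda> * T)"
    using start L(1) s M0 by (intro mult_mono) (auto intro!: mult_left_mono)
  finally show ?thesis .
qed

text \<open>\<open>\<phi> s z\<close> is the position at the fixed final time T of the particle that
  is at z at time s. Holomorphy in z and differentiability in s are left out, since they follow from
  continuity and the functional equation.\<close>

definition transition :: "real \<Rightarrow> (real \<Rightarrow> complex \<Rightarrow> complex) \<Rightarrow> bool" where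
  "transition T \<phi> \<longleftrightarrow>
     (\<forall>s\<in>{0..T}. \<forall>z\<in>ball 0 1. norm (\<phi> s z) \<le> norm z \<and> f (\<phi> s z) T = f z s) \<and>
     (\<forall>z\<in>ball 0 1. \<phi> T z = z) \<and>
     (\<forall>r<1. continuous_on ({0..T} \<times> cball 0 r) (\<lambda>(s, z). \<phi> s z))"

lemma transition_exists:
  assumes T: "T \<ge> 0" obtains \<phi> where "transition T \<phi>"
proof -
  \<comment> \<open>The choices for different s and z need not be coherent:
    \<open>trajectory_stable\<close> compares arbitrary ones.\<close>
  define W where "W s z = (SOME W. trajectory T s z W)" for s z
  have W: "trajectory T s z (W s z)" if "0 \<le> s" "s \<le> T" "norm z < 1" for s z
    unfolding W_def using someI_ex[OF trajectory_exists[OF that]] .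
  define \<phi> where "\<phi> s z = W s z T" for s z
  have "norm (\<phi> s z) \<le> norm z" "f (\<phi> s z) T = f z s" if "s \<in> {0..T}" "z \<in> ball 0 1" for s z
    using trajectoryD(2)[OF W[of s z], of T] trajectory_conserved[OF W[of s z]] that unfolding \<phi>_def by simp_all
  moreover have "\<phi> T z = z" if "z \<in> ball 0 1" for z
    using trajectoryD(3)[OF W[of T z], of T] that T unfolding \<phi>_def by simp
  moreover have "continuous_on ({0..T} \<times> cball 0 r) (\<lambda>(s, z). \<phi> s z)" if r: "r < 1" for r
  proof (cases "r \<ge> 0")
    case True
    from P_bounds[OF T True r]
    obtain M \<Lambda> where M: "M \<ge> 0" "\<Lambda> \<ge> 0"
      "\<forall>t\<in>{0..T}. \<forall>w. norm w \<le> r \<longrightarrow> norm (P w t) \<le> M"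
      "\<forall>t\<in>{0..T}. \<forall>w v. norm w \<le> r \<and> norm v \<le> r \<longrightarrow> norm (P w t - P v t) \<le> \<Lambda> * norm (w - v)"
      by (elim exE conjE)
    have *: "norm (\<phi> s z - \<phi> s' z') \<le> (norm (z - z') + M * \<bar>s - s'\<bar>) * exp (\<Lambda> * T)"
      if "s \<in> {0..T}" "s' \<in> {0..T}" "norm z \<le> r" "norm z' \<le> r" "s \<le> s'" for s s' z z'
    proof -
      have "norm (W s z T - W s' z' T) \<le> (norm (z - z') + M * (s' - s)) * exp (\<Lambda> * T)"
        by (rule trajectory_stable[OF W W _ that(5) _ that(3,4) r M(3)[rule_format] M(2) M(4)[rule_format]]) (use that r in simp_all)
      then show ?thesis using that(5) by (simp add: \<phi>_def)
    qed
    have **: "norm (\<phi> s z - \<phi> s' z') \<le> (norm (z - z') + M * \<bar>s - s'\<bar>) * exp (\<Lambda> * T)"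
      if "s \<in> {0..T}" "s' \<in> {0..T}" "norm z \<le> r" "norm z' \<le> r" for s s' z z'
    proof (cases "s \<le> s'")
      case True
      then show ?thesis by (rule *[OF that])
    next
      case False
      then have "s' \<le> s" by simp
      from *[OF that(2,1,4,3) this] show ?thesis
        by (simp only: norm_minus_commute[of "\<phi> s' z'" "\<phi> s z"] norm_minus_commute[of z' z] abs_minus_commute[of s' s])
    qed
    show ?thesis
      unfolding continuous_on_def
    proof
      fix p :: "real \<times> complex" assume p: "p \<in> {0..T} \<times> cball 0 r"
      let ?F = "at p within {0..T} \<times> cball 0 r"
      have "((\<lambda>p'. (norm (snd p' - snd p) + M * \<bar>fst p' - fst p\<bar>) * exp (\<Lambda> * T)) \<longlongrightarrow>
          (norm (snd p - snd p) + M * \<bar>fst p - fst p\<bar>) * exp (\<Lambda> * T)) ?F"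
        by (intro tendsto_intros)
      then have lim: "((\<lambda>p'. (norm (snd p' - snd p) + M * \<bar>fst p' - fst p\<bar>) * exp (\<Lambda> * T)) \<longlongrightarrow> 0) ?F" by simp
      have "((\<lambda>p'. \<phi> (fst p') (snd p') - \<phi> (fst p) (snd p)) \<longlongrightarrow> 0) ?F"
      proof (rule Lim_null_comparison[OF _ lim])
        show "\<forall>\<^sub>F p' in ?F. norm (\<phi> (fst p') (snd p') - \<phi> (fst p) (snd p)) \<le>
            (norm (snd p' - snd p) + M * \<bar>fst p' - fst p\<bar>) * exp (\<Lambda> * T)"
          unfolding eventually_at_filter
        proof (intro always_eventually allI impI)
          fix p' :: "real \<times> complex" assume "p' \<in> {0..T} \<times> cball 0 r"
          then show "norm (\<phi> (fst p') (snd p') - \<phi> (fst p) (snd p)) \<le>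
              (norm (snd p' - snd p) + M * \<bar>fst p' - fst p\<bar>) * exp (\<Lambda> * T)"
            using p by (intro **) auto
        qed
      qed
      then have "((\<lambda>p'. \<phi> (fst p') (snd p')) \<longlongrightarrow> \<phi> (fst p) (snd p)) ?F"
        by (rule LIM_zero_cancel)
      then show "((\<lambda>(s, z). \<phi> s z) \<longlongrightarrow> (\<lambda>(s, z). \<phi> s z) p) ?F"
        by (simp add: case_prod_unfold)
    qed
  qed simp
  ultimately show thesis by (intro that[of \<phi>]) (simp add: transition_def)
qed

end

section \<open>Regularity of the transition maps\<close>

context pg_solution begin

lemma transitionD:
  assumes "transition T \<phi>" "s \<in> {0..T}" "norm z < 1"
  shows "norm (\<phi> s z) \<le> norm z" "norm (\<phi> s z) < 1" "f (\<phi> s z) T = f z s"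
proof -
  show le: "norm (\<phi> s z) \<le> norm z" and "f (\<phi> s z) T = f z s"
    using assms unfolding transition_def by auto
  show "norm (\<phi> s z) < 1" using le assms(3) by simp
qed

lemma transition_final: "transition T \<phi> \<Longrightarrow> norm z < 1 \<Longrightarrow> \<phi> T z = z"
  unfolding transition_def by auto

lemma transition_continuous: "transition T \<phi> \<Longrightarrow> r < 1 \<Longrightarrow> continuous_on ({0..T} \<times> cball 0 r) (\<lambda>p. \<phi> (fst p) (snd p))"
  unfolding transition_def by (simp add: case_prod_unfold)

lemma transition_cont_time:
  assumes "transition T \<phi>" "norm z < 1"
  shows "continuous_on {0..T} (\<lambda>s. \<phi> s z)"
proof -
  have "continuous_on {0..T} (\<lambda>s. (\<lambda>p. \<phi> (fst p) (snd p)) (s, z))"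
    by (rule continuous_on_compose2[OF transition_continuous[OF assms]]) (auto intro!: continuous_intros)
  then show ?thesis by simp
qed

lemma transition_cont_space:
  assumes "transition T \<phi>" "s \<in> {0..T}"
  shows "continuous_on (ball 0 1) (\<phi> s)"
proof (rule continuous_at_imp_continuous_on, rule ballI)
  fix z :: complex assume z: "z \<in> ball 0 1"
  define r where "r = (1 + norm z) / 2"
  have r: "norm z < r" "r < 1" using z by (auto simp: r_def)
  have "continuous_on (ball 0 r) (\<lambda>z. (\<lambda>p. \<phi> (fst p) (snd p)) (s, z))"
    by (rule continuous_on_compose2[OF transition_continuous[OF assms(1) r(2)]])
      (use assms(2) in \<open>auto intro!: continuous_intros\<close>)
  then have "continuous_on (ball 0 r) (\<phi> s)" by simp
  then show "continuous (at z) (\<phi> s)"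
    using r(1) by (auto simp: continuous_on_eq_continuous_at)
qed

text \<open>Implicit differentiation of \<open>f (\<phi> s z) T = f z s\<close> in z, possible
  because f' has no zeros at time T. The next lemma does the same in s, with E in place of D in the
  numerator.\<close>

lemma transition_space:
  assumes tr: "transition T \<phi>" and s: "s \<in> {0..T}" and z: "norm z < 1"
  shows "(\<phi> s has_field_derivative D z s / D (\<phi> s z) T) (at z)"
proof -
  have T: "0 \<le> T" and s0: "0 \<le> s" using s by auto
  have "(\<phi> s has_derivative (\<lambda>h. D z s * h / deriv (\<lambda>w. f w T) (\<phi> s z))) (at z within ball 0 1)"
  proof (rule implicit_derivative[OF f_holomorphic[OF T]])
    show "\<phi> s z \<in> ball 0 1" using transitionD(2)[OF tr s z] by simp
    show "deriv (\<lambda>w. f w T) (\<phi> s z) \<noteq> 0"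
      using D_nonzero[OF T, of "\<phi> s z"] transitionD(2)[OF tr s z] by (simp add: space_deriv_def)
    show "(\<phi> s \<longlongrightarrow> \<phi> s z) (at z within ball 0 1)"
      using transition_cont_space[OF tr s] z by (auto simp: continuous_on_def)
    have "((\<lambda>z. f z s) has_derivative (*) (D z s)) (at z within ball 0 1)"
      using f_space[OF s0, of z] z by (auto simp: has_field_derivative_def intro: has_derivative_at_withinI)
    then show "((\<lambda>z. f (\<phi> s z) T) has_derivative (*) (D z s)) (at z within ball 0 1)"
      by (rule has_derivative_transform[rotated 2]) (use z transitionD(3)[OF tr s] in auto)
  qed (use z in auto)
  moreover have "(\<lambda>h. D z s * h / deriv (\<lambda>w. f w T) (\<phi> s z)) = (*) (D z s / D (\<phi> s z) T)"
    by (auto simp: space_deriv_def)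
  ultimately show ?thesis
    using z at_within_open[of z "ball 0 1"] by (simp add: has_field_derivative_def)
qed

lemma transition_time:
  assumes tr: "transition T \<phi>" and s: "s \<in> {0..T}" and z: "norm z < 1"
  shows "((\<lambda>s. \<phi> s z) has_vector_derivative E z s / D (\<phi> s z) T) (at s within {0..T})"
proof -
  have T: "0 \<le> T" and s0: "0 \<le> s" using s by auto
  have "((\<lambda>s. \<phi> s z) has_derivative (\<lambda>h. h *\<^sub>R E z s / deriv (\<lambda>w. f w T) (\<phi> s z))) (at s within {0..T})"
  proof (rule implicit_derivative[where \<phi> = "\<lambda>s. \<phi> s z" and ?x0.0 = s, OF f_holomorphic[OF T]])
    show "\<phi> s z \<in> ball 0 1" using transitionD(2)[OF tr s z] by simp
    show "deriv (\<lambda>w. f w T) (\<phi> s z) \<noteq> 0"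
      using D_nonzero[OF T, of "\<phi> s z"] transitionD(2)[OF tr s z] by (simp add: space_deriv_def)
    show "((\<lambda>s. \<phi> s z) \<longlongrightarrow> \<phi> s z) (at s within {0..T})"
      using transition_cont_time[OF tr z] s by (auto simp: continuous_on_def)
    have "((\<lambda>s. f z s) has_derivative (\<lambda>h. h *\<^sub>R E z s)) (at s within {0..T})"
      using has_vector_derivative_within_subset[OF f_time[OF s0, of z], of "{0..T}"] z
      by (auto simp: has_vector_derivative_def)
    then show "((\<lambda>s. f (\<phi> s z) T) has_derivative (\<lambda>h. h *\<^sub>R E z s)) (at s within {0..T})"
      by (rule has_derivative_transform[rotated 2]) (use s transitionD(3)[OF tr _ z] in auto)
  qed (use s in auto)
  then show ?thesis
    by (simp add: has_vector_derivative_def space_deriv_def scaleR_conv_of_real)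
qed

lemma transition_holomorphic:
  "transition T \<phi> \<Longrightarrow> s \<in> {0..T} \<Longrightarrow> \<phi> s holomorphic_on ball 0 1"
  unfolding holomorphic_on_def field_differentiable_def
  using has_field_derivative_at_within[OF transition_space] by (metis mem_ball_0)

subsection \<open>Transport of moments\<close>

lemma swap_continuous:
  assumes "continuous_on (A \<times> {0..}) (\<lambda>(z, t). G z (t::real))" "S \<subseteq> A"
  shows "continuous_on ({0..T} \<times> S) (\<lambda>p. G (snd p) (fst p))"
proof -
  have "continuous_on ({0..T} \<times> S) (\<lambda>p. (\<lambda>(z, t). G z t) (snd p, fst p))"
    by (rule continuous_on_compose2[OF assms(1)]) (use assms(2) in \<open>auto intro!: continuous_intros\<close>)
  then show ?thesis by simp
qed

text \<open>The derivatives of \<open>\<Psi> (\<phi> s z)\<close> in s and in z are the same factor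
  times E and D, as if it were a function of \<open>f z s\<close>. The argument for the conservation
  of moments therefore carries over to every holomorphic \<Psi>: integration by parts moves the
  z-derivative onto \<open>cnj f\<close>, and two conjugate terms remain.\<close>

lemma transported_moment_derivative:
  assumes tr: "transition T \<phi>" and hol: "\<Psi> holomorphic_on ball 0 1"
    and \<rho>: "0 < \<rho>" "\<rho> < 1" and s: "s \<in> {0..T}"
  shows "((\<lambda>s. circle_mean \<rho> (\<lambda>z. \<Psi> (\<phi> s z) * cnj (f z s) * (z * D z s))) has_vector_derivative
      circle_mean \<rho> (\<lambda>z. \<Psi> (\<phi> s z) * of_real (2 * Re (E z s * cnj (z * D z s))))) (at s within {0..T})"
proof -
  \<comment> \<open>The common factor: the derivative of \<Psi> with respect to the value of
    \<open>f\<close> at time T.\<close>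
  define \<Omega> where "\<Omega> w = deriv \<Psi> w / D w T" for w
  have T: "0 \<le> T" and s0: "0 \<le> s" using s by auto
  have sub: "sphere 0 \<rho> \<subseteq> cball 0 1" "sphere 0 \<rho> \<subseteq> ball 0 (1::real)"
    "sphere (0::complex) \<rho> \<subseteq> cball 0 \<rho>" using \<rho> by auto
  let ?K = "{0..T} \<times> sphere (0::complex) \<rho>"
  have c\<phi>: "continuous_on ?K (\<lambda>p. \<phi> (fst p) (snd p))"
    by (rule continuous_on_subset[OF transition_continuous[OF tr \<rho>(2)]]) (use sub in auto)
  have \<phi>: "\<phi> s z \<in> ball 0 1" if "s \<in> {0..T}" "norm z = \<rho>" for s z
    using transitionD(2)[OF tr that(1), of z] that \<rho> by simp
  have c\<Psi>: "continuous_on ?K (\<lambda>p. \<Psi> (\<phi> (fst p) (snd p)))"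
    by (rule continuous_on_compose2[OF holomorphic_on_imp_continuous_on[OF hol] c\<phi>]) (use \<phi> in auto)
  have "\<Omega> holomorphic_on ball 0 1"
    unfolding \<Omega>_def using D_nonzero[OF T]
    by (intro holomorphic_intros holomorphic_deriv[OF hol] D_holomorphic T) auto
  then have c\<Omega>: "continuous_on ?K (\<lambda>p. \<Omega> (\<phi> (fst p) (snd p)))"
    by (intro continuous_on_compose2[OF holomorphic_on_imp_continuous_on c\<phi>]) (use \<phi> in auto)
  have cf: "continuous_on ?K (\<lambda>p. f (snd p) (fst p))" by (rule swap_continuous[OF f_continuous sub(1)])
  have cD: "continuous_on ?K (\<lambda>p. D (snd p) (fst p))" by (rule swap_continuous[OF D_continuous sub(1)])
  have cE: "continuous_on ?K (\<lambda>p. E (snd p) (fst p))" by (rule swap_continuous[OF E_continuous sub(1)])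
  have cE': "continuous_on ?K (\<lambda>p. E' (snd p) (fst p))"
    by (rule swap_continuous[OF E'_continuous]) (use \<rho> in auto)
  have slice: "continuous_on (sphere 0 \<rho>) (\<lambda>z. h s z)"
    if "continuous_on ?K (\<lambda>p. h (fst p) (snd p))" "s \<in> {0..T}" for h :: "real \<Rightarrow> complex \<Rightarrow> complex" and s
  proof -
    have "continuous_on (sphere 0 \<rho>) (\<lambda>z. (\<lambda>p. h (fst p) (snd p)) (s, z))"
      by (rule continuous_on_compose2[OF that(1)]) (use that(2) in \<open>auto intro!: continuous_intros\<close>)
    then show ?thesis by simp
  qed
  define F' where "F' s z = \<Omega> (\<phi> s z) * E z s * cnj (f z s) * (z * D z s) +
      \<Psi> (\<phi> s z) * cnj (E z s) * (z * D z s) + \<Psi> (\<phi> s z) * cnj (f z s) * (z * E' z s)" for s z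
  have "((\<lambda>s. circle_mean \<rho> (\<lambda>z. \<Psi> (\<phi> s z) * cnj (f z s) * (z * D z s))) has_vector_derivative
      circle_mean \<rho> (F' s)) (at s within {0..T})"
  proof (rule circle_mean_has_vector_derivative)
    fix s z assume s: "s \<in> {0..T}" and z: "norm (z::complex) = \<rho>"
    have z1: "norm z < 1" using z \<rho> by simp
    have "((\<lambda>s. \<Psi> (\<phi> s z)) has_vector_derivative \<Omega> (\<phi> s z) * E z s) (at s within {0..T})"
      using field_vector_diff_chain_within[OF transition_time[OF tr s z1]
          has_field_derivative_at_within[OF holomorphic_derivI[OF hol open_ball \<phi>[OF s z]]]]
      by (simp add: o_def \<Omega>_def mult_ac)
    moreover have "((\<lambda>s. f z s) has_vector_derivative E z s) (at s within {0..T})"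
      by (rule has_vector_derivative_within_subset[OF f_time]) (use s z1 in auto)
    moreover have "((\<lambda>s. D z s) has_vector_derivative E' z s) (at s within {0..T})"
      by (rule has_vector_derivative_within_subset[OF D_time]) (use s z1 in auto)
    ultimately have "((\<lambda>s. \<Psi> (\<phi> s z) * cnj (f z s) * (z * D z s)) has_vector_derivative
        \<Psi> (\<phi> s z) * cnj (f z s) * (z * E' z s) +
        (\<Psi> (\<phi> s z) * cnj (E z s) + \<Omega> (\<phi> s z) * E z s * cnj (f z s)) * (z * D z s)) (at s within {0..T})"
      by (intro has_vector_derivative_mult has_vector_derivative_cnj has_vector_derivative_mult_right)
    then show "((\<lambda>s. \<Psi> (\<phi> s z) * cnj (f z s) * (z * D z s)) has_vector_derivative F' s z) (at s within {0..T})"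
      by (rule has_vector_derivative_eq_rhs) (simp add: F'_def algebra_simps)
  next
    fix s assume "s \<in> {0..T}"
    then show "continuous_on (sphere 0 \<rho>) (\<lambda>z. \<Psi> (\<phi> s z) * cnj (f z s) * (z * D z s))"
      by (intro continuous_intros slice[OF c\<Psi>] slice[OF cf] slice[OF cD])
  next
    show "continuous_on ?K (\<lambda>(s, z). F' s z)"
      unfolding F'_def case_prod_unfold
      by (intro continuous_intros c\<Psi> c\<Omega> cf cD cE cE')
  qed (use s \<rho> in auto)
  moreover have "circle_mean \<rho> (F' s) =
      circle_mean \<rho> (\<lambda>z. \<Psi> (\<phi> s z) * of_real (2 * Re (E z s * cnj (z * D z s))))"
  proof -
    \<comment> \<open>\<open>z * G' * cnj f\<close> collects the first and third summands of
      \<open>F'\<close>, that is, all terms in which f itself is conjugated.\<close>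
    define G where "G z = \<Psi> (\<phi> s z) * E z s" for z
    define G' where "G' z = \<Omega> (\<phi> s z) * D z s * E z s + \<Psi> (\<phi> s z) * E' z s" for z
    note sl = slice[OF c\<Psi> s] slice[OF c\<Omega> s] slice[OF cf s] slice[OF cD s] slice[OF cE s] slice[OF cE' s]
    have cG: "continuous_on (sphere 0 \<rho>) G" "continuous_on (sphere 0 \<rho>) G'"
      unfolding G_def G'_def by (intro continuous_intros sl)+
    have parts: "circle_mean \<rho> (\<lambda>z. z * G' z * cnj (f z s)) = circle_mean \<rho> (\<lambda>z. G z * cnj (z * D z s))"
    proof (rule circle_mean_by_parts[OF _ _ cG(2) sl(4)])
      fix z :: complex assume z: "norm z = \<rho>"
      have z1: "norm z < 1" using z \<rho> by simp
      have 1: "((\<lambda>z. \<Psi> (\<phi> s z)) has_field_derivative deriv \<Psi> (\<phi> s z) * (D z s / D (\<phi> s z) T)) (at z)"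
        using DERIV_chain[OF holomorphic_derivI[OF hol open_ball \<phi>[OF s z]] transition_space[OF tr s z1]]
        by (simp add: o_def)
      show "(G has_field_derivative G' z) (at z)"
        unfolding G_def[abs_def]
        by (rule DERIV_cong[OF DERIV_mult[OF 1 E_space[OF s0 z1]]]) (simp add: G'_def \<Omega>_def algebra_simps)
      show "((\<lambda>z. f z s) has_field_derivative D z s) (at z)"
        by (rule f_space[OF s0]) (use z1 in simp)
    qed (use \<rho> in simp)
    have "circle_mean \<rho> (F' s) =
        circle_mean \<rho> (\<lambda>z. z * G' z * cnj (f z s) + \<Psi> (\<phi> s z) * cnj (E z s) * (z * D z s))"
      by (rule circle_mean_cong) (use \<rho> in \<open>simp_all add: F'_def G'_def algebra_simps\<close>)
    also have "\<dots> = circle_mean \<rho> (\<lambda>z. z * G' z * cnj (f z s)) +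
        circle_mean \<rho> (\<lambda>z. \<Psi> (\<phi> s z) * cnj (E z s) * (z * D z s))"
      by (intro circle_mean_add continuous_intros cG sl) (use \<rho> in simp)
    also have "\<dots> = circle_mean \<rho> (\<lambda>z. G z * cnj (z * D z s) + \<Psi> (\<phi> s z) * cnj (E z s) * (z * D z s))"
      unfolding parts by (intro circle_mean_add[symmetric] continuous_intros cG sl) (use \<rho> in simp)
    also have "\<dots> = circle_mean \<rho> (\<lambda>z. \<Psi> (\<phi> s z) * of_real (2 * Re (E z s * cnj (z * D z s))))"
    proof (rule circle_mean_cong)
      fix z
      have "G z * cnj (z * D z s) + \<Psi> (\<phi> s z) * cnj (E z s) * (z * D z s) =
          \<Psi> (\<phi> s z) * (E z s * cnj (z * D z s) + cnj (E z s * cnj (z * D z s)))"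
        by (simp add: G_def algebra_simps)
      also have "\<dots> = \<Psi> (\<phi> s z) * of_real (2 * Re (E z s * cnj (z * D z s)))"
        by (simp only: complex_add_cnj)
      finally show "G z * cnj (z * D z s) + \<Psi> (\<phi> s z) * cnj (E z s) * (z * D z s) =
          \<Psi> (\<phi> s z) * of_real (2 * Re (E z s * cnj (z * D z s)))" .
    qed (use \<rho> in simp)
    finally show ?thesis .
  qed
  ultimately show ?thesis by simp
qed

text \<open>\<open>\<phi> s\<close> fixes 0, so the mean of \<Psi> \<circ> \<open>\<phi> s\<close>
  is \<Psi>(0) at every time. Replacing the real part by q thus contributes exactly 2 Q \<Psi>(0),
  and only the defect of the boundary equation on the inner circle is left.\<close>

lemma transported_moment_error:
  assumes tr: "transition T \<phi>" and T: "T \<ge> 0" and hol: "\<Psi> holomorphic_on ball 0 1"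
    and B: "\<And>z. norm z < 1 \<Longrightarrow> norm (\<Psi> z) \<le> B"
    and \<rho>: "0 < \<rho>" "\<rho> < 1"
    and \<epsilon>: "\<And>s z. s \<in> {0..T} \<Longrightarrow> norm z = \<rho> \<Longrightarrow> \<bar>Re (E z s * cnj (z * D z s)) - q s\<bar> \<le> \<epsilon>"
  shows "norm (circle_mean \<rho> (\<lambda>z. \<Psi> (\<phi> T z) * cnj (f z T) * (z * D z T)) -
      circle_mean \<rho> (\<lambda>z. \<Psi> (\<phi> 0 z) * cnj (f z 0) * (z * D z 0)) - 2 * of_real (Q T) * \<Psi> 0) \<le> B * (2 * \<epsilon>) * T"
proof -
  define K where "K s = circle_mean \<rho> (\<lambda>z. \<Psi> (\<phi> s z) * cnj (f z s) * (z * D z s)) - of_real (2 * Q s) * \<Psi> 0" for s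
  define K' where "K' s = circle_mean \<rho> (\<lambda>z. \<Psi> (\<phi> s z) * of_real (2 * Re (E z s * cnj (z * D z s)))) - of_real (2 * q s) * \<Psi> 0" for s
  have "B \<ge> 0" using B[of 0] order.trans[OF norm_ge_zero] by auto
  have "of_real \<rho> \<in> sphere (0::complex) \<rho>" using \<rho> by simp
  then have "\<epsilon> \<ge> 0" using \<epsilon>[of 0 "of_real \<rho>"] T by auto
  have "(K has_vector_derivative K' s) (at s within {0..T})" if s: "s \<in> {0..T}" for s
  proof -
    have "((\<lambda>s. 2 * Q s) has_real_derivative 2 * q s) (at s within {0..T})"
      by (intro DERIV_cmult Q_derivative) (use s in auto)
    then have "((\<lambda>s. of_real (2 * Q s) * \<Psi> 0) has_vector_derivative of_real (2 * q s) * \<Psi> 0) (at s within {0..T})"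
      by (intro has_vector_derivative_mult_left has_vector_derivative_of_real)
    then show ?thesis
      unfolding K_def[abs_def] K'_def
      by (intro has_vector_derivative_diff transported_moment_derivative[OF tr hol \<rho> s])
  qed
  then have "(K' has_integral (K T - K 0)) {0..T}"
    by (intro fundamental_theorem_of_calculus T)
  moreover have "norm (K' s) \<le> B * (2 * \<epsilon>)" if s: "s \<in> {0..T}" for s
  proof -
    have s0: "0 \<le> s" using s by simp
    have sub: "sphere (0::complex) \<rho> \<subseteq> ball 0 1" "cball (0::complex) \<rho> \<subseteq> ball 0 1"
      "ball (0::complex) \<rho> \<subseteq> ball 0 1" "sphere (0::complex) \<rho> \<subseteq> cball 0 1" using \<rho> by auto
    have hol\<Psi>: "(\<lambda>z. \<Psi> (\<phi> s z)) holomorphic_on ball 0 1"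
    proof -
      have "\<phi> s ` ball 0 1 \<subseteq> ball 0 1" using transitionD(2)[OF tr s] by auto
      from holomorphic_on_compose_gen[OF transition_holomorphic[OF tr s] hol this]
      show ?thesis by (simp add: o_def)
    qed
    have c\<Psi>: "continuous_on (ball 0 1) (\<lambda>z. \<Psi> (\<phi> s z))"
      by (rule holomorphic_on_imp_continuous_on[OF hol\<Psi>])
    have "\<phi> s 0 = 0" using transitionD(1)[OF tr s, of 0] by simp
    then have "circle_mean \<rho> (\<lambda>z. \<Psi> (\<phi> s z)) = \<Psi> 0"
      using circle_mean_holomorphic[OF continuous_on_subset[OF c\<Psi> sub(2)] holomorphic_on_subset[OF hol\<Psi> sub(3)] \<rho>(1)]
      by simp
    then have "of_real (2 * q s) * \<Psi> 0 = circle_mean \<rho> (\<lambda>z. of_real (2 * q s) * \<Psi> (\<phi> s z))"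
      by (simp only: circle_mean_mult)
    then have "K' s = circle_mean \<rho> (\<lambda>z. \<Psi> (\<phi> s z) * of_real (2 * Re (E z s * cnj (z * D z s))) - of_real (2 * q s) * \<Psi> (\<phi> s z))"
      unfolding K'_def
      by (simp only:) (intro circle_mean_diff[symmetric] continuous_intros continuous_on_subset[OF c\<Psi> sub(1)]
          E_cont_space[OF s0 sub(4)] D_cont_space[OF s0 sub(4)]; use \<rho> in simp)
    also have "\<dots> = circle_mean \<rho> (\<lambda>z. \<Psi> (\<phi> s z) * of_real (2 * (Re (E z s * cnj (z * D z s)) - q s)))"
      by (rule circle_mean_cong) (use \<rho> in \<open>simp_all add: algebra_simps\<close>)
    also have "norm \<dots> \<le> B * (2 * \<epsilon>)"
    proof (rule norm_circle_mean_le)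
      show "continuous_on (sphere 0 \<rho>) (\<lambda>z. \<Psi> (\<phi> s z) * of_real (2 * (Re (E z s * cnj (z * D z s)) - q s)))"
        by (intro continuous_intros continuous_on_subset[OF c\<Psi> sub(1)]
          E_cont_space[OF s0 sub(4)] D_cont_space[OF s0 sub(4)])
      show "norm (\<Psi> (\<phi> s z) * of_real (2 * (Re (E z s * cnj (z * D z s)) - q s))) \<le> B * (2 * \<epsilon>)"
        if z: "norm z = \<rho>" for z
      proof -
        have "norm (\<Psi> (\<phi> s z)) \<le> B" by (rule B[OF transitionD(2)[OF tr s]]) (use z \<rho> in simp)
        moreover have "\<bar>2 * (Re (E z s * cnj (z * D z s)) - q s)\<bar> \<le> 2 * \<epsilon>"
          using \<epsilon>[OF s z] unfolding abs_mult by simp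
        ultimately show ?thesis
          unfolding norm_mult norm_of_real using \<open>B \<ge> 0\<close> by (intro mult_mono) auto
      qed
    qed (use \<rho> in simp)
    finally show ?thesis .
  qed
  ultimately have "norm (K T - K 0) \<le> B * (2 * \<epsilon>) * Henstock_Kurzweil_Integration.content {0..T}"
    using has_integral_bound_real[of "B * (2 * \<epsilon>)" "{}" K' "K T - K 0" 0 T] \<open>B \<ge> 0\<close> \<open>\<epsilon> \<ge> 0\<close> by auto
  then show ?thesis using T by (simp add: K_def accumulated_def algebra_simps)
qed

text \<open>
  On the circle the increment of the functional is governed by the Polubarinova-Galin equation;
  as nothing is known about \<open>\<phi>\<close> there, it is approached by circles inside the disk.
\<close>

lemma transport:
  assumes tr: "transition T \<phi>" and T: "T \<ge> 0"
    and cont: "continuous_on (cball 0 1) \<Psi>" and hol: "\<Psi> holomorphic_on ball 0 1"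
  shows "((\<lambda>\<rho>. circle_mean \<rho> (\<lambda>z. \<Psi> (\<phi> 0 z) * cnj (f z 0) * (z * D z 0))) \<longlongrightarrow>
      circle_mean 1 (\<lambda>z. \<Psi> z * cnj (f z T) * (z * D z T)) - 2 * of_real (Q T) * \<Psi> 0) (at_left 1)"
proof -
  define J where "J s \<rho> = circle_mean \<rho> (\<lambda>z. \<Psi> (\<phi> s z) * cnj (f z s) * (z * D z s))" for s \<rho>
  have "compact (\<Psi> ` cball 0 1)" by (intro compact_continuous_image cont compact_cball)
  from compact_imp_bounded[OF this, unfolded bounded_pos]
  obtain B where "B > 0" and B: "\<forall>x\<in>\<Psi> ` cball 0 1. norm x \<le> B" by (elim exE conjE)
  define h where "h = (\<lambda>p. Re (E (snd p) (fst p) * cnj (snd p * D (snd p) (fst p))))"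
  have "continuous_on ({0..T} \<times> cball 0 1) h"
    unfolding h_def
    by (intro continuous_intros swap_continuous[OF E_continuous order.refl] swap_continuous[OF D_continuous order.refl])
  then have uc: "uniformly_continuous_on ({0..T} \<times> cball 0 1) h"
    by (intro compact_uniformly_continuous compact_Times) auto
  have "((\<lambda>\<rho>. J T \<rho> - J 0 \<rho> - 2 * of_real (Q T) * \<Psi> 0) \<longlongrightarrow> 0) (at_left 1)"
  proof (rule tendstoI)
    fix e :: real assume "e > 0"
    \<comment> \<open>Makes the error \<open>B * (2 * \<epsilon>) * T\<close> at most e / 2;
      \<open>T + 1\<close> also covers T = 0.\<close>
    define \<epsilon> where "\<epsilon> = e / (4 * B) / (T + 1)"
    have \<epsilon>: "\<epsilon> > 0" using \<open>e > 0\<close> \<open>B > 0\<close> T by (simp add: \<epsilon>_def)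
    from uniformly_continuous_onE[OF uc this] obtain \<delta> where \<delta>: "\<delta> > 0"
      "\<And>p p'. p \<in> {0..T} \<times> cball 0 1 \<Longrightarrow> p' \<in> {0..T} \<times> cball 0 1 \<Longrightarrow> dist p' p < \<delta> \<Longrightarrow> dist (h p') (h p) < \<epsilon>"
      by blast
    have "\<forall>\<^sub>F \<rho> in at_left 1. max 0 (1 - \<delta>) < \<rho> \<and> \<rho> < 1"
      using eventually_at_left_real[of "max 0 (1 - \<delta>)" 1] \<delta>(1) by simp
    then show "\<forall>\<^sub>F \<rho> in at_left 1. dist (J T \<rho> - J 0 \<rho> - 2 * of_real (Q T) * \<Psi> 0) 0 < e"
    proof eventually_elim
      case (elim \<rho>)
      have "norm (J T \<rho> - J 0 \<rho> - 2 * of_real (Q T) * \<Psi> 0) \<le> B * (2 * \<epsilon>) * T"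
        unfolding J_def
      proof (rule transported_moment_error[OF tr T hol])
        show "norm (\<Psi> z) \<le> B" if "norm z < 1" for z using B that by auto
        fix s and z :: complex assume s: "s \<in> {0..T}" and z: "norm z = \<rho>"
        have "z \<noteq> 0" using z elim by auto
        \<comment> \<open>Radial projection to the unit circle, at distance 1 - \<rho>: there
          \<open>h\<close> equals q, and uniform continuity carries this back to z.\<close>
        define z' where "z' = sgn z"
        have z': "norm z' = 1" using \<open>z \<noteq> 0\<close> by (simp add: z'_def norm_sgn)
        have "z = of_real \<rho> * z'" using elim z by (simp add: z'_def sgn_div_norm scaleR_conv_of_real)
        then have "z - z' = of_real (\<rho> - 1) * z'" by (simp add: algebra_simps)
        then have "norm (z - z') = \<bar>\<rho> - 1\<bar>" using z' by (simp only: norm_mult norm_of_real) simp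
        then have "dist (s, z) (s, z') < \<delta>" using elim by (simp add: dist_Pair_Pair dist_norm)
        then have "dist (h (s, z)) (h (s, z')) < \<epsilon>"
          using s z z' elim by (intro \<delta>(2)) auto
        moreover have "h (s, z') = q s" using PG[of s z'] s z' by (simp add: h_def)
        ultimately show "\<bar>Re (E z s * cnj (z * D z s)) - q s\<bar> \<le> \<epsilon>"
          by (simp add: h_def dist_real_def)
      qed (use elim in auto)
      also have "\<dots> \<le> B * (2 * \<epsilon>) * (T + 1)" using \<open>B > 0\<close> \<epsilon> by (intro mult_left_mono) auto
      also have "\<dots> = 2 * B * (\<epsilon> * (T + 1))" by (simp only: mult_ac)
      also have "\<epsilon> * (T + 1) = e / (4 * B)" using T by (simp add: \<epsilon>_def)
      also have "2 * B * (e / (4 * B)) = e / 2" using \<open>B > 0\<close> by simp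
      also have "\<dots> < e" using \<open>e > 0\<close> by simp
      finally show ?case by (simp add: dist_norm)
    qed
  qed
  moreover have "(J T \<longlongrightarrow> circle_mean 1 (\<lambda>z. \<Psi> z * cnj (f z T) * (z * D z T))) (at_left 1)"
  proof -
    have "((\<lambda>\<rho>. circle_mean \<rho> (\<lambda>z. \<Psi> z * cnj (f z T) * (z * D z T))) \<longlongrightarrow>
        circle_mean 1 (\<lambda>z. \<Psi> z * cnj (f z T) * (z * D z T))) (at_left 1)"
      by (intro circle_mean_tendsto_1 continuous_intros cont f_cont_space D_cont_space T order.refl)
    then show ?thesis
    proof (rule Lim_transform_eventually)
      have "\<forall>\<^sub>F \<rho> in at_left 1. 0 < \<rho> \<and> \<rho> < (1::real)"
        using eventually_at_left_real[of 0 "1::real"] by simp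
      then show "\<forall>\<^sub>F \<rho> in at_left 1. circle_mean \<rho> (\<lambda>z. \<Psi> z * cnj (f z T) * (z * D z T)) = J T \<rho>"
        by eventually_elim (auto simp: J_def transition_final[OF tr] intro!: circle_mean_cong)
    qed
  qed
  ultimately have "((\<lambda>\<rho>. J T \<rho> - (J T \<rho> - J 0 \<rho> - 2 * of_real (Q T) * \<Psi> 0) - 2 * of_real (Q T) * \<Psi> 0) \<longlongrightarrow>
      circle_mean 1 (\<lambda>z. \<Psi> z * cnj (f z T) * (z * D z T)) - 0 - 2 * of_real (Q T) * \<Psi> 0) (at_left 1)"
    by (intro tendsto_intros)
  then show ?thesis by (simp add: J_def)
qed

end

section \<open>Taylor coefficients and area\<close>

text \<open>Compactness turns the neighbourhoods of single points into one of uniform width. A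
  radius above 1 makes the Taylor series absolutely convergent on the closed unit disk.\<close>

lemma analytic_on_cball_imp_holomorphic:
  assumes "f analytic_on cball 0 1"
  obtains R where "R > 1" "f holomorphic_on ball (0::complex) R"
proof -
  from assms obtain S where S: "open S" "cball 0 1 \<subseteq> S" "f holomorphic_on S"
    unfolding analytic_on_holomorphic by auto
  obtain \<epsilon> where \<epsilon>: "\<epsilon> > 0" "(\<Union>x\<in>cball 0 1. ball x \<epsilon>) \<subseteq> S"
    using compact_subset_open_imp_ball_epsilon_subset[OF compact_cball S(1,2)] by blast
  have "ball 0 (1 + \<epsilon>) \<subseteq> S"
  proof
    fix z :: complex assume z: "z \<in> ball 0 (1 + \<epsilon>)"
    show "z \<in> S"
    proof (cases "norm z \<le> 1")
      case True then show ?thesis using S(2) by auto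
    next
      case False
      then have "z \<noteq> 0" by auto
      have "z - sgn z = of_real (norm z - 1) * sgn z"
        using \<open>z \<noteq> 0\<close> by (simp add: sgn_div_norm scaleR_conv_of_real algebra_simps)
      then have "norm (z - sgn z) = \<bar>norm z - 1\<bar>"
        using \<open>z \<noteq> 0\<close> by (simp only: norm_mult norm_of_real norm_sgn) simp
      then have "dist (sgn z) z < \<epsilon>" using z False by (simp add: dist_norm norm_minus_commute)
      then have "z \<in> (\<Union>x\<in>cball 0 1. ball x \<epsilon>)"
        using \<open>z \<noteq> 0\<close> by (intro UN_I[of "sgn z"]) (auto simp: norm_sgn)
      then show ?thesis using \<epsilon>(2) by blast
    qed
  qed
  then show thesis using that[of "1 + \<epsilon>"] \<epsilon>(1) S(3) holomorphic_on_subset by auto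
qed

context pg_solution begin

definition taylor :: "nat \<Rightarrow> real \<Rightarrow> complex" where
  "taylor k t = (deriv ^^ k) (\<lambda>z. f z t) 0 / fact k"

lemma taylor_0: "t \<ge> 0 \<Longrightarrow> taylor 0 t = 0"
  by (simp add: taylor_def)

lemma taylor_1: "t \<ge> 0 \<Longrightarrow> taylor 1 t = of_real (a t)"
  by (simp add: taylor_def space_deriv_def[symmetric] D_0_eq)

lemma taylor_sums_bound:
  assumes t: "t \<ge> 0"
  shows "\<And>z. norm z \<le> 1 \<Longrightarrow> (\<lambda>k. taylor k t * z ^ k) sums f z t"
    and "summable (\<lambda>k. norm (taylor k t))"
proof -
  obtain R where R: "R > 1" "(\<lambda>z. f z t) holomorphic_on ball 0 R"
    using analytic_on_cball_imp_holomorphic[OF f_analytic[OF t]] by blast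
  show "(\<lambda>k. taylor k t * z ^ k) sums f z t" if "norm z \<le> 1" for z
    using holomorphic_power_series[OF R(2), of z] that R(1) by (simp add: taylor_def)
  \<comment> \<open>A point between the unit circle and the circle of radius R; convergence there
    forces absolute convergence at 1.\<close>
  define x :: complex where "x = of_real ((1 + R) / 2)"
  have "norm x = (1 + R) / 2" unfolding x_def norm_of_real using R(1) by simp
  then have x: "norm x < R" "1 < norm x" using R(1) by (auto simp: field_simps)
  have "(\<lambda>k. taylor k t * x ^ k) sums f x t"
    using holomorphic_power_series[OF R(2), of x] x by (simp add: taylor_def)
  from powser_insidea[OF sums_summable[OF this], of 1] x
  show "summable (\<lambda>k. norm (taylor k t))" by simp
qed

lemma taylor_mean:
  assumes t: "t \<ge> 0" shows "circle_mean 1 (\<lambda>z. f z t * cnj (z ^ k)) = taylor k t"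
  using circle_mean_coeff[OF f_cont_space[OF t order.refl] f_holomorphic[OF t], of k] by (simp add: taylor_def)

text \<open>Integration by parts moves the derivative from f to \<open>z ^ k\<close>, so the
  coefficients of f appear directly.\<close>

lemma D_taylor_mean:
  assumes t: "t \<ge> 0"
  shows "circle_mean 1 (\<lambda>z. z * D z t * cnj (z ^ k)) = of_nat k * taylor k t"
proof -
  have "circle_mean 1 (\<lambda>z. z * D z t * cnj (z ^ k)) =
      circle_mean 1 (\<lambda>z. f z t * cnj (z * (of_nat k * z ^ (k - 1))))"
    by (rule circle_mean_by_parts)
      (use t in \<open>auto intro!: f_space D_cont_space continuous_intros derivative_eq_intros\<close>)
  also have "\<dots> = circle_mean 1 (\<lambda>z. of_nat k * (f z t * cnj (z ^ k)))"
    by (rule circle_mean_cong) (cases k; simp)+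
  finally show ?thesis by (simp only: circle_mean_mult taylor_mean[OF t])
qed

definition area :: "real \<Rightarrow> complex" where
  "area t = circle_mean 1 (\<lambda>z. cnj (f z t) * (z * D z t))"

text \<open>Expanding the single factor \<open>cnj f\<close> suffices: its partial sums converge
  uniformly on the circle, and each term is a mean against \<open>z * D\<close> known from
  \<open>D_taylor_mean\<close>.\<close>

lemma area_sums:
  assumes t: "t \<ge> 0" shows "(\<lambda>k. of_real (real k * (norm (taylor k t))\<^sup>2)) sums area t"
proof -
  let ?F = "\<lambda>n z. (\<Sum>k<n. cnj (taylor k t * z ^ k)) * (z * D z t)"
  have "uniform_limit (sphere 0 1) (\<lambda>n z. \<Sum>k<n. cnj (taylor k t * z ^ k)) (\<lambda>z. \<Sum>k. cnj (taylor k t * z ^ k)) sequentially"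
    by (rule Weierstrass_m_test[OF _ taylor_sums_bound(2)[OF t]]) (auto simp: norm_mult norm_power)
  moreover have "(\<Sum>k. cnj (taylor k t * z ^ k)) = cnj (f z t)" if "z \<in> sphere 0 1" for z
    using taylor_sums_bound(1)[OF t, of z] that sums_cnj sums_unique by (metis mem_sphere_0 order.refl)
  ultimately have 1: "uniform_limit (sphere 0 1) (\<lambda>n z. \<Sum>k<n. cnj (taylor k t * z ^ k)) (\<lambda>z. cnj (f z t)) sequentially"
    by (auto intro: uniform_limit_cong[THEN iffD1, rotated 2])
  have "uniform_limit (sphere 0 1) ?F (\<lambda>z. cnj (f z t) * (z * D z t)) sequentially"
  proof (rule uniform_lim_mult[OF 1 uniform_limit_const])
    show "bounded ((\<lambda>z. cnj (f z t)) ` sphere 0 1)"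
      by (intro compact_imp_bounded compact_continuous_image continuous_intros f_cont_space t) auto
    show "bounded ((\<lambda>z. z * D z t) ` sphere 0 1)"
      by (intro compact_imp_bounded compact_continuous_image continuous_intros D_cont_space t) auto
  qed
  then have "(\<lambda>n. circle_mean 1 (?F n)) \<longlonglongrightarrow> area t"
    unfolding area_def by (rule circle_mean_uniform_limit) (auto intro!: continuous_intros D_cont_space t)
  moreover have "circle_mean 1 (?F n) = (\<Sum>k<n. of_real (real k * (norm (taylor k t))\<^sup>2))" for n
  proof -
    have "circle_mean 1 (?F n) = circle_mean 1 (\<lambda>z. \<Sum>k<n. cnj (taylor k t) * (z * D z t * cnj (z ^ k)))"
      by (rule circle_mean_cong) (auto simp: sum_distrib_left sum_distrib_right mult_ac)
    also have "\<dots> = (\<Sum>k<n. circle_mean 1 (\<lambda>z. cnj (taylor k t) * (z * D z t * cnj (z ^ k))))"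
      by (rule circle_mean_sum) (auto intro!: continuous_intros D_cont_space t)
    also have "\<dots> = (\<Sum>k<n. of_real (real k * (norm (taylor k t))\<^sup>2))"
      unfolding circle_mean_mult D_taylor_mean[OF t]
      by (intro sum.cong refl) (simp only: of_real_mult complex_norm_square of_real_of_nat_eq mult_ac)
    finally show ?thesis .
  qed
  ultimately show ?thesis by (simp add: sums_def)
qed

lemma area_real: "t \<ge> 0 \<Longrightarrow> (\<lambda>k. real k * (norm (taylor k t))\<^sup>2) sums Re (area t)"
  and area_Im: "t \<ge> 0 \<Longrightarrow> Im (area t) = 0"
proof -
  assume t: "t \<ge> 0"
  show "(\<lambda>k. real k * (norm (taylor k t))\<^sup>2) sums Re (area t)" using sums_Re[OF area_sums[OF t]] by simp
  have "(\<lambda>k. 0) sums Im (area t)" using sums_Im[OF area_sums[OF t]] by simp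
  then show "Im (area t) = 0" using sums_unique2[OF sums_zero] by metis
qed

text \<open>For \<Psi> = 1 the transition map drops out of the transported integrand, so its limit
  at the unit circle is \<open>area 0\<close>.\<close>

lemma area_growth:
  assumes T: "T \<ge> 0" shows "area T = area 0 + 2 * of_real (Q T)"
proof -
  obtain \<phi> where tr: "transition T \<phi>" using transition_exists[OF T] .
  have "((\<lambda>\<rho>. circle_mean \<rho> (\<lambda>z. 1 * cnj (f z 0) * (z * D z 0))) \<longlongrightarrow>
      circle_mean 1 (\<lambda>z. 1 * cnj (f z T) * (z * D z T)) - 2 * of_real (Q T) * 1) (at_left 1)"
    by (rule transport[OF tr T]) auto
  moreover have "((\<lambda>\<rho>. circle_mean \<rho> (\<lambda>z. 1 * cnj (f z 0) * (z * D z 0))) \<longlongrightarrow>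
      circle_mean 1 (\<lambda>z. 1 * cnj (f z 0) * (z * D z 0))) (at_left 1)"
    by (intro circle_mean_tendsto_1 continuous_intros f_cont_space D_cont_space order.refl)
  ultimately have "area T - 2 * of_real (Q T) = area 0"
    using tendsto_unique[OF trivial_limit_at_left_real] by (fastforce simp: area_def)
  then show ?thesis by (simp add: algebra_simps)
qed

section \<open>Coefficient bounds uniform in time\<close>

definition m0 :: real where "m0 = Re (area 0)"

lemma area_0: "area 0 = of_real m0"
  using area_Im[of 0] by (simp add: m0_def complex_eq_iff)

text \<open>Two terms of the area series, whose terms are all nonnegative; the weight k of the
  second is lowered to 1.\<close>

lemma taylor_square_le:
  assumes T: "T \<ge> 0" and k: "k \<ge> 2"
  shows "(a T)\<^sup>2 + (norm (taylor k T))\<^sup>2 \<le> m0 + 2 * Q T"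
proof -
  have nonneg: "0 \<le> real k * (norm (taylor k T))\<^sup>2" for k by simp
  have "(\<Sum>k\<in>{1, k}. real k * (norm (taylor k T))\<^sup>2) \<le> (\<Sum>k. real k * (norm (taylor k T))\<^sup>2)"
    by (rule sum_le_suminf[OF sums_summable[OF area_real[OF T]]]) (use nonneg in auto)
  also have "\<dots> = Re (area T)" using sums_unique[OF area_real[OF T]] by simp
  also have "\<dots> = m0 + 2 * Q T" using area_growth[OF T] by (simp add: m0_def)
  finally have "(norm (taylor 1 T))\<^sup>2 + real k * (norm (taylor k T))\<^sup>2 \<le> m0 + 2 * Q T" using k by simp
  moreover have "1 * (norm (taylor k T))\<^sup>2 \<le> real k * (norm (taylor k T))\<^sup>2"
    using k by (intro mult_right_mono) auto
  ultimately show ?thesis using taylor_1[OF T] by simp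
qed

lemma m0_nonneg: "m0 \<ge> 0"
proof -
  have "Q 0 = 0" by (simp add: accumulated_def)
  moreover have "0 \<le> (a 0)\<^sup>2 + (norm (taylor 2 0))\<^sup>2" by simp
  ultimately show ?thesis using taylor_square_le[of 0 2] by linarith
qed

lemma a_upper:
  assumes "T \<ge> 0" shows "(a T)\<^sup>2 \<le> m0 + 2 * Q T"
proof -
  have "0 \<le> (norm (taylor 2 T))\<^sup>2" by simp
  with taylor_square_le[OF assms, of 2] show ?thesis by linarith
qed

text \<open>The area and the square of a both grow like 2 Q. In the difference Q cancels, which
  leaves a bound independent of time and of k.\<close>

lemma taylor_le:
  assumes "T \<ge> 0" "k \<ge> 2" shows "norm (taylor k T) \<le> sqrt m0"
  using taylor_square_le[OF assms] a_growth[OF assms(1)] zero_le_power2[of "a 0"]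
  by (intro real_le_rsqrt) linarith

text \<open>All coefficients from degree 2 on are at most \<open>sqrt m0\<close>; the factor 2 is
  the sum of the geometric series of ratio 1 / 2.\<close>

lemma f_minus_linear:
  assumes T: "T \<ge> 0" and z: "norm z \<le> 1 / 2"
  shows "norm (f z T - of_real (a T) * z) \<le> 2 * sqrt m0 * (norm z)\<^sup>2"
proof -
  have "(\<lambda>k. taylor (k + 2) T * z ^ (k + 2)) sums (f z T - (\<Sum>k<2. taylor k T * z ^ k))"
    by (rule sums_split_initial_segment[OF taylor_sums_bound(1)[OF T]]) (use z in simp)
  then have *: "(\<lambda>k. taylor (k + 2) T * z ^ (k + 2)) sums (f z T - of_real (a T) * z)"
    using taylor_0[OF T] taylor_1[OF T] by (simp add: numeral_2_eq_2)
  have geo: "(\<lambda>k. sqrt m0 * (norm z)\<^sup>2 * (1 / 2) ^ k) sums (sqrt m0 * (norm z)\<^sup>2 * 2)"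
    using sums_mult[OF geometric_sums[of "1 / 2 :: real"], of "sqrt m0 * (norm z)\<^sup>2"] by simp
  have "norm (\<Sum>k. taylor (k + 2) T * z ^ (k + 2)) \<le> (\<Sum>k. sqrt m0 * (norm z)\<^sup>2 * (1 / 2) ^ k)"
  proof (rule norm_suminf_le[OF _ sums_summable[OF geo]])
    fix k
    have "norm (taylor (k + 2) T * z ^ (k + 2)) = norm (taylor (k + 2) T) * (norm z)\<^sup>2 * norm z ^ k"
      by (simp add: norm_mult norm_power power_add power2_eq_square)
    also have "\<dots> \<le> sqrt m0 * (norm z)\<^sup>2 * (1 / 2) ^ k"
      using taylor_le[OF T, of "k + 2"] z m0_nonneg by (intro mult_mono power_mono) auto
    finally show "norm (taylor (k + 2) T * z ^ (k + 2)) \<le> sqrt m0 * (norm z)\<^sup>2 * (1 / 2) ^ k" .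
  qed
  then show ?thesis using sums_unique[OF *] sums_unique[OF geo] by simp
qed

text \<open>Cauchy's estimate for f minus its linear part on a disk of radius 1/4 about z. This disk
  lies in the disk of radius 1/2 about 0, where the difference is at most
  \<open>sqrt m0 / 2\<close>.\<close>

lemma D_minus_const:
  assumes T: "T \<ge> 0" and z: "norm z \<le> 1 / 4"
  shows "norm (D z T - of_real (a T)) \<le> 2 * sqrt m0"
proof -
  let ?g = "\<lambda>z. f z T - of_real (a T) * z"
  have mem: "norm w \<le> 1 / 2" if "dist z w \<le> 1 / 4" for w
    using that z norm_triangle_ineq4[of z "z - w"] by (simp add: dist_norm)
  have sub: "cball z (1 / 4) \<subseteq> ball 0 1"
  proof
    fix w assume "w \<in> cball z (1 / 4)"
    then show "w \<in> ball 0 1" using mem[of w] by simp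
  qed
  have "(\<lambda>w. ?g w) holomorphic_on ball z (1 / 4)"
    by (intro holomorphic_intros holomorphic_on_subset[OF f_holomorphic[OF T]]
        order.trans[OF ball_subset_cball sub])
  moreover have "continuous_on (cball z (1 / 4)) ?g"
    by (intro continuous_intros f_cont_space T order.trans[OF sub ball_subset_cball])
  ultimately have "norm ((deriv ^^ 1) ?g z) \<le> fact 1 * (sqrt m0 / 2) / (1 / 4) ^ 1"
  proof (rule Cauchy_inequality)
    fix w assume "norm (z - w) = 1 / 4"
    then have w: "norm w \<le> 1 / 2" by (intro mem) (simp add: dist_norm)
    have "norm (?g w) \<le> 2 * sqrt m0 * (norm w)\<^sup>2" by (rule f_minus_linear[OF T w])
    also have "\<dots> \<le> 2 * sqrt m0 * (1 / 2)\<^sup>2" using w m0_nonneg by (intro mult_left_mono power_mono) auto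
    finally show "norm (?g w) \<le> sqrt m0 / 2" by (simp add: power2_eq_square)
  qed simp
  moreover have "deriv ?g z = D z T - of_real (a T)"
    by (rule DERIV_imp_deriv) (use z T in \<open>auto intro!: derivative_eq_intros f_space\<close>)
  ultimately show ?thesis by simp
qed

lemma f_lower:
  assumes T: "T \<ge> 0" and z: "norm z \<le> 1 / 4" and a: "a T \<ge> sqrt m0"
  shows "a T * norm z / 2 \<le> norm (f z T)"
proof -
  have "2 * sqrt m0 * (norm z)\<^sup>2 \<le> 2 * sqrt m0 * (1 / 4 * norm z)"
    unfolding power2_eq_square using z m0_nonneg by (intro mult_left_mono mult_right_mono) auto
  also have "\<dots> \<le> a T * norm z / 2"
    using mult_right_mono[OF a norm_ge_zero[of z]] by (simp add: mult_ac)
  finally have "norm (f z T - of_real (a T) * z) \<le> a T * norm z / 2"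
    using f_minus_linear[OF T, of z] z by simp
  moreover have "norm (of_real (a T) * z) = a T * norm z"
    using a_pos[OF T] by (simp add: norm_mult)
  ultimately show ?thesis
    using norm_triangle_ineq3[of "f z T" "of_real (a T) * z"] by simp
qed

text \<open>Wherever the modulus of \<open>\<phi> 0\<close> is at most 1/4, \<open>f_lower\<close>
  improves this to 2 B / a, which is below 1/4 since a > 8 B. The value 1/4 is thus never attained,
  and the modulus, being 0 at the origin, cannot get past it.\<close>

lemma transition_small:
  assumes tr: "transition T \<phi>" and T: "T \<ge> 0" and a: "a T \<ge> sqrt m0" "a T > 8 * B"
    and B: "\<And>z. norm z \<le> 1 \<Longrightarrow> norm (f z 0) \<le> B" and z: "norm z < 1"
  shows "norm (\<phi> 0 z) \<le> 2 * B / a T"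
proof (rule ccontr)
  assume large: "\<not> norm (\<phi> 0 z) \<le> 2 * B / a T"
  have s: "0 \<in> {0..T}" using T by simp
  have apos: "a T > 0" by (rule a_pos[OF T])
  have gap: "norm (\<phi> 0 w) \<le> 2 * B / a T" if w: "norm w < 1" "norm (\<phi> 0 w) \<le> 1 / 4" for w
  proof -
    have "a T * norm (\<phi> 0 w) / 2 \<le> norm (f (\<phi> 0 w) T)" by (rule f_lower[OF T w(2) a(1)])
    also have "\<dots> \<le> B" using transitionD(3)[OF tr s w(1)] B[of w] w(1) by simp
    finally show ?thesis using apos by (simp add: field_simps)
  qed
  have "connected ((\<lambda>w. norm (\<phi> 0 w)) ` ball 0 1)"
    by (intro connected_continuous_image continuous_intros transition_cont_space[OF tr s]) auto
  moreover have "norm (\<phi> 0 0) \<in> (\<lambda>w. norm (\<phi> 0 w)) ` ball 0 1" "norm (\<phi> 0 z) \<in> (\<lambda>w. norm (\<phi> 0 w)) ` ball 0 1"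
    using z by auto
  moreover have "norm (\<phi> 0 0) \<le> 1 / 4" using transitionD(1)[OF tr s, of 0] by simp
  moreover have "1 / 4 \<le> norm (\<phi> 0 z)" using gap[OF z] large by linarith
  ultimately have "1 / 4 \<in> (\<lambda>w. norm (\<phi> 0 w)) ` ball 0 1"
    by (rule connectedD_interval[of _ "norm (\<phi> 0 0)" "norm (\<phi> 0 z)"])
  then obtain w where w: "norm w < 1" "norm (\<phi> 0 w) = 1 / 4" by force
  then have "1 / 4 \<le> 2 * B / a T" using gap[of w] by simp
  then show False using a(2) apos by (simp add: field_simps)
qed

end

section \<open>Lagrange inversion and the asymptotics\<close>

lemma circle_mean_inverse_power:
  assumes "\<rho> > 0" "m \<ge> 1" shows "circle_mean \<rho> (\<lambda>z. 1 / z ^ m) = 0"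
proof -
  have "(deriv ^^ m) (\<lambda>_. 1 :: complex) 0 = 0" using assms(2) by (cases m) (simp_all add: funpow_swap1)
  then have "circle_mean \<rho> (\<lambda>z. z * (1 / (z - 0) ^ Suc m)) = 0"
    using Cauchy_has_contour_integral_higher_derivative_circlepath[of 0 \<rho> "\<lambda>_. 1" 0 m, THEN contour_integral_unique] assms(1)
    by (simp add: contour_integral_circlepath_mean)
  moreover have "circle_mean \<rho> (\<lambda>z. 1 / z ^ m) = circle_mean \<rho> (\<lambda>z. z * (1 / (z - 0) ^ Suc m))"
    by (rule circle_mean_cong) (use assms in auto)
  ultimately show ?thesis by simp
qed

text \<open>The difference quotient \<open>G\<close> of \<open>F\<close> at \<open>w\<close> is
  holomorphic and has no zeros on the disk by injectivity, so the integrand is a Cauchy kernel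
  applied to \<open>x ^ p / G x\<close>.\<close>

lemma Lagrange_circle_mean:
  fixes F :: "complex \<Rightarrow> complex"
  assumes hol: "F holomorphic_on ball 0 1" and w: "norm w < \<rho>" and \<rho>: "\<rho> < 1"
    and inj: "\<And>x. norm x \<le> \<rho> \<Longrightarrow> x \<noteq> w \<Longrightarrow> F x \<noteq> F w" and nz: "deriv F w \<noteq> 0"
  shows "circle_mean \<rho> (\<lambda>x. x * (x ^ p / (F x - F w))) = w ^ p / deriv F w"
proof -
  define G where "G x = (if x = w then deriv F w else (F x - F w) / (x - w))" for x
  have w1: "w \<in> ball 0 1" using w \<rho> by simp
  have holG: "G holomorphic_on ball 0 1"
  proof (rule pole_theorem_open_0[where a = w and g = "\<lambda>x. F x - F w"])
    show "G w = deriv (\<lambda>x. F x - F w) w"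
      using holomorphic_derivI[OF hol open_ball w1]
      by (auto simp: G_def intro!: DERIV_imp_deriv[symmetric] derivative_eq_intros)
  qed (auto simp: G_def intro!: holomorphic_intros hol)
  have Gnz: "G x \<noteq> 0" if "norm x \<le> \<rho>" for x :: complex using inj[OF that] nz by (auto simp: G_def)
  define H where "H x = x ^ p / G x" for x
  have "(\<lambda>x. x ^ p / G x) holomorphic_on cball 0 \<rho>"
    by (intro holomorphic_intros holomorphic_on_subset[OF holG]) (use Gnz \<rho> in auto)
  then have holH: "H holomorphic_on cball 0 \<rho>" unfolding H_def[abs_def] .
  have "circle_mean \<rho> (\<lambda>x. x * (x ^ p / (F x - F w))) = circle_mean \<rho> (\<lambda>x. x * (H x / (x - w)))"
  proof (rule circle_mean_cong)
    fix x :: complex assume "norm x = \<rho>"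
    then have "x \<noteq> w" using w by auto
    then show "x * (x ^ p / (F x - F w)) = x * (H x / (x - w))" by (simp add: H_def G_def)
  qed (use order.trans[OF norm_ge_zero less_imp_le[OF w]] in simp)
  also have "\<dots> = H w"
    by (rule Cauchy_circle_mean[OF holomorphic_on_imp_continuous_on[OF holH] holomorphic_on_subset[OF holH ball_subset_cball] w])
  finally show ?thesis by (simp add: H_def G_def)
qed

lemma geometric_remainder:
  fixes u y :: complex
  assumes "u \<noteq> 0" "u \<noteq> y"
  shows "1 / (u - y) = (\<Sum>k\<le>r. y ^ k / u ^ Suc k) + y ^ Suc r / (u ^ Suc r * (u - y))"
proof (induction r)
  case 0
  then show ?case using assms by (simp add: field_simps)
next
  case (Suc r)
  have "y ^ Suc r / (u ^ Suc r * (u - y)) = y ^ Suc r / u ^ Suc (Suc r) + y ^ Suc (Suc r) / (u ^ Suc (Suc r) * (u - y))"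
    using assms by (simp add: divide_simps) (simp add: algebra_simps)
  with Suc.IH show ?case by simp
qed

lemma norm_power_minus_one_le:
  fixes v :: complex
  assumes "norm v \<le> 2" shows "norm (v ^ n - 1) \<le> norm (v - 1) * (real n * 2 ^ n)"
proof -
  have "norm (\<Sum>i<n. v ^ i) \<le> (\<Sum>i<n. 2 ^ n)"
  proof (rule order.trans[OF norm_sum sum_mono])
    fix i assume "i \<in> {..<n}"
    have "norm v ^ i \<le> 2 ^ i" using assms by (intro power_mono) auto
    also have "\<dots> \<le> (2::real) ^ n" using \<open>i \<in> {..<n}\<close> by (intro power_increasing) auto
    finally show "norm (v ^ i) \<le> 2 ^ n" by (simp add: norm_power)
  qed
  then show ?thesis unfolding power_diff_1_eq norm_mult by (intro mult_left_mono) auto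
qed

context pg_solution begin

lemma harmonic_moment_0:
  "harmonic_moment f k 0 = circle_mean 1 (\<lambda>z. f z 0 ^ k * cnj (f z 0) * (z * D z 0))"
proof -
  have "harmonic_moment f k 0 = circle_mean 1 (\<lambda>z. z * (f z 0 ^ k * reflected f z 0 * D z 0))"
    by (simp add: harmonic_moment_def contour_integral_circlepath_mean)
  also have "\<dots> = circle_mean 1 (\<lambda>z. f z 0 ^ k * cnj (f z 0) * (z * D z 0))"
  proof (rule circle_mean_cong)
    fix z :: complex assume z: "norm z = 1"
    then have "z * cnj z = 1" by (simp add: complex_norm_square[symmetric])
    then have "1 / cnj z = z" by (metis div_by_1 divide_divide_eq_right mult_zero_right nonzero_eq_divide_eq one_neq_zero mult.commute)
    then show "z * (f z 0 ^ k * reflected f z 0 * D z 0) = f z 0 ^ k * cnj (f z 0) * (z * D z 0)"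
      by (simp add: reflected_def)
  qed simp
  finally show ?thesis .
qed

lemma harmonic_moment_0_0: "harmonic_moment f 0 0 = of_real m0"
  unfolding harmonic_moment_0 area_0[symmetric] area_def by simp

lemma initial_bound: "\<exists>B>0. \<forall>z. norm z \<le> 1 \<longrightarrow> norm (f z 0) \<le> B \<and> norm (cnj (f z 0) * (z * D z 0)) \<le> B"
proof -
  have "bounded ((\<lambda>z. f z 0) ` cball 0 1)" "bounded ((\<lambda>z. cnj (f z 0) * (z * D z 0)) ` cball 0 1)"
    by (intro compact_imp_bounded compact_continuous_image continuous_intros f_cont_space D_cont_space compact_cball order.refl)+
  then obtain B1 B2 where B: "\<forall>x\<in>(\<lambda>z. f z 0) ` cball 0 1. norm x \<le> B1"
      "\<forall>x\<in>(\<lambda>z. cnj (f z 0) * (z * D z 0)) ` cball 0 1. norm x \<le> B2"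
    unfolding bounded_iff by (elim exE)
  show ?thesis
  proof (intro exI[of _ "max 1 (max B1 B2)"] conjI allI impI)
    fix z :: complex assume "norm z \<le> 1"
    then show "norm (f z 0) \<le> max 1 (max B1 B2)" "norm (cnj (f z 0) * (z * D z 0)) \<le> max 1 (max B1 B2)"
      using B by (auto simp: le_max_iff_disj)
  qed simp
qed

section \<open>Estimates at one fixed time with large leading coefficient\<close>

context
  fixes B T :: real and \<phi> :: "real \<Rightarrow> complex \<Rightarrow> complex"
  assumes B: "B > 0" "\<And>z. norm z \<le> 1 \<Longrightarrow> norm (f z 0) \<le> B"
      "\<And>z. norm z \<le> 1 \<Longrightarrow> norm (cnj (f z 0) * (z * D z 0)) \<le> B"
    and T: "T \<ge> 0" and tr: "transition T \<phi>"
    and large: "a T \<ge> 4 * sqrt m0 + 1" "a T \<ge> 16 * B + 1"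
begin

text \<open>The first threshold keeps f' within a / 2 of a on the disk of radius 1/4 and makes f
  injective there. The second keeps the initial image well inside the image of the circle of radius
  1/4. The summands 1 make inequalities strict and give a \<ge> 1.\<close>

lemma large': "a T > 0" "a T \<ge> sqrt m0" "a T > 8 * B" "2 * sqrt m0 \<le> a T / 2" "a T > 2 * sqrt m0" "a T \<ge> 16 * B" "a T \<ge> 1"
  using large B(1) m0_nonneg by auto

lemma zero_mem: "0 \<in> {0..T}" using T by simp

lemma \<phi>_small: "norm z < 1 \<Longrightarrow> norm (\<phi> 0 z) \<le> 2 * B / a T"
  by (rule transition_small[OF tr T large'(2,3) B(2)])

lemma \<phi>_less: assumes "norm z < 1" shows "norm (\<phi> 0 z) < 1 / 4"
proof -
  have "2 * B / a T < 1 / 4" using large'(1,3) by (simp add: field_simps)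
  with \<phi>_small[OF assms] show ?thesis by linarith
qed

lemma D_lower: assumes "norm x \<le> 1 / 4" shows "a T / 2 \<le> norm (D x T)"
proof -
  have "norm (of_real (a T) :: complex) = a T" using large'(1) by simp
  moreover have "norm (D x T - of_real (a T)) \<le> a T / 2" using D_minus_const[OF T assms] large'(4) by linarith
  ultimately show ?thesis using norm_triangle_ineq3[of "D x T" "of_real (a T)"] by simp
qed

text \<open>On this disk f is multiplication by a plus a map with Lipschitz constant
  \<open>2 * sqrt m0\<close>, which is smaller than a.\<close>

lemma f_injective:
  assumes "norm x \<le> 1 / 4" "norm w \<le> 1 / 4" "x \<noteq> w" shows "f x T \<noteq> f w T"
proof
  assume eq: "f x T = f w T"
  have "norm ((f x T - of_real (a T) * x) - (f w T - of_real (a T) * w)) \<le> 2 * sqrt m0 * norm (x - w)"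
  proof (rule field_differentiable_bound[of "cball 0 (1 / 4)" _ "\<lambda>z. D z T - of_real (a T)"])
    fix z :: complex assume z: "z \<in> cball 0 (1 / 4)"
    have "((\<lambda>z. f z T - of_real (a T) * z) has_field_derivative D z T - of_real (a T)) (at z)"
      using z by (auto intro!: derivative_eq_intros f_space T)
    then show "((\<lambda>z. f z T - of_real (a T) * z) has_field_derivative D z T - of_real (a T)) (at z within cball 0 (1 / 4))"
      by (rule has_field_derivative_at_within)
    show "norm (D z T - of_real (a T)) \<le> 2 * sqrt m0" using D_minus_const[OF T, of z] z by simp
  qed (use assms in auto)
  moreover have "(f x T - of_real (a T) * x) - (f w T - of_real (a T) * w) = - of_real (a T) * (x - w)"
    using eq by (simp add: algebra_simps)
  ultimately have "a T * norm (x - w) \<le> 2 * sqrt m0 * norm (x - w)"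
    using large'(1) by (simp add: norm_mult)
  then show False using assms(3) large'(5) by simp
qed

lemma deriv_f_eq: "deriv (\<lambda>z. f z T) x = D x T" by (simp add: space_deriv_def)

lemma Lagrange_f:
  assumes "norm w < 1 / 4"
  shows "circle_mean (1 / 4) (\<lambda>x. x * (x ^ p / (f x T - f w T))) = w ^ p / D w T"
proof -
  have "circle_mean (1 / 4) (\<lambda>x. x * (x ^ p / (f x T - f w T))) = w ^ p / deriv (\<lambda>z. f z T) w"
    by (rule Lagrange_circle_mean[OF f_holomorphic[OF T] assms])
      (use f_injective assms D_nonzero[OF T, of w] in \<open>auto simp: deriv_f_eq\<close>)
  then show ?thesis by (simp add: deriv_f_eq)
qed

lemma f_circle:
  assumes "norm x = 1 / 4"
  shows "a T / 8 \<le> norm (f x T)" "f x T \<noteq> 0" "norm y \<le> B \<Longrightarrow> a T / 16 \<le> norm (f x T - y)" "norm y \<le> B \<Longrightarrow> f x T \<noteq> y"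
proof -
  show 1: "a T / 8 \<le> norm (f x T)" using f_lower[OF T, of x] assms large'(2) by simp
  then show "f x T \<noteq> 0" using large'(1) by auto
  show 2: "a T / 16 \<le> norm (f x T - y)" if "norm y \<le> B"
    using 1 that large'(6) norm_triangle_ineq2[of "f x T" y] by linarith
  show "f x T \<noteq> y" if "norm y \<le> B" using 2[OF that] large'(1) by auto
qed

text \<open>The coefficient of \<open>y ^ k\<close> in \<open>w ^ p / f'(w)\<close>, where w is the
  preimage of y near 0 under f at time T: a Lagrange coefficient written as a contour
  integral.\<close>

definition \<theta> :: "nat \<Rightarrow> nat \<Rightarrow> complex" where
  "\<theta> p k = circle_mean (1 / 4) (\<lambda>x. x * (x ^ p / f x T ^ Suc k))"

lemma \<theta>_0: "\<theta> p 0 = 0 ^ p / of_real (a T)"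
  using Lagrange_f[of 0 p] T by (simp add: \<theta>_def D_0_eq)

lemma f_cont_quarter: "continuous_on (sphere 0 (1 / 4)) (\<lambda>x. f x T)"
  by (rule f_cont_space[OF T]) auto

text \<open>The kernel \<open>1 / (f x T - y)\<close> with y = f(z,0) is expanded geometrically,
  with explicit remainder. The constants 8 and 16 are the lower bounds of \<open>f_circle\<close>;
  the order r is the last one at which a moment is kept.\<close>

lemma Lagrange_expansion:
  assumes z: "norm z < 1"
  shows "norm (\<phi> 0 z ^ p / D (\<phi> 0 z) T - (\<Sum>k\<le>r. \<theta> p k * f z 0 ^ k)) \<le> B ^ Suc r * (8 / a T) ^ Suc r * (16 / a T)"
proof -
  define y where "y = f z 0"
  have y: "norm y \<le> B" using B(2)[of z] z by (simp add: y_def)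
  have fy: "f (\<phi> 0 z) T = y" using transitionD(3)[OF tr zero_mem z] by (simp add: y_def)
  note nz = f_circle(2) f_circle(4)[OF _ y]
  let ?R = "\<lambda>x. x * (x ^ p * (y ^ Suc r / (f x T ^ Suc r * (f x T - y))))"
  have nz': "f x T \<noteq> 0" "f x T - y \<noteq> 0" if "x \<in> sphere 0 (1 / 4)" for x
    using nz[of x] that by auto
  have cR: "continuous_on (sphere 0 (1 / 4)) ?R"
    by (intro continuous_intros f_cont_quarter) (use nz' in auto)
  have ck: "continuous_on (sphere 0 (1 / 4)) (\<lambda>x. y ^ k * (x * (x ^ p / f x T ^ Suc k)))" for k
    by (intro continuous_intros f_cont_quarter) (use nz' in auto)
  have "\<phi> 0 z ^ p / D (\<phi> 0 z) T = circle_mean (1 / 4) (\<lambda>x. x * (x ^ p / (f x T - y)))"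
    using Lagrange_f[OF \<phi>_less[OF z], of p] fy by simp
  also have "\<dots> = circle_mean (1 / 4) (\<lambda>x. (\<Sum>k\<le>r. y ^ k * (x * (x ^ p / f x T ^ Suc k))) + ?R x)"
  proof (rule circle_mean_cong)
    fix x :: complex assume x: "norm x = 1 / 4"
    have "x * (x ^ p / (f x T - y)) = x * (x ^ p * (1 / (f x T - y)))" by simp
    also have "\<dots> = (\<Sum>k\<le>r. y ^ k * (x * (x ^ p / f x T ^ Suc k))) + ?R x"
      unfolding geometric_remainder[OF nz(1)[OF x] nz(2)[OF x], of r]
      by (simp add: distrib_left sum_distrib_left mult_ac)
    finally show "x * (x ^ p / (f x T - y)) = (\<Sum>k\<le>r. y ^ k * (x * (x ^ p / f x T ^ Suc k))) + ?R x" .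
  qed simp
  also have "\<dots> = circle_mean (1 / 4) (\<lambda>x. \<Sum>k\<le>r. y ^ k * (x * (x ^ p / f x T ^ Suc k))) + circle_mean (1 / 4) ?R"
    by (intro circle_mean_add continuous_on_sum ck cR) simp
  also have "circle_mean (1 / 4) (\<lambda>x. \<Sum>k\<le>r. y ^ k * (x * (x ^ p / f x T ^ Suc k))) = (\<Sum>k\<le>r. y ^ k * \<theta> p k)"
    unfolding \<theta>_def circle_mean_mult[symmetric] by (rule circle_mean_sum[OF _ ck]) simp_all
  finally have "\<phi> 0 z ^ p / D (\<phi> 0 z) T - (\<Sum>k\<le>r. \<theta> p k * f z 0 ^ k) = circle_mean (1 / 4) ?R"
    by (simp add: y_def mult.commute)
  also have "norm \<dots> \<le> B ^ Suc r * (8 / a T) ^ Suc r * (16 / a T)"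
  proof (rule norm_circle_mean_le[OF cR])
    fix x :: complex assume x: "norm x = 1 / 4"
    have "norm (?R x) = (norm x * norm x ^ p) * (norm y ^ Suc r * (1 / norm (f x T)) ^ Suc r * (1 / norm (f x T - y)))"
      by (simp add: norm_mult norm_divide norm_power power_divide)
    also have "\<dots> \<le> (1 * 1) * (B ^ Suc r * (8 / a T) ^ Suc r * (16 / a T))"
    proof (intro mult_mono power_mono)
      show "1 / norm (f x T) \<le> 8 / a T"
        using f_circle(1,2)[OF x] large'(1) by (simp add: field_simps)
      show "1 / norm (f x T - y) \<le> 16 / a T"
        using f_circle(3,4)[OF x y] large'(1) by (simp add: field_simps)
      show "norm x ^ p \<le> 1" using x by (intro power_le_one) auto
    qed (use x y B(1) large'(1) in auto)
    finally show "norm (?R x) \<le> B ^ Suc r * (8 / a T) ^ Suc r * (16 / a T)" by simp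
  qed simp
  finally show ?thesis .
qed

text \<open>For \<Psi> = \<open>z ^ p / f'\<close> the factor f' of the functional cancels, leaving
  \<open>cnj f * z ^ Suc p\<close>. As \<open>0 ^ 0 = 1\<close>, the term with Q is present exactly
  for p = 0.\<close>

lemma taylor_limit:
  "((\<lambda>\<rho>. circle_mean \<rho> (\<lambda>z. \<phi> 0 z ^ p / D (\<phi> 0 z) T * cnj (f z 0) * (z * D z 0))) \<longlongrightarrow>
    cnj (taylor (Suc p) T) - 2 * of_real (Q T) * (0 ^ p / of_real (a T))) (at_left 1)"
proof -
  have nz: "D z T \<noteq> 0" if "norm z \<le> 1" for z using D_nonzero[OF T that] .
  have "((\<lambda>\<rho>. circle_mean \<rho> (\<lambda>z. \<phi> 0 z ^ p / D (\<phi> 0 z) T * cnj (f z 0) * (z * D z 0))) \<longlongrightarrow>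
      circle_mean 1 (\<lambda>z. z ^ p / D z T * cnj (f z T) * (z * D z T)) - 2 * of_real (Q T) * (0 ^ p / D 0 T)) (at_left 1)"
    by (rule transport[OF tr T, of "\<lambda>z. z ^ p / D z T"])
      (use nz in \<open>auto intro!: continuous_intros holomorphic_intros D_cont_space D_holomorphic T\<close>)
  moreover have "circle_mean 1 (\<lambda>z. z ^ p / D z T * cnj (f z T) * (z * D z T)) = cnj (taylor (Suc p) T)"
  proof -
    have "circle_mean 1 (\<lambda>z. z ^ p / D z T * cnj (f z T) * (z * D z T)) =
        circle_mean 1 (\<lambda>z. cnj (f z T * cnj (z ^ Suc p)))"
      by (rule circle_mean_cong) (use nz in auto)
    then show ?thesis by (simp only: circle_mean_cnj taylor_mean[OF T])
  qed
  ultimately show ?thesis by (simp add: D_0_eq[OF T])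
qed

lemma initial_cont: "\<rho> < 1 \<Longrightarrow> continuous_on (sphere 0 \<rho>) (\<lambda>z. f z 0)" "\<rho> < 1 \<Longrightarrow> continuous_on (sphere 0 \<rho>) (\<lambda>z. D z 0)"
  by (auto intro!: f_cont_space D_cont_space)

lemma integrand_cont:
  assumes "\<rho> < 1" shows "continuous_on (sphere 0 \<rho>) (\<lambda>z. \<phi> 0 z ^ p / D (\<phi> 0 z) T)"
proof -
  have c: "continuous_on (sphere 0 \<rho>) (\<phi> 0)"
    by (rule continuous_on_subset[OF transition_cont_space[OF tr zero_mem]]) (use assms in auto)
  have m: "norm (\<phi> 0 z) \<le> 1" if "z \<in> sphere 0 \<rho>" for z
    using transitionD(2)[OF tr zero_mem, of z] that assms by simp
  have "continuous_on (sphere 0 \<rho>) (\<lambda>z. D (\<phi> 0 z) T)"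
    by (rule continuous_on_compose2[OF D_cont_space[OF T order.refl] c]) (use m in auto)
  then show ?thesis
    by (intro continuous_intros c) (use m D_nonzero[OF T] in auto)
qed

lemma eventually_inner: "\<forall>\<^sub>F \<rho> in at_left 1. 0 < \<rho> \<and> \<rho> < (1::real)"
  using eventually_at_left_real[of 0 "1::real"] by simp

text \<open>The error in \<open>taylor_expansion\<close> does not depend on p and so cannot be
  summed over all high degrees. Bounding the integrand directly by \<phi> = O(1/a) gives decay that
  is geometric in p.\<close>

lemma taylor_tail:
  assumes p: "p \<ge> 1" shows "norm (taylor (Suc p) T) \<le> (2 * B / a T) ^ p * (2 / a T) * B"
proof -
  have "norm (cnj (taylor (Suc p) T) - 2 * of_real (Q T) * (0 ^ p / of_real (a T))) \<le> (2 * B / a T) ^ p * (2 / a T) * B"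
  proof (rule Lim_norm_ubound[OF _ taylor_limit])
    show "\<forall>\<^sub>F \<rho> in at_left 1. norm (circle_mean \<rho> (\<lambda>z. \<phi> 0 z ^ p / D (\<phi> 0 z) T * cnj (f z 0) * (z * D z 0)))
        \<le> (2 * B / a T) ^ p * (2 / a T) * B"
      using eventually_inner
    proof eventually_elim
      case (elim \<rho>)
      show ?case
      proof (rule norm_circle_mean_le)
        show "continuous_on (sphere 0 \<rho>) (\<lambda>z. \<phi> 0 z ^ p / D (\<phi> 0 z) T * cnj (f z 0) * (z * D z 0))"
          using elim by (intro continuous_on_mult integrand_cont continuous_on_cnj continuous_on_id initial_cont) auto
        fix z :: complex assume z: "norm z = \<rho>"
        then have z1: "norm z < 1" using elim by simp
        have "norm (\<phi> 0 z ^ p / D (\<phi> 0 z) T * cnj (f z 0) * (z * D z 0)) =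
            norm (\<phi> 0 z) ^ p * (1 / norm (D (\<phi> 0 z) T)) * norm (cnj (f z 0) * (z * D z 0))"
          by (simp add: norm_mult norm_divide norm_power)
        also have "\<dots> \<le> (2 * B / a T) ^ p * (2 / a T) * B"
        proof (intro mult_mono power_mono \<phi>_small[OF z1] B(3))
          have "a T / 2 \<le> norm (D (\<phi> 0 z) T)" by (rule D_lower[OF less_imp_le[OF \<phi>_less[OF z1]]])
          moreover from this have "0 < norm (D (\<phi> 0 z) T)" using large'(1) by linarith
          ultimately show "1 / norm (D (\<phi> 0 z) T) \<le> 2 / a T" using large'(1) by (simp add: field_simps)
        qed (use z1 B(1) large'(1) in auto)
        finally show "norm (\<phi> 0 z ^ p / D (\<phi> 0 z) T * cnj (f z 0) * (z * D z 0)) \<le> (2 * B / a T) ^ p * (2 / a T) * B" .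
      qed (use elim in simp)
    qed
  qed simp
  moreover have "(0::complex) ^ p = 0" using p by simp
  ultimately show ?thesis by simp
qed

text \<open>Inside the disk \<phi> is replaced by a polynomial in the initial map, up to a uniform
  error. That polynomial extends to the unit circle, where its powers produce the moments as \<rho>
  tends to 1.\<close>

lemma taylor_expansion:
  "norm (cnj (taylor (Suc p) T) - 2 * of_real (Q T) * (0 ^ p / of_real (a T)) - (\<Sum>k\<le>r. \<theta> p k * harmonic_moment f k 0))
    \<le> B ^ Suc r * (8 / a T) ^ Suc r * (16 / a T) * B"
proof -
  let ?J = "\<lambda>\<rho>. circle_mean \<rho> (\<lambda>z. \<phi> 0 z ^ p / D (\<phi> 0 z) T * cnj (f z 0) * (z * D z 0))"
  let ?M = "\<lambda>k \<rho>. circle_mean \<rho> (\<lambda>z. f z 0 ^ k * cnj (f z 0) * (z * D z 0))"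
  have "((\<lambda>\<rho>. ?M k \<rho>) \<longlongrightarrow> harmonic_moment f k 0) (at_left 1)" for k
    unfolding harmonic_moment_0
    by (intro circle_mean_tendsto_1 continuous_intros f_cont_space D_cont_space order.refl)
  then have "((\<lambda>\<rho>. ?J \<rho> - (\<Sum>k\<le>r. \<theta> p k * ?M k \<rho>)) \<longlongrightarrow>
      cnj (taylor (Suc p) T) - 2 * of_real (Q T) * (0 ^ p / of_real (a T)) - (\<Sum>k\<le>r. \<theta> p k * harmonic_moment f k 0)) (at_left 1)"
    by (intro tendsto_diff taylor_limit tendsto_sum tendsto_mult_left)
  then show ?thesis
  proof (rule Lim_norm_ubound[rotated])
    show "\<forall>\<^sub>F \<rho> in at_left 1. norm (?J \<rho> - (\<Sum>k\<le>r. \<theta> p k * ?M k \<rho>)) \<le> B ^ Suc r * (8 / a T) ^ Suc r * (16 / a T) * B"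
      using eventually_inner
    proof eventually_elim
      case (elim \<rho>)
      have \<rho>: "\<rho> \<ge> 0" "\<rho> < 1" using elim by auto
      note c = integrand_cont[OF \<rho>(2)] initial_cont[OF \<rho>(2)]
      have ck: "continuous_on (sphere 0 \<rho>) (\<lambda>z. \<theta> p k * (f z 0 ^ k * cnj (f z 0) * (z * D z 0)))" for k
        by (intro continuous_intros c)
      have "(\<Sum>k\<le>r. \<theta> p k * ?M k \<rho>) = circle_mean \<rho> (\<lambda>z. \<Sum>k\<le>r. \<theta> p k * (f z 0 ^ k * cnj (f z 0) * (z * D z 0)))"
        by (subst circle_mean_sum) (auto intro: ck simp: \<rho> circle_mean_mult)
      then have "?J \<rho> - (\<Sum>k\<le>r. \<theta> p k * ?M k \<rho>) = circle_mean \<rho> (\<lambda>z. \<phi> 0 z ^ p / D (\<phi> 0 z) T * cnj (f z 0) * (z * D z 0) -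
          (\<Sum>k\<le>r. \<theta> p k * (f z 0 ^ k * cnj (f z 0) * (z * D z 0))))"
        by (simp only:) (intro circle_mean_diff[symmetric] continuous_on_mult continuous_on_sum continuous_on_cnj continuous_on_id c ck \<rho>)
      also have "\<dots> = circle_mean \<rho> (\<lambda>z. (\<phi> 0 z ^ p / D (\<phi> 0 z) T - (\<Sum>k\<le>r. \<theta> p k * f z 0 ^ k)) * (cnj (f z 0) * (z * D z 0)))"
        by (rule circle_mean_cong) (simp_all add: \<rho> left_diff_distrib sum_distrib_right mult.assoc)
      also have "norm \<dots> \<le> B ^ Suc r * (8 / a T) ^ Suc r * (16 / a T) * B"
      proof (rule norm_circle_mean_le)
        show "continuous_on (sphere 0 \<rho>) (\<lambda>z. (\<phi> 0 z ^ p / D (\<phi> 0 z) T - (\<Sum>k\<le>r. \<theta> p k * f z 0 ^ k)) * (cnj (f z 0) * (z * D z 0)))"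
          by (intro continuous_on_mult continuous_on_diff continuous_on_sum continuous_on_const continuous_on_power continuous_on_cnj continuous_on_id c)
        fix z :: complex assume "norm z = \<rho>"
        then have z: "norm z < 1" using \<rho> by simp
        show "norm ((\<phi> 0 z ^ p / D (\<phi> 0 z) T - (\<Sum>k\<le>r. \<theta> p k * f z 0 ^ k)) * (cnj (f z 0) * (z * D z 0)))
            \<le> B ^ Suc r * (8 / a T) ^ Suc r * (16 / a T) * B"
          unfolding norm_mult[of "_ - _"] using z B(1) large'(1) by (intro mult_mono Lagrange_expansion B(3)) auto
      qed (rule \<rho>)
      finally show ?case .
    qed
  qed simp
qed

text \<open>With \<open>u x = a * x / f x T\<close> close to 1, the scaled coefficient is the mean
  of \<open>u ^ Suc r * x ^ p / x ^ r\<close>, and putting u = 1 leaves 1 or 0. On the circle of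
  radius 1/4, u differs from 1 by at most \<open>sqrt m0 / a\<close>, and \<open>4 ^ r\<close>
  bounds the quotient of powers.\<close>

lemma \<theta>_asymptotic:
  assumes p: "p \<le> r"
  shows "norm (of_real (a T) ^ Suc r * \<theta> p r - (if p = r then 1 else 0)) \<le>
    sqrt m0 / a T * (real (Suc r) * 2 ^ Suc r) * 4 ^ r"
proof -
  define u where "u x = of_real (a T) * x / f x T" for x
  have cu: "continuous_on (sphere 0 (1 / 4)) u"
    unfolding u_def by (intro continuous_intros f_cont_quarter) (auto simp: f_circle(2))
  have c0: "continuous_on (sphere 0 (1 / 4)) (\<lambda>x::complex. x ^ p / x ^ r)"
    by (intro continuous_intros) auto
  have "of_real (a T) ^ Suc r * \<theta> p r = circle_mean (1 / 4) (\<lambda>x. u x ^ Suc r * (x ^ p / x ^ r))"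
    unfolding \<theta>_def circle_mean_mult[symmetric]
  proof (rule circle_mean_cong)
    fix x :: complex assume x: "norm x = 1 / 4"
    then have "x \<noteq> 0" by auto
    then show "of_real (a T) ^ Suc r * (x * (x ^ p / f x T ^ Suc r)) = u x ^ Suc r * (x ^ p / x ^ r)"
      using f_circle(2)[OF x] by (simp add: u_def power_divide power_mult_distrib)
  qed simp
  moreover have "(if p = r then 1 else 0) = circle_mean (1 / 4) (\<lambda>x. x ^ p / x ^ r)"
  proof (cases "p = r")
    case True
    have "circle_mean (1 / 4) (\<lambda>x. x ^ p / x ^ r) = circle_mean (1 / 4) (\<lambda>x. 1)"
      by (rule circle_mean_cong) (auto simp: True)
    then show ?thesis using True by (simp add: circle_mean_def)
  next
    case False
    have "circle_mean (1 / 4) (\<lambda>x. x ^ p / x ^ r) = circle_mean (1 / 4) (\<lambda>x. 1 / x ^ (r - p))"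
    proof (rule circle_mean_cong)
      fix x :: complex assume "norm x = 1 / 4"
      then have "x \<noteq> 0" by auto
      then show "x ^ p / x ^ r = 1 / x ^ (r - p)" using p by (simp add: power_diff)
    qed simp
    then show ?thesis using False p by (simp add: circle_mean_inverse_power)
  qed
  ultimately have "of_real (a T) ^ Suc r * \<theta> p r - (if p = r then 1 else 0) =
      circle_mean (1 / 4) (\<lambda>x. u x ^ Suc r * (x ^ p / x ^ r) - x ^ p / x ^ r)"
    by (simp only:) (intro circle_mean_diff[symmetric] continuous_on_mult continuous_on_power cu c0; simp)
  also have "norm \<dots> \<le> sqrt m0 / a T * (real (Suc r) * 2 ^ Suc r) * 4 ^ r"
  proof (rule norm_circle_mean_le)
    show "continuous_on (sphere 0 (1 / 4)) (\<lambda>x. u x ^ Suc r * (x ^ p / x ^ r) - x ^ p / x ^ r)"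
      by (intro continuous_on_mult continuous_on_power continuous_on_diff cu c0)
    fix x :: complex assume x: "norm x = 1 / 4"
    have fx: "f x T \<noteq> 0" by (rule f_circle(2)[OF x])
    have u2: "norm (u x) \<le> 2"
    proof -
      have eq: "norm (u x) = a T * (1 / 4) / norm (f x T)" using large'(1) by (simp add: u_def norm_mult norm_divide x)
      show ?thesis unfolding eq using f_circle(1)[OF x] fx by (simp add: field_simps)
    qed
    have "u x - 1 = - (f x T - of_real (a T) * x) / f x T" using fx by (simp add: u_def field_simps)
    then have "norm (u x - 1) = norm (f x T - of_real (a T) * x) / norm (f x T)"
      by (simp only: norm_divide norm_minus_cancel)
    also have "\<dots> \<le> (2 * sqrt m0 * (norm x)\<^sup>2) / (a T / 8)"
      by (rule frac_le[OF _ f_minus_linear[OF T] _ f_circle(1)[OF x]]) (use x large'(1) m0_nonneg in auto)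
    also have "\<dots> = sqrt m0 / a T" unfolding x by (simp add: power2_eq_square)
    finally have u1: "norm (u x - 1) \<le> sqrt m0 / a T" .
    have "norm (u x ^ Suc r - 1) \<le> norm (u x - 1) * (real (Suc r) * 2 ^ Suc r)"
      by (rule norm_power_minus_one_le[OF u2])
    also have "\<dots> \<le> sqrt m0 / a T * (real (Suc r) * 2 ^ Suc r)"
      using u1 by (intro mult_right_mono) auto
    finally have 1: "norm (u x ^ Suc r - 1) \<le> sqrt m0 / a T * (real (Suc r) * 2 ^ Suc r)" .
    have "norm (x ^ p / x ^ r) = (1 / 4) ^ p * 4 ^ r"
      unfolding norm_divide norm_power x by (simp add: power_divide)
    also have "\<dots> \<le> 1 * 4 ^ r" by (intro mult_right_mono power_le_one) auto
    finally have 2: "norm (x ^ p / x ^ r) \<le> 4 ^ r" by simp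
    have "norm (u x ^ Suc r * (x ^ p / x ^ r) - x ^ p / x ^ r) = norm (u x ^ Suc r - 1) * norm (x ^ p / x ^ r)"
      by (simp only: norm_mult[symmetric] left_diff_distrib mult_1)
    also have "\<dots> \<le> sqrt m0 / a T * (real (Suc r) * 2 ^ Suc r) * 4 ^ r"
      using 1 2 m0_nonneg large'(1) by (intro mult_mono) auto
    finally show "norm (u x ^ Suc r * (x ^ p / x ^ r) - x ^ p / x ^ r) \<le> sqrt m0 / a T * (real (Suc r) * 2 ^ Suc r) * 4 ^ r" .
  qed simp
  finally show ?thesis .
qed

text \<open>The vanishing moments leave only k = 0 and k = r in the expansion. The former adds m0 to
  2 Q, the latter yields the limit when p = r.\<close>

lemma taylor_asymptotic:
  assumes p: "p \<le> r" and r: "r \<ge> 1" and M: "\<And>k. 1 \<le> k \<Longrightarrow> k < r \<Longrightarrow> harmonic_moment f k 0 = 0"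
  shows "norm (of_real (a T) ^ Suc r * (cnj (taylor (Suc p) T) - of_real (2 * Q T + m0) * (0 ^ p / of_real (a T))) -
      (if p = r then harmonic_moment f r 0 else 0)) \<le>
    (B ^ Suc r * 8 ^ Suc r * 16 * B + sqrt m0 * (real (Suc r) * 2 ^ Suc r) * 4 ^ r * norm (harmonic_moment f r 0)) / a T"
proof -
  define A where "A = (of_real (a T) :: complex)"
  define X where "X = cnj (taylor (Suc p) T) - 2 * of_real (Q T) * (0 ^ p / A) - (\<Sum>k\<le>r. \<theta> p k * harmonic_moment f k 0)"
  let ?M = "harmonic_moment f r 0" and ?\<delta> = "if p = r then 1 else 0 :: complex"
  have A: "norm A = a T" "A \<noteq> 0" using large'(1) by (auto simp: A_def)
  have "(\<Sum>k\<le>r. \<theta> p k * harmonic_moment f k 0) = (\<Sum>k\<in>{0, r}. \<theta> p k * harmonic_moment f k 0)"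
    by (rule sum.mono_neutral_right) (use M in auto)
  also have "\<dots> = 0 ^ p / A * of_real m0 + \<theta> p r * ?M" using r by (simp add: \<theta>_0 harmonic_moment_0_0 A_def)
  finally have X: "cnj (taylor (Suc p) T) - of_real (2 * Q T + m0) * (0 ^ p / A) = X + \<theta> p r * ?M"
    by (simp add: X_def algebra_simps)
  have "A ^ Suc r * (cnj (taylor (Suc p) T) - of_real (2 * Q T + m0) * (0 ^ p / A)) - (if p = r then ?M else 0) =
      A ^ Suc r * X + (A ^ Suc r * \<theta> p r - ?\<delta>) * ?M"
    unfolding X by (simp add: algebra_simps)
  also have "norm \<dots> \<le> norm (A ^ Suc r * X) + norm ((A ^ Suc r * \<theta> p r - ?\<delta>) * ?M)"
    by (rule norm_triangle_ineq)
  also have "\<dots> \<le> B ^ Suc r * 8 ^ Suc r * 16 * B / a T + sqrt m0 / a T * (real (Suc r) * 2 ^ Suc r) * 4 ^ r * norm ?M"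
  proof (rule add_mono)
    have "norm (A ^ Suc r * X) = a T ^ Suc r * norm X" by (simp add: norm_mult norm_power A)
    also have "\<dots> \<le> a T ^ Suc r * (B ^ Suc r * (8 / a T) ^ Suc r * (16 / a T) * B)"
      using taylor_expansion[of p r] large'(1) unfolding X_def A_def by (intro mult_left_mono) auto
    also have "\<dots> = (a T * (8 / a T)) ^ Suc r * (B ^ Suc r * (16 / a T) * B)"
      unfolding power_mult_distrib by (simp only: mult_ac)
    also have "a T * (8 / a T) = 8" using large'(1) by simp
    finally show "norm (A ^ Suc r * X) \<le> B ^ Suc r * 8 ^ Suc r * 16 * B / a T" by (simp add: mult_ac)
    show "norm ((A ^ Suc r * \<theta> p r - ?\<delta>) * ?M) \<le> sqrt m0 / a T * (real (Suc r) * 2 ^ Suc r) * 4 ^ r * norm ?M"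
      unfolding norm_mult A_def by (rule mult_right_mono[OF \<theta>_asymptotic[OF p] norm_ge_zero])
  qed
  finally show ?thesis by (simp add: A_def add_divide_distrib)
qed

text \<open>f minus its prescribed linear part is split into the degrees up to r, the degree r + 1
  and the rest. After scaling, only degree r + 1 has a limit other than 0; the four summands of the
  constant come from the low degrees, from the two errors in degree r + 1, and from the
  tail.\<close>

lemma final_estimate:
  assumes r: "r \<ge> 1" and M: "\<And>k. 1 \<le> k \<Longrightarrow> k < r \<Longrightarrow> harmonic_moment f k 0 = 0"
    and Q: "Q T \<ge> 0" and z: "norm z = 1"
  defines "K \<equiv> B ^ Suc r * 8 ^ Suc r * 16 * B + sqrt m0 * (real (Suc r) * 2 ^ Suc r) * 4 ^ r * norm (harmonic_moment f r 0)"
  shows "norm ((f z T - of_real (sqrt (2 * Q T + m0)) * z) * of_real (sqrt (2 * Q T)) ^ Suc r -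
      cnj (harmonic_moment f r 0) * z ^ Suc r) \<le>
    (real (Suc r) * K + K + norm (harmonic_moment f r 0) * real (Suc r) * m0 + (2 * B) ^ Suc r * 4 * B) / a T"
proof -
  define S where "S = sqrt (2 * Q T)"
  define N where "N = sqrt (2 * Q T + m0)"
  define \<alpha> where "\<alpha> = a T"
  let ?M = "harmonic_moment f r 0"
  have \<alpha>: "\<alpha> > 0" "\<alpha> \<ge> 1" using large'(1,7) by (auto simp: \<alpha>_def)
  have S0: "S \<ge> 0" and S2: "S\<^sup>2 = 2 * Q T" using Q by (auto simp: S_def)
  have N0: "N \<ge> 0" and N2: "N\<^sup>2 = 2 * Q T + m0" using Q m0_nonneg by (auto simp: N_def)
  have "S\<^sup>2 \<le> \<alpha>\<^sup>2" using a_growth[OF T] zero_le_power2[of "a 0"] unfolding S2 \<alpha>_def by linarith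
  \<comment> \<open>In the terms that tend to 0 the scaling by powers of S may therefore be replaced
    by the larger one by powers of a.\<close>
  then have S\<alpha>: "S \<le> \<alpha>" using \<alpha>(1) by (auto intro: power2_le_imp_le)
  have asym: "norm (of_real \<alpha> ^ Suc r * (cnj (taylor (Suc p) T) - of_real (2 * Q T + m0) * (0 ^ p / of_real \<alpha>)) -
      (if p = r then ?M else 0)) \<le> K / \<alpha>" if "p \<le> r" for p
    unfolding \<alpha>_def K_def by (rule taylor_asymptotic[OF that r M])
  have K0: "K \<ge> 0" using B(1) m0_nonneg by (simp add: K_def)
  \<comment> \<open>Coefficients of f minus its prescribed linear part; degree 1 is the case p =
    0.\<close>
  define c where "c k = taylor k T - (if k = 1 then of_real N else 0)" for k
  have c: "norm (c k) * S ^ Suc r \<le> K / \<alpha>" if k: "k \<le> r" for k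
  proof -
    have "norm (c k) * \<alpha> ^ Suc r \<le> K / \<alpha>"
    proof -
      consider "k = 0" | "k = 1" | "k \<ge> 2" by linarith
      then show ?thesis
      proof cases
        case 1
        then show ?thesis using K0 \<alpha> T by (simp add: c_def taylor_0)
      next
        case 2
        have "cnj (taylor (Suc 0) T) - of_real (2 * Q T + m0) * (0 ^ 0 / of_real \<alpha>) = of_real ((\<alpha> - N) * (\<alpha> + N) / \<alpha>)"
          using taylor_1[OF T] \<alpha>(1) unfolding N2[symmetric] by (simp add: \<alpha>_def field_simps power2_eq_square)
        then have "norm (of_real \<alpha> ^ Suc r * (of_real ((\<alpha> - N) * (\<alpha> + N) / \<alpha>) :: complex)) \<le> K / \<alpha>"
          using asym[of 0] r by simp
        then have "\<alpha> ^ Suc r * (\<bar>\<alpha> - N\<bar> * ((\<alpha> + N) / \<alpha>)) \<le> K / \<alpha>"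
          using \<alpha>(1) N0 unfolding norm_mult norm_power norm_of_real by (simp add: abs_mult)
        moreover have "\<bar>\<alpha> - N\<bar> * 1 \<le> \<bar>\<alpha> - N\<bar> * ((\<alpha> + N) / \<alpha>)"
          using \<alpha>(1) N0 by (intro mult_left_mono) auto
        then have "\<alpha> ^ Suc r * \<bar>\<alpha> - N\<bar> \<le> \<alpha> ^ Suc r * (\<bar>\<alpha> - N\<bar> * ((\<alpha> + N) / \<alpha>))"
          using \<alpha>(1) by (intro mult_left_mono) auto
        moreover have "norm (c k) = \<bar>\<alpha> - N\<bar>"
          unfolding c_def 2 using taylor_1[OF T] norm_of_real[of "\<alpha> - N", where 'a = complex] by (simp add: \<alpha>_def)
        ultimately show ?thesis by (simp add: mult_ac)
      next
        case 3
        define p where "p = k - 1"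
        have p: "k = Suc p" "p \<ge> 1" "p < r" using 3 k by (auto simp: p_def)
        have "norm (of_real \<alpha> ^ Suc r * cnj (taylor k T)) \<le> K / \<alpha>"
          using asym[of p] p by (simp add: power_0_left)
        then show ?thesis using 3 \<alpha>(1) by (simp add: c_def norm_mult norm_power mult_ac)
      qed
    qed
    moreover have "norm (c k) * S ^ Suc r \<le> norm (c k) * \<alpha> ^ Suc r"
      using S0 S\<alpha> by (intro mult_left_mono power_mono) auto
    ultimately show ?thesis by linarith
  qed
  have main: "norm (taylor (Suc r) T * of_real S ^ Suc r - cnj ?M) \<le> K / \<alpha> + norm ?M * real (Suc r) * m0 / \<alpha>"
  proof -
    \<comment> \<open>In degree r + 1 the change of scale from a to S does matter; its cost
      \<open>1 - s ^ Suc r\<close> is linear in 1 - s by Bernoulli's inequality.\<close>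
    define s where "s = S / \<alpha>"
    have s: "0 \<le> s" "s \<le> 1" using S0 S\<alpha> \<alpha>(1) by (auto simp: s_def)
    have S: "S = s * \<alpha>" using \<alpha>(1) by (simp add: s_def)
    define t where "t = taylor (Suc r) T * of_real \<alpha> ^ Suc r - cnj ?M"
    have "cnj t = of_real \<alpha> ^ Suc r * (cnj (taylor (Suc r) T) - of_real (2 * Q T + m0) * (0 ^ r / of_real \<alpha>)) - ?M"
      using r by (simp add: t_def power_0_left mult_ac)
    then have t: "norm t \<le> K / \<alpha>" using asym[of r] by (metis complex_mod_cnj order.refl)
    have "taylor (Suc r) T * of_real S ^ Suc r - cnj ?M = t * of_real (s ^ Suc r) - cnj ?M * of_real (1 - s ^ Suc r)"
      unfolding S t_def by (simp add: algebra_simps power_mult_distrib)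
    also have "norm \<dots> \<le> norm (t * of_real (s ^ Suc r)) + norm (cnj ?M * of_real (1 - s ^ Suc r))"
      by (rule norm_triangle_ineq4)
    also have "\<dots> \<le> K / \<alpha> * 1 + norm ?M * (real (Suc r) * m0 / \<alpha>)"
    proof (rule add_mono)
      show "norm (t * of_real (s ^ Suc r)) \<le> K / \<alpha> * 1"
        unfolding norm_mult norm_of_real using s t K0 \<alpha>(1) by (intro mult_mono) (auto simp: power_le_one abs_mult mult_le_one)
      have sS: "s ^ Suc r \<le> 1" using s by (rule power_le_one)
      have "1 + real (Suc r) * (s - 1) \<le> (1 + (s - 1)) ^ Suc r"
        by (rule Bernoulli_inequality) (use s in simp)
      then have "1 - s ^ Suc r \<le> real (Suc r) * (1 - s)" by (simp add: algebra_simps)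
      \<comment> \<open>The squares of \<alpha> and S differ by at most m0. Here \<alpha> \<ge> 1 is
        used to pass from the difference of squares to (1 - s) * \<alpha>.\<close>
      also have "1 - s \<le> m0 / \<alpha>"
      proof -
        have "\<alpha>\<^sup>2 - S\<^sup>2 \<le> m0" using a_upper[OF T] unfolding S2 \<alpha>_def by linarith
        then have "(1 - s\<^sup>2) * \<alpha>\<^sup>2 \<le> m0" unfolding S by (simp add: algebra_simps power_mult_distrib)
        moreover have "(1 - s) * \<alpha> \<le> (1 - s\<^sup>2) * \<alpha>\<^sup>2"
        proof (rule mult_mono)
          show "1 - s \<le> 1 - s\<^sup>2" using s by (simp add: power2_eq_square mult_left_le)
          show "\<alpha> \<le> \<alpha>\<^sup>2" using \<alpha> by (simp add: power2_eq_square)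
          show "0 \<le> 1 - s\<^sup>2" using s by (simp add: power_le_one)
        qed (use \<alpha> in simp)
        ultimately have "(1 - s) * \<alpha> \<le> m0" by linarith
        then show ?thesis using \<alpha>(1) by (simp add: pos_le_divide_eq)
      qed
      finally have "1 - s ^ Suc r \<le> real (Suc r) * m0 / \<alpha>" by (simp add: mult_left_mono)
      then show "norm (cnj ?M * of_real (1 - s ^ Suc r)) \<le> norm ?M * (real (Suc r) * m0 / \<alpha>)"
        unfolding norm_mult norm_of_real complex_mod_cnj using sS by (intro mult_left_mono) auto
    qed
    finally show ?thesis by (simp add: mult_ac)
  qed
  define tail where "tail = (\<Sum>j. taylor (j + (r + 2)) T * z ^ (j + (r + 2)))"
  have "(\<lambda>j. taylor (j + (r + 2)) T * z ^ (j + (r + 2))) sums (f z T - (\<Sum>k<r + 2. taylor k T * z ^ k))"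
    by (rule sums_split_initial_segment[OF taylor_sums_bound(1)[OF T]]) (use z in simp)
  then have tail: "tail = f z T - (\<Sum>k<r + 2. taylor k T * z ^ k)" by (simp add: tail_def sums_iff)
  have tail_le: "norm tail * S ^ Suc r \<le> (2 * B) ^ Suc r * 4 * B / \<alpha>"
  proof -
    \<comment> \<open>Ratio of the geometric bound in \<open>taylor_tail\<close>; it is below 1/2
      since a > 8 B, so the tail sums to at most twice its first term.\<close>
    define w where "w = 2 * B / \<alpha>"
    have w: "0 \<le> w" "w \<le> 1 / 2" using B(1) large'(3) \<alpha>(1) by (auto simp: w_def \<alpha>_def field_simps)
    have geo: "(\<lambda>j. w ^ Suc r * (2 / \<alpha> * B) * (1 / 2) ^ j) sums (w ^ Suc r * (2 / \<alpha> * B) * 2)"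
      using sums_mult[OF geometric_sums[of "1 / 2 :: real"], of "w ^ Suc r * (2 / \<alpha> * B)"] by simp
    have "norm tail \<le> (\<Sum>j. w ^ Suc r * (2 / \<alpha> * B) * (1 / 2) ^ j)"
      unfolding tail_def
    proof (rule norm_suminf_le[OF _ sums_summable[OF geo]])
      fix j
      have "norm (taylor (j + (r + 2)) T * z ^ (j + (r + 2))) = norm (taylor (Suc (Suc r + j)) T)"
        using z by (simp add: norm_mult norm_power add_ac)
      also have "\<dots> \<le> w ^ (Suc r + j) * (2 / \<alpha>) * B"
        unfolding w_def \<alpha>_def by (rule taylor_tail) simp
      also have "\<dots> = w ^ Suc r * (2 / \<alpha> * B) * w ^ j" by (simp only: power_add mult_ac)
      also have "\<dots> \<le> w ^ Suc r * (2 / \<alpha> * B) * (1 / 2) ^ j"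
        using w B(1) \<alpha>(1) by (intro mult_left_mono power_mono) auto
      finally show "norm (taylor (j + (r + 2)) T * z ^ (j + (r + 2))) \<le> w ^ Suc r * (2 / \<alpha> * B) * (1 / 2) ^ j" .
    qed
    also have "\<dots> = w ^ Suc r * (4 * B / \<alpha>)" unfolding sums_unique[OF geo, symmetric] by simp
    finally have "norm tail * S ^ Suc r \<le> (w ^ Suc r * (4 * B / \<alpha>)) * \<alpha> ^ Suc r"
      using S0 S\<alpha> w B(1) \<alpha>(1) by (intro mult_mono power_mono) auto
    also have "\<dots> = (w * \<alpha>) ^ Suc r * (4 * B / \<alpha>)" by (simp only: power_mult_distrib mult_ac)
    also have "w * \<alpha> = 2 * B" using \<alpha>(1) by (simp add: w_def)
    finally show ?thesis by simp
  qed
  have "(\<Sum>k<r + 2. taylor k T * z ^ k) = (\<Sum>k\<le>r. taylor k T * z ^ k) + taylor (Suc r) T * z ^ Suc r"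
    by (simp add: lessThan_Suc_atMost[symmetric] del: power_Suc)
  moreover have "(\<Sum>k\<le>r. c k * z ^ k) = (\<Sum>k\<le>r. taylor k T * z ^ k) - of_real N * z"
  proof -
    have "(\<Sum>k\<le>r. c k * z ^ k) = (\<Sum>k\<le>r. taylor k T * z ^ k) - (\<Sum>k\<le>r. if k = 1 then of_real N * z else 0)"
      unfolding sum_subtractf[symmetric] by (rule sum.cong) (auto simp: c_def algebra_simps)
    then show ?thesis using r by simp
  qed
  ultimately have split: "f z T - of_real N * z = (\<Sum>k\<le>r. c k * z ^ k) + taylor (Suc r) T * z ^ Suc r + tail"
    unfolding tail by simp
  have "(f z T - of_real N * z) * of_real S ^ Suc r - cnj ?M * z ^ Suc r =
      (\<Sum>k\<le>r. c k * z ^ k * of_real S ^ Suc r) + (taylor (Suc r) T * of_real S ^ Suc r - cnj ?M) * z ^ Suc r + tail * of_real S ^ Suc r"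
    unfolding split by (simp add: algebra_simps sum_distrib_left sum_distrib_right)
  also have "norm \<dots> \<le> norm (\<Sum>k\<le>r. c k * z ^ k * of_real S ^ Suc r) +
      norm ((taylor (Suc r) T * of_real S ^ Suc r - cnj ?M) * z ^ Suc r) + norm (tail * of_real S ^ Suc r)"
    by (meson norm_triangle_ineq add_right_mono order.trans)
  also have "\<dots> \<le> (\<Sum>k\<le>r. K / \<alpha>) + (K / \<alpha> + norm ?M * real (Suc r) * m0 / \<alpha>) + (2 * B) ^ Suc r * 4 * B / \<alpha>"
  proof (intro add_mono)
    show "norm (\<Sum>k\<le>r. c k * z ^ k * of_real S ^ Suc r) \<le> (\<Sum>k\<le>r. K / \<alpha>)"
    proof (rule order.trans[OF norm_sum sum_mono])
      fix k assume "k \<in> {..r}"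
      then show "norm (c k * z ^ k * of_real S ^ Suc r) \<le> K / \<alpha>"
        using c[of k] z S0 unfolding norm_mult norm_power norm_of_real by simp
    qed
    show "norm ((taylor (Suc r) T * of_real S ^ Suc r - cnj ?M) * z ^ Suc r) \<le> K / \<alpha> + norm ?M * real (Suc r) * m0 / \<alpha>"
      using main z unfolding norm_mult[of "_ - _"] norm_power by simp
    show "norm (tail * of_real S ^ Suc r) \<le> (2 * B) ^ Suc r * 4 * B / \<alpha>"
      using tail_le S0 unfolding norm_mult norm_power norm_of_real by simp
  qed
  also have "\<dots> = (real (Suc r) * K + K + norm ?M * real (Suc r) * m0 + (2 * B) ^ Suc r * 4 * B) / \<alpha>"
    by (simp add: add_divide_distrib)
  finally show ?thesis by (simp only: S_def N_def \<alpha>_def)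
qed

end

section \<open>Passage to the limit\<close>

lemma Q_nonneg: "T \<ge> 0 \<Longrightarrow> Q T \<ge> 0"
  unfolding accumulated_def
  by (rule Henstock_Kurzweil_Integration.integral_nonneg)
    (auto intro!: integrable_continuous_real continuous_on_subset[OF q_cont] less_imp_le[OF q_pos])

text \<open>On the unit circle the scaled error is at most a fixed constant divided by a(t), which
  also gives the rate of convergence; a tends to infinity because its square is at least 2
  Q.\<close>

theorem asymptotics:
  assumes Q: "filterlim Q at_top at_top" and r: "r \<ge> 1"
    and M: "\<And>k. 1 \<le> k \<Longrightarrow> k < r \<Longrightarrow> harmonic_moment f k 0 = 0"
  shows "((\<lambda>t. SUP z\<in>sphere 0 1.
            cmod ((f z t - csqrt (of_real (2 * Q t) + harmonic_moment f 0 0) * z) *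
                    of_real (sqrt (2 * Q t)) ^ (r + 1) -
                  cnj (harmonic_moment f r 0) * z ^ (r + 1))) \<longlongrightarrow> 0) at_top"
proof -
  obtain B where B: "B > 0"
      "\<forall>z. norm z \<le> 1 \<longrightarrow> norm (f z 0) \<le> B \<and> norm (cnj (f z 0) * (z * D z 0)) \<le> B"
    using initial_bound by blast
  let ?g = "\<lambda>t z. cmod ((f z t - csqrt (of_real (2 * Q t) + harmonic_moment f 0 0) * z) *
      of_real (sqrt (2 * Q t)) ^ (r + 1) - cnj (harmonic_moment f r 0) * z ^ (r + 1))"
  \<comment> \<open>The closing \<open>show\<close> determines the witness: the numerator from
    \<open>final_estimate\<close>, in which neither the time nor the point occurs.\<close>
  obtain C where C: "\<And>T z. T \<ge> 0 \<Longrightarrow> a T \<ge> 4 * sqrt m0 + 1 \<Longrightarrow> a T \<ge> 16 * B + 1 \<Longrightarrow> norm z = 1 \<Longrightarrow> ?g T z \<le> C / a T"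
  proof
    fix T :: real and z :: complex
    assume T: "T \<ge> 0" and large: "a T \<ge> 4 * sqrt m0 + 1" "a T \<ge> 16 * B + 1" and z: "norm z = 1"
    obtain \<phi> where tr: "transition T \<phi>" using transition_exists[OF T] .
    have "csqrt (of_real (2 * Q T) + harmonic_moment f 0 0) = of_real (sqrt (2 * Q T + m0))"
      unfolding harmonic_moment_0_0 of_real_add[symmetric] using Q_nonneg[OF T] m0_nonneg by (intro of_real_sqrt[symmetric]) simp
    then show "?g T z \<le> (real (Suc r) * (B ^ Suc r * 8 ^ Suc r * 16 * B + sqrt m0 * (real (Suc r) * 2 ^ Suc r) * 4 ^ r * norm (harmonic_moment f r 0))
        + (B ^ Suc r * 8 ^ Suc r * 16 * B + sqrt m0 * (real (Suc r) * 2 ^ Suc r) * 4 ^ r * norm (harmonic_moment f r 0))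
        + norm (harmonic_moment f r 0) * real (Suc r) * m0 + (2 * B) ^ Suc r * 4 * B) / a T"
      using final_estimate[OF B(1) _ _ T tr large r M Q_nonneg[OF T] z] B(2) by (simp only: Suc_eq_plus1)
  qed
  have a_top: "filterlim a at_top at_top"
  proof (rule filterlim_at_top_mono)
    show "filterlim (\<lambda>t. sqrt (2 * Q t)) at_top at_top"
      by (intro filterlim_compose[OF sqrt_at_top] filterlim_tendsto_pos_mult_at_top[OF tendsto_const _ Q]) simp
    show "\<forall>\<^sub>F t in at_top. sqrt (2 * Q t) \<le> a t"
      using eventually_ge_at_top[of 0]
    proof eventually_elim
      case (elim t)
      have "2 * Q t \<le> (a t)\<^sup>2" using a_growth[OF elim] zero_le_power2[of "a 0"] by linarith
      then show ?case using a_pos[OF elim] by (intro real_le_lsqrt) auto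
    qed
  qed
  have lim: "((\<lambda>t. C / a t) \<longlongrightarrow> 0) at_top"
    by (rule real_tendsto_divide_at_top[OF tendsto_const a_top])
  show ?thesis
  proof (rule tendsto_sandwich[OF _ _ tendsto_const lim])
    have ev: "\<forall>\<^sub>F t in at_top. \<forall>z\<in>sphere 0 1. ?g t z \<le> C / a t"
      using eventually_ge_at_top[of 0] a_top[unfolded filterlim_at_top, rule_format, of "4 * sqrt m0 + 1"]
        a_top[unfolded filterlim_at_top, rule_format, of "16 * B + 1"]
    proof eventually_elim
      case (elim t)
      then show ?case by (intro ballI C) simp_all
    qed
    then show "\<forall>\<^sub>F t in at_top. (SUP z\<in>sphere 0 1. ?g t z) \<le> C / a t"
    proof eventually_elim
      case (elim t)
      then show ?case by (intro cSUP_least) auto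
    qed
    show "\<forall>\<^sub>F t in at_top. 0 \<le> (SUP z\<in>sphere 0 1. ?g t z)"
      using ev
    proof eventually_elim
      case (elim t)
      \<comment> \<open>Nonnegativity of the supremum is read off at the point 1; \<open>ev\<close>
        supplies the upper bound that makes the real supremum meaningful.\<close>
      have "?g t 1 \<le> (SUP z\<in>sphere 0 1. ?g t z)"
        by (rule cSUP_upper) (use elim in \<open>auto intro!: bdd_aboveI2\<close>)
      then show ?case by (rule order.trans[rotated]) simp
    qed
  qed
qed

end

theorem corollary6p2:
  fixes f :: "complex \<Rightarrow> real \<Rightarrow> complex"
    and q :: "real \<Rightarrow> real"
    and m n l r :: nat
    and \<nu> :: "nat \<Rightarrow> nat"
    and d :: "real \<Rightarrow> nat"
    and b :: "real \<Rightarrow> complex"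
    and \<omega> \<zeta> :: "nat \<Rightarrow> real \<Rightarrow> complex"
    and e :: "nat \<Rightarrow> complex"
    and num c :: "nat \<Rightarrow> real \<Rightarrow> complex"
  assumes "continuous_on {0..} q"
    and "\<And>t. t \<ge> 0 \<Longrightarrow> q t > 0"
    and "filterlim (accumulated q) at_top at_top"
    and "locally_univalent_solution q f"
    and "n = (\<Sum>j=1..l. \<nu> j)"
    and "rational_derivative f m l \<nu> d b \<omega> \<zeta>"
    and "\<And>t j. t \<ge> 0 \<Longrightarrow> j \<in> {1..l} \<Longrightarrow>
           e j = residue (rational_fun (d t) l \<nu> (b t) (\<lambda>k. \<omega> k t) (\<lambda>i. \<zeta> i t)) (\<zeta> j t)"
    and "\<And>t z. t \<ge> 0 \<Longrightarrow>
           (\<Sum>j=0..n-l. c j t * z ^ j) = (\<Prod>j=1..l. (1 - z / \<zeta> j t) ^ (\<nu> j - 1))"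
    and "\<And>t z. t \<ge> 0 \<Longrightarrow> z \<in> cball 0 1 \<Longrightarrow>
           f z t = (\<Sum>j=1..l. e j * Ln (1 - z / \<zeta> j t)) +
                   (\<Sum>j=1..m-l+1. num j t * z ^ j) / (\<Sum>j=0..n-l. c j t * z ^ j)"
    and "r \<ge> 1"
    and "\<And>k. 1 \<le> k \<Longrightarrow> k < r \<Longrightarrow> harmonic_moment f k 0 = 0"
    and "harmonic_moment f r 0 \<noteq> 0"
  shows "((\<lambda>t. SUP z\<in>sphere 0 1.
            cmod ((f z t - csqrt (of_real (2 * accumulated q t) + harmonic_moment f 0 0) * z) *
                    of_real (sqrt (2 * accumulated q t)) ^ (r + 1) -
                  cnj (harmonic_moment f r 0) * z ^ (r + 1)))
          \<longlongrightarrow> 0) at_top"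
proof -
  interpret pg_solution f q
    using assms(1,2,4) by unfold_locales
  show ?thesis by (rule asymptotics[OF assms(3,10,11)])
qed

end
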